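(* Suppose $\mathbf X$ satisfies Assumption (A) with constant $\omega$. Let $l_1,l_3$ be positive integers, $l_2=l_1l_3$, and let $\mathbb S_1\subset\{A_1\in\mathbb R^{d_1\times l_1}:\|A_1\|\le1\}$, $\mathbb S_3\subset\{A_3\in\mathbb R^{d_3\times l_3}:\|A_3\|\le1\}$, $\mathbb S_2\subset\{A_2\in\mathbb R^{l_1\times d_2\times l_3}:\|A_2\|_{\rm F}\le1\}$ be nonempty. For $i=1,2,3$ set $m_i=\min\{\mathtt r_i^2(\Sigma)\,l_i,\ \log|\mathbb S_i|\}$ if $\mathbb S_i$ is finite and $m_i=\mathtt r_i^2(\Sigma)\,l_i$ if $\mathbb S_i$ is infinite. Fix $\delta\in(0,1)$ and suppose $n\ge m_1+m_2+m_3+\log(8/\delta)$. Then with probability at least $1-\delta$, $$\sup_{A_1\in\mathbb S_1,A_2\in\mathbb S_2,A_3\in\mathbb S_3}\langle A_1^\top\times_1A_3^\top\times_3\widehat{\mathcal E},A_2\rangle\le2^7\omega\|\Sigma\|\sqrt{\frac{m_1+m_2+m_3+\log(8/\delta)}{n}}.$$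
   Context: Let $p,q,r$ be positive integers, $d=pqr$, $d_1=p^2$, $d_2=q^2$, $d_3=r^2$. Let $\mathbf X,\mathbf X_1,\dots,\mathbf X_n$ be i.i.d. centered random vectors in $\mathbb R^d$ with positive definite covariance $\Sigma=\mathbb E\mathbf X\mathbf X^\top$, $\widehat\Sigma=\frac1n\sum_i\mathbf X_i\mathbf X_i^\top$. $\|\cdot\|$ is the spectral norm, $\|\cdot\|_{\rm F}$ the Frobenius norm (for tensors: Euclidean norm of entries), $\langle\cdot,\cdot\rangle$ the entrywise inner product of tensors of equal shape. Rearrangement: $\mathcal R:\mathbb R^{d\times d}\to\mathbb R^{d_1\times d_2\times d_3}$, $\mathcal R(A)_{a,b,c}=A_{(\lceil a/p\rceil-1)qr+(\lceil b/q\rceil-1)r+\lceil c/r\rceil,\ ((a-1)\%p)qr+((b-1)\%q)r+(c-1)\%r+1}$, $y\%x$ the residue mod $x$ in $\{0,\dots,x-1\}$. Set $\widehat{\mathcal E}=\mathcal R(\widehat\Sigma)-\mathcal R(\Sigma)$. Mode products: $(M\times_1\mathcal T)_{abc}=\sum_{a'}M_{aa'}\mathcal T_{a'bc}$, $(M\times_3\mathcal T)_{abc}=\sum_{c'}M_{cc'}\mathcal T_{abc'}$; $A\times_1B\times_3\mathcal T=A\times_1(B\times_3\mathcal T)$; thus $A_1^\top\times_1A_3^\top\times_3\widehat{\mathcal E}\in\mathbb R^{l_1\times d_2\times l_3}$. Partial traces and effective dimensions: identify $\mathbb R^d=\mathbb R^p\otimes\mathbb R^q\otimes\mathbb R^r$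 via Kronecker products; ${\rm Tr}_1,{\rm Tr}_2,{\rm Tr}_3$ are partial traces over $\mathbb R^p,\mathbb R^q,\mathbb R^r$ (e.g. ${\rm Tr}_1(X\otimes Y\otimes Z)={\rm Tr}(X)Y\otimes Z$, extended linearly), ${\rm Tr}_{i_1\dots i_k}$ their composition. $\mathtt r_1(\Sigma)=\max\{\|{\rm Tr}_1\Sigma\|/\|\Sigma\|,\|{\rm Tr}_{1,2}\Sigma\|/\|{\rm Tr}_2\Sigma\|\}$, $\mathtt r_2(\Sigma)=\max\{\|{\rm Tr}_2\Sigma\|/\|\Sigma\|,\|{\rm Tr}_{2,3}\Sigma\|/\|{\rm Tr}_3\Sigma\|\}$, $\mathtt r_3(\Sigma)=\max\{\|{\rm Tr}_3\Sigma\|/\|\Sigma\|,\|{\rm Tr}_{1,3}\Sigma\|/\|{\rm Tr}_1\Sigma\|,|{\rm Tr}_{1,2,3}\Sigma|/\|{\rm Tr}_{1,2}\Sigma\|\}$. Assumption (A): there is $\omega>0$ with $\log\mathbb E\exp\{(\Sigma^{-1/2}\mathbf X)^\top V(\Sigma^{-1/2}\mathbf X)-{\rm Tr}V\}\le\omega^2\|V\|_{\rm F}^2$ for all $V\in\mathbb R^{d\times d}$ with $\|V\|_{\rm F}\le1/\omega$. (In the paper the domains are abstract spaces $L_1,L_3$ of dimensions $l_1,l_3$ and $A_2\in L_1\otimes\mathbb R^{d_2}\otimes L_3$; here they are identified with $\mathbb R^{l_1},\mathbb R^{l_3}$ via orthonormal bases.) *)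

theory Defs
  imports "HOL-Probability.Probability"
begin

text \<open>Conventions. Vectors are nat => real, matrices nat => nat => real, order-3 tensors
  nat => nat => nat => real; all indices are 0-based. An m x n matrix only uses the entries
  with i < m, j < n. Sets of matrices/tensors are required to consist of elements that vanish
  outside the index range (so that cardinalities are those of genuine matrices/tensors).\<close>

definition mat_space :: "nat \<Rightarrow> nat \<Rightarrow> (nat \<Rightarrow> nat \<Rightarrow> real) set" where
  "mat_space m n = {A. \<forall>i j. (m \<le> i \<or> n \<le> j) \<longrightarrow> A i j = 0}"

definition tens_space :: "nat \<Rightarrow> nat \<Rightarrow> nat \<Rightarrow> (nat \<Rightarrow> nat \<Rightarrow> nat \<Rightarrow> real) set" where
  "tens_space m n k = {T. \<forall>a b c. (m \<le> a \<or> n \<le> b \<or> k \<le> c) \<longrightarrow> T a b c = 0}"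

definition mat_opnorm :: "nat \<Rightarrow> nat \<Rightarrow> (nat \<Rightarrow> nat \<Rightarrow> real) \<Rightarrow> real" where
  "mat_opnorm m n A = (SUP x\<in>{x::nat\<Rightarrow>real. (\<Sum>j<n. (x j)^2) \<le> 1}.
        sqrt (\<Sum>i<m. (\<Sum>j<n. A i j * x j)^2))"

definition mat_frob :: "nat \<Rightarrow> nat \<Rightarrow> (nat \<Rightarrow> nat \<Rightarrow> real) \<Rightarrow> real" where
  "mat_frob m n A = sqrt (\<Sum>i<m. \<Sum>j<n. (A i j)^2)"

definition tens_frob :: "nat \<Rightarrow> nat \<Rightarrow> nat \<Rightarrow> (nat \<Rightarrow> nat \<Rightarrow> nat \<Rightarrow> real) \<Rightarrow> real" where
  "tens_frob m n k T = sqrt (\<Sum>a<m. \<Sum>b<n. \<Sum>c<k. (T a b c)^2)"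

definition mat_trace :: "nat \<Rightarrow> (nat \<Rightarrow> nat \<Rightarrow> real) \<Rightarrow> real" where
  "mat_trace d A = (\<Sum>i<d. A i i)"

definition matmul :: "nat \<Rightarrow> (nat \<Rightarrow> nat \<Rightarrow> real) \<Rightarrow> (nat \<Rightarrow> nat \<Rightarrow> real) \<Rightarrow> (nat \<Rightarrow> nat \<Rightarrow> real)" where
  "matmul k A B = (\<lambda>i j. \<Sum>l<k. A i l * B l j)"

definition pos_def :: "nat \<Rightarrow> (nat \<Rightarrow> nat \<Rightarrow> real) \<Rightarrow> bool" where
  "pos_def d S \<longleftrightarrow> (\<forall>i<d. \<forall>j<d. S i j = S j i) \<and>
     (\<forall>x::nat\<Rightarrow>real. (\<exists>i<d. x i \<noteq> 0) \<longrightarrow> (\<Sum>i<d. \<Sum>j<d. x i * S i j * x j) > 0)"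

definition pos_semidef :: "nat \<Rightarrow> (nat \<Rightarrow> nat \<Rightarrow> real) \<Rightarrow> bool" where
  "pos_semidef d S \<longleftrightarrow> (\<forall>i<d. \<forall>j<d. S i j = S j i) \<and>
     (\<forall>x::nat\<Rightarrow>real. (\<Sum>i<d. \<Sum>j<d. x i * S i j * x j) \<ge> 0)"

definition inv_sqrt :: "nat \<Rightarrow> (nat \<Rightarrow> nat \<Rightarrow> real) \<Rightarrow> (nat \<Rightarrow> nat \<Rightarrow> real)" where
  "inv_sqrt d S = (THE B. B \<in> mat_space d d \<and> pos_semidef d B \<and>
      (\<forall>i<d. \<forall>j<d. matmul d (matmul d B B) S i j = (if i = j then 1 else 0)))"

text \<open>Partial traces on R^a \<otimes> R^b (Kronecker index i*b + j) and R^a \<otimes> R^b \<otimes> R^c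
  (index i*b*c + j*c + k).\<close>
definition ptr_left :: "nat \<Rightarrow> nat \<Rightarrow> (nat \<Rightarrow> nat \<Rightarrow> real) \<Rightarrow> (nat \<Rightarrow> nat \<Rightarrow> real)" where
  "ptr_left a b S = (\<lambda>j k. \<Sum>i<a. S (i*b + j) (i*b + k))"

definition ptr_right :: "nat \<Rightarrow> nat \<Rightarrow> (nat \<Rightarrow> nat \<Rightarrow> real) \<Rightarrow> (nat \<Rightarrow> nat \<Rightarrow> real)" where
  "ptr_right a b S = (\<lambda>j k. \<Sum>i<b. S (j*b + i) (k*b + i))"

definition ptr_mid :: "nat \<Rightarrow> nat \<Rightarrow> nat \<Rightarrow> (nat \<Rightarrow> nat \<Rightarrow> real) \<Rightarrow> (nat \<Rightarrow> nat \<Rightarrow> real)" where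
  "ptr_mid a b c S = (\<lambda>j k. \<Sum>i<b. S ((j div c)*b*c + i*c + j mod c) ((k div c)*b*c + i*c + k mod c))"

text \<open>Tr_1 (result on R^q \<otimes> R^r), Tr_2 (on R^p \<otimes> R^r), Tr_3 (on R^p \<otimes> R^q) and compositions.\<close>
definition Tr1 where "Tr1 p q r S = ptr_left p (q*r) S"
definition Tr2 where "Tr2 p q r S = ptr_mid p q r S"
definition Tr3 where "Tr3 p q r S = ptr_right (p*q) r S"
definition Tr12 where "Tr12 p q r S = ptr_left p r (Tr2 p q r S)"   \<comment> \<open>on R^r\<close>
definition Tr23 where "Tr23 p q r S = ptr_right p r (Tr2 p q r S)"  \<comment> \<open>on R^p\<close>
definition Tr13 where "Tr13 p q r S = ptr_left p q (Tr3 p q r S)"   \<comment> \<open>on R^q\<close>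
definition Tr123 where "Tr123 p q r S = mat_trace (p*q*r) S"

definition eff_r1 :: "nat \<Rightarrow> nat \<Rightarrow> nat \<Rightarrow> (nat \<Rightarrow> nat \<Rightarrow> real) \<Rightarrow> real" where
  "eff_r1 p q r S = max (mat_opnorm (q*r) (q*r) (Tr1 p q r S) / mat_opnorm (p*q*r) (p*q*r) S)
                        (mat_opnorm r r (Tr12 p q r S) / mat_opnorm (p*r) (p*r) (Tr2 p q r S))"

definition eff_r2 :: "nat \<Rightarrow> nat \<Rightarrow> nat \<Rightarrow> (nat \<Rightarrow> nat \<Rightarrow> real) \<Rightarrow> real" where
  "eff_r2 p q r S = max (mat_opnorm (p*r) (p*r) (Tr2 p q r S) / mat_opnorm (p*q*r) (p*q*r) S)
                        (mat_opnorm p p (Tr23 p q r S) / mat_opnorm (p*q) (p*q) (Tr3 p q r S))"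

definition eff_r3 :: "nat \<Rightarrow> nat \<Rightarrow> nat \<Rightarrow> (nat \<Rightarrow> nat \<Rightarrow> real) \<Rightarrow> real" where
  "eff_r3 p q r S = max (mat_opnorm (p*q) (p*q) (Tr3 p q r S) / mat_opnorm (p*q*r) (p*q*r) S)
                     (max (mat_opnorm q q (Tr13 p q r S) / mat_opnorm (q*r) (q*r) (Tr1 p q r S))
                          (\<bar>Tr123 p q r S\<bar> / mat_opnorm r r (Tr12 p q r S)))"

text \<open>Rearrangement R : R^{d x d} -> R^{p^2 x q^2 x r^2} (0-based version of the paper's formula).\<close>
definition rearr :: "nat \<Rightarrow> nat \<Rightarrow> nat \<Rightarrow> (nat \<Rightarrow> nat \<Rightarrow> real) \<Rightarrow> (nat \<Rightarrow> nat \<Rightarrow> nat \<Rightarrow> real)" where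
  "rearr p q r A = (\<lambda>a b c. A ((a div p)*q*r + (b div q)*r + c div r)
                              ((a mod p)*q*r + (b mod q)*r + c mod r))"

definition contract :: "nat \<Rightarrow> nat \<Rightarrow> nat \<Rightarrow> nat \<Rightarrow> nat \<Rightarrow> (nat \<Rightarrow> nat \<Rightarrow> real) \<Rightarrow>
    (nat \<Rightarrow> nat \<Rightarrow> real) \<Rightarrow> (nat \<Rightarrow> nat \<Rightarrow> nat \<Rightarrow> real) \<Rightarrow> (nat \<Rightarrow> nat \<Rightarrow> nat \<Rightarrow> real) \<Rightarrow> real" where
  "contract d1 d2 d3 l1 l3 A1 A3 E A2 =
     (\<Sum>a<l1. \<Sum>b<d2. \<Sum>c<l3.
        (\<Sum>a'<d1. \<Sum>c'<d3. A1 a' a * A3 c' c * E a' b c') * A2 a b c)"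

definition m_param :: "real \<Rightarrow> nat \<Rightarrow> 'b set \<Rightarrow> real" where
  "m_param ri l S = (if finite S then min (ri^2 * real l) (ln (real (card S))) else ri^2 * real l)"

end

(* PAC-Bayes argument. Put on each tensor factor A_i either the uniform prior on S_i (if the minimum in
   m_i is log |S_i|) or a centred Gaussian prior of variance 1 / (2 rho_i), where rho_1 = r_1^2,
   rho_2 = r_2^2 l_1 l_3, rho_3 = r_3^2. Let Z be the prior average of
   exp (lambda n <Sigma_hat - Sigma, V> - const) over those parameters whose matrix V satisfies
   ||Sigma^(1/2) V Sigma^(1/2)||_F <= 64 ||Sigma||; then Assumption (A) gives E Z <= 1, and Markov's
   inequality yields one event for all A simultaneously. For fixed (A_1, A_2, A_3) a change of measure
   recentres the prior at A at the cost exp (- m_1 - m_2 - m_3). Averaging over the 2^3 sign flips of the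
   three centred perturbations, the trilinear form returns its value at A, so convexity of exp
   bounds Z below by a constant times exp (form(A) - const - m_1 - m_2 - m_3), provided the truncation is
   active with small probability only. The latter is a second moment computation: its eight terms are
   controlled by the partial traces of Sigma, that is, by the effective ranks. *)

theory Submission
  imports Defs
begin

section \<open>Spectral theorem by maximisation over the orthogonal group; the positive root and its
  inverse\<close>

section \<open>Square roots of positive definite matrices\<close>

text \<open>Write mt for m_1 + m_2 + m_3 + log (8 / delta). Assumption (A) reaches only matrices of
  Frobenius norm at most 1 / omega, whereas Gaussian perturbations are unbounded: hence the
  truncation. The scale lambda is set so that on the truncated set omega times the norm is at most
  sqrt (mt / n), which the lower bound on n keeps at most 1; the n observations then cost at most mt
  in the exponent. Truncation in turn blocks the usual entropy form of the change of measure, since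
  the log of a truncated density takes the value minus infinity. Convexity is therefore used at each
  fixed noise value over the eight signs only, and a failure of the truncation at any sign is
  charged to the second moment. The variance 1 / (2 rho_i) lets each perturbation raise the second
  moment by a factor of at most 3/2. rho_2 carries l_1 l_3 because replacing A_2 by noise frees both
  of its outer indices; in return A_2 has squared norm at most 1, while A_1 and A_3 may reach l_1
  and l_3, so all Gaussian costs have the form r_i^2 l_i. The constant 2^7 is 2 * 64: the exponent
  is bounded by 2 mt, namely mt from the moments and mt from the costs and log (8 / delta).\<close>

lemma first_order_zero:
  fixes \<beta> \<kappa> :: real
  assumes "\<And>c s. c^2 + s^2 = 1 \<Longrightarrow> c * s * \<beta> + s^2 * \<kappa> \<le> 0"
  shows "\<beta> = 0"
proof (rule ccontr)
  assume b: "\<beta> \<noteq> 0"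
  \<comment> \<open>\<open>t\<close> is the tangent of the rotation angle, \<open>s = t * c\<close>.
    Taking it proportional to \<beta> makes \<open>t * \<beta>\<close> equal to
    \<open>t^2 * (\<bar>\<kappa>\<bar> + 1)\<close>, which outweighs the second-order term.\<close>
  define t where "t = \<beta> / (\<bar>\<kappa>\<bar> + 1)"
  define c where "c = 1 / sqrt (1 + t^2)"
  have pos: "1 + t^2 > 0" by (simp add: add_pos_nonneg)
  have c2: "c^2 * (1 + t^2) = 1" using pos by (simp add: c_def power_divide)
  have "c^2 + (t*c)^2 = 1" using c2 by (simp add: algebra_simps power_mult_distrib)
  from assms[OF this] have "c^2 * (t * \<beta> + t^2 * \<kappa>) \<le> 0"
    by (simp add: algebra_simps power2_eq_square)
  moreover have "c^2 > 0" using c2 by (metis mult_zero_left power2_eq_square zero_less_power2 zero_neq_one)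
  ultimately have le: "t * \<beta> + t^2 * \<kappa> \<le> 0" by (simp add: mult_le_0_iff)
  have t: "\<beta> = t * (\<bar>\<kappa>\<bar> + 1)" by (simp add: t_def)
  then have "t \<noteq> 0" using b by auto
  have "t * \<beta> + t^2 * \<kappa> = t^2 * (\<bar>\<kappa>\<bar> + 1 + \<kappa>)"
    by (subst t) (simp add: power2_eq_square algebra_simps)
  moreover have "t^2 * (\<bar>\<kappa>\<bar> + 1 + \<kappa>) > 0"
    using \<open>t \<noteq> 0\<close> by (intro mult_pos_pos) auto
  ultimately show False using le by linarith
qed

text \<open>Entries are indexed by pairs so that the matrices live in one product space, where
  compactness comes from Tychonoff's theorem. Rows and columns are both required to be orthonormal,
  which spares the passage from a left to a right inverse; the zeros outside the range keep every
  coordinate bounded.\<close>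

definition ortho :: "nat \<Rightarrow> (nat \<times> nat \<Rightarrow> real) \<Rightarrow> bool" where
  "ortho d x \<longleftrightarrow> (\<forall>i j. d \<le> i \<or> d \<le> j \<longrightarrow> x (i, j) = 0) \<and>
     (\<forall>i<d. \<forall>j<d. (\<Sum>k<d. x (k, i) * x (k, j)) = (if i = j then 1 else 0)) \<and>
     (\<forall>i<d. \<forall>j<d. (\<Sum>k<d. x (i, k) * x (j, k)) = (if i = j then 1 else 0))"

lemma ortho_entry_bound:
  assumes "ortho d x" shows "\<bar>x (i, j)\<bar> \<le> 1"
proof (cases "i < d \<and> j < d")
  case True
  have "(x (i, j))\<^sup>2 \<le> (\<Sum>k<d. (x (k, j))\<^sup>2)"
    using True by (intro member_le_sum) auto
  also have "\<dots> = 1" using assms True by (simp add: ortho_def power2_eq_square)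
  finally show ?thesis by (simp add: abs_square_le_1)
qed (use assms in \<open>auto simp: ortho_def\<close>)

lemma compact_ortho: "compact {x. ortho d x}"
proof -
  let ?B = "Pi\<^sub>E UNIV (\<lambda>k::nat\<times>nat. {-1..1::real})"
  have "compactin (product_topology (\<lambda>k. euclidean) UNIV) ?B"
    by (subst compactin_PiE) auto
  then have cB: "compact ?B"
    by (simp add: euclidean_product_topology)
  have ce: "continuous_on UNIV (\<lambda>x::nat\<times>nat\<Rightarrow>real. x k)" for k
    by (simp add: continuous_on_product_coordinates)
  have "closed {x. ortho d x}"
    unfolding ortho_def
    by (intro closed_Collect_conj closed_Collect_all closed_Collect_imp open_Collect_const
        closed_Collect_eq continuous_intros ce)
  moreover have "{x. ortho d x} \<subseteq> ?B"
  proof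
    fix x assume "x \<in> {x. ortho d x}"
    then have "\<bar>x k\<bar> \<le> 1" for k using ortho_entry_bound[of d x "fst k" "snd k"] by simp
    then have "x k \<in> {-1..1}" for k by (simp add: abs_le_iff minus_le_iff)
    then show "x \<in> ?B" by (simp add: PiE_UNIV_domain)
  qed
  ultimately show ?thesis using cB by (metis compact_Int_closed inf.absorb2)
qed

text \<open>Right multiplication by a Givens rotation in the plane of columns \<open>i\<close> and
  \<open>j\<close>.\<close>

definition rot :: "nat \<Rightarrow> nat \<Rightarrow> real \<Rightarrow> real \<Rightarrow> (nat \<times> nat \<Rightarrow> real) \<Rightarrow> nat \<times> nat \<Rightarrow> real" where
  "rot i j c s x = (\<lambda>(k, m). if m = i then c * x (k, i) + s * x (k, j)
      else if m = j then - s * x (k, i) + c * x (k, j) else x (k, m))"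

lemma sum_split_two:
  fixes f :: "nat \<Rightarrow> real"
  assumes "i < d" "j < d" "i \<noteq> j"
  shows "sum f {..<d} = f i + f j + sum f ({..<d} - {i, j})"
proof -
  have "sum f {..<d} = sum f {i, j} + sum f ({..<d} - {i, j})"
    using assms by (subst sum.subset_diff[of "{i, j}"]) auto
  then show ?thesis using assms by simp
qed

lemma ortho_rot:
  assumes x: "ortho d x" and ij: "i < d" "j < d" "i \<noteq> j" and cs: "c^2 + s^2 = 1"
  shows "ortho d (rot i j c s x)"
  unfolding ortho_def
proof (intro conjI allI impI)
  fix k m assume "d \<le> k \<or> d \<le> m"
  then show "rot i j c s x (k, m) = 0" using x ij by (auto simp: rot_def ortho_def)
next
  fix k m assume km: "k < d" "m < d"
  have col: "(\<Sum>l<d. x (l, a) * x (l, b)) = (if a = b then 1 else 0)" if "a < d" "b < d" for a b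
    using x that by (auto simp: ortho_def)
  have lin: "(\<Sum>l<d. (a1 * x (l, a) + a2 * x (l, b)) * (a3 * x (l, e) + a4 * x (l, f))) =
     a1 * a3 * (\<Sum>l<d. x (l, a) * x (l, e)) + a1 * a4 * (\<Sum>l<d. x (l, a) * x (l, f)) +
     a2 * a3 * (\<Sum>l<d. x (l, b) * x (l, e)) + a2 * a4 * (\<Sum>l<d. x (l, b) * x (l, f))"
    for a1 a2 a3 a4 a b e f
    by (simp add: sum_distrib_left sum.distrib[symmetric] algebra_simps)
  have r: "rot i j c s x (l, m) = (if m = i then c else if m = j then - s else 1) * x (l, if m = j then i else m)
        + (if m = i then s else if m = j then c else 0) * x (l, j)" for l m
    using ij by (auto simp: rot_def)
  show "(\<Sum>l<d. rot i j c s x (l, k) * rot i j c s x (l, m)) = (if k = m then 1 else 0)"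
    unfolding r lin using km ij cs by (auto simp: col power2_eq_square algebra_simps)
next
  fix k m assume km: "k < d" "m < d"
  have "(\<Sum>l<d. rot i j c s x (k, l) * rot i j c s x (m, l)) =
     (c * x (k, i) + s * x (k, j)) * (c * x (m, i) + s * x (m, j)) +
     (- s * x (k, i) + c * x (k, j)) * (- s * x (m, i) + c * x (m, j)) +
     (\<Sum>l\<in>{..<d} - {i, j}. x (k, l) * x (m, l))"
    using ij by (subst sum_split_two[OF ij]) (auto simp: rot_def intro!: sum.cong)
  also have "\<dots> = (c^2 + s^2) * (x (k, i) * x (m, i) + x (k, j) * x (m, j)) +
     (\<Sum>l\<in>{..<d} - {i, j}. x (k, l) * x (m, l))"
    by (simp add: power2_eq_square algebra_simps)
  also have "\<dots> = (\<Sum>l<d. x (k, l) * x (m, l))"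
    using cs by (subst sum_split_two[OF ij]) simp
  finally show "(\<Sum>l<d. rot i j c s x (k, l) * rot i j c s x (m, l)) = (if k = m then 1 else 0)"
    using x km by (auto simp: ortho_def)
qed

text \<open>Brockett's trick: at a maximiser of \<open>tr (D O\<^sup>T S O)\<close> over orthogonal \<open>O\<close>, with \<open>D\<close> diagonal
  with distinct entries, stationarity under plane rotations forces \<open>O\<^sup>T S O\<close> to be diagonal.\<close>

lemma symmetric_diagonalisation:
  fixes S :: "nat \<Rightarrow> nat \<Rightarrow> real"
  assumes sym: "\<And>i j. i < d \<Longrightarrow> j < d \<Longrightarrow> S i j = S j i"
  shows "\<exists>x. ortho d x \<and>
    (\<forall>i<d. \<forall>j<d. i \<noteq> j \<longrightarrow> (\<Sum>k<d. \<Sum>l<d. x (k, i) * S k l * x (l, j)) = 0)"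
proof -
  define A where "A = (\<lambda>(x :: nat \<times> nat \<Rightarrow> real) i j. \<Sum>k<d. \<Sum>l<d. x (k, i) * S k l * x (l, j))"
  define f where "f = (\<lambda>x. \<Sum>i<d. real i * A x i i)"
  have ce: "continuous_on UNIV (\<lambda>x::nat\<times>nat\<Rightarrow>real. x k)" for k
    by (simp add: continuous_on_product_coordinates)
  have "continuous_on {x. ortho d x} f"
    unfolding f_def A_def
    by (intro continuous_intros continuous_on_subset[OF ce]) auto
  moreover have "ortho d (\<lambda>(i, j). if i = j \<and> i < d then 1 else 0)"
    unfolding ortho_def
  proof (intro conjI allI impI, goal_cases)
    case (2 i j)
    have "(\<Sum>k<d. (if k = i \<and> k < d then 1 else 0) * (if k = j \<and> k < d then 1 else 0)) =
          (\<Sum>k<d. if k = i then (if i = j then 1 else 0) else (0::real))"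
      using 2 by (intro sum.cong) auto
    then show ?case using 2 by simp
  next
    case (3 i j)
    have "(\<Sum>k<d. (if i = k \<and> i < d then 1 else 0) * (if j = k \<and> j < d then 1 else 0)) =
          (\<Sum>k<d. if k = i then (if i = j then 1 else 0) else (0::real))"
      using 3 by (intro sum.cong) auto
    then show ?case using 3 by simp
  qed auto
  ultimately obtain x where x: "ortho d x" and mx: "\<And>y. ortho d y \<Longrightarrow> f y \<le> f x"
    using continuous_attains_sup[OF compact_ortho[of d], of f] by blast
  have Asym: "A x j i = A x i j" for i j
    unfolding A_def by (subst sum.swap) (intro sum.cong refl, simp add: sym mult_ac)
  have "A x i j = 0" if ij: "i < d" "j < d" "i \<noteq> j" for i j
  proof -
    have "c * s * (2 * (real i - real j) * A x i j) + s^2 * ((real i - real j) * (A x j j - A x i i)) \<le> 0"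
      if cs: "c^2 + s^2 = 1" for c s
    proof -
      let ?y = "rot i j c s x"
      have lin: "(\<Sum>k<d. \<Sum>l<d. (a1 * x (k, i) + a2 * x (k, j)) * S k l * (a1 * x (l, i) + a2 * x (l, j)))
        = a1^2 * A x i i + 2 * a1 * a2 * A x i j + a2^2 * A x j j" for a1 a2
      proof -
        have "(\<Sum>k<d. \<Sum>l<d. (a1 * x (k, i) + a2 * x (k, j)) * S k l * (a1 * x (l, i) + a2 * x (l, j)))
          = a1^2 * A x i i + a1 * a2 * A x i j + a1 * a2 * A x j i + a2^2 * A x j j"
          unfolding A_def
          by (simp add: sum_distrib_left sum.distrib[symmetric] algebra_simps power2_eq_square)
        then show ?thesis using Asym by simp
      qed
      have yi: "A ?y i i = c^2 * A x i i + 2 * c * s * A x i j + s^2 * A x j j"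
        unfolding lin[symmetric] by (simp add: A_def rot_def)
      have yj: "A ?y j j = s^2 * A x i i - 2 * c * s * A x i j + c^2 * A x j j"
        using lin[of "- s" c] ij by (simp add: A_def rot_def)
      have rest: "A ?y m m = A x m m" if "m \<in> {..<d} - {i, j}" for m
        using that by (simp add: A_def rot_def)
      have "f ?y - f x = real i * (A ?y i i - A x i i) + real j * (A ?y j j - A x j j)"
        unfolding f_def by (subst (1 2) sum_split_two[OF ij]) (simp add: rest algebra_simps)
      \<comment> \<open>The multiple of \<open>c^2 + s^2 - 1\<close> is kept so that the identity is
        polynomial in \<open>c\<close> and \<open>s\<close>; it vanishes on rotations.\<close>
      also have "\<dots> = c * s * (2 * (real i - real j) * A x i j) + s^2 * ((real i - real j) * (A x j j - A x i i))
          + (c^2 + s^2 - 1) * (real i * A x i i + real j * A x j j)"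
        unfolding yi yj by (simp add: algebra_simps power2_eq_square)
      finally show ?thesis using mx[OF ortho_rot[OF x ij cs]] cs by simp
    qed
    \<comment> \<open>Stationarity gives \<open>2 * (real i - real j) * A x i j = 0\<close>, and the
      weights of \<open>f\<close> are pairwise distinct.\<close>
    from first_order_zero[OF this] show ?thesis using ij by simp
  qed
  then show ?thesis using x unfolding A_def by blast
qed

text \<open>\<open>inv_sqrt\<close> is a definite description, so it says nothing until its solution
  is known to be unique. Existence comes from the eigenbasis, uniqueness from the absence of
  negative eigenvalues of a positive semidefinite matrix; afterwards only its symmetry and its being
  a left inverse of \<open>R\<close> are kept.\<close>

lemma pos_def_sqrt:
  assumes pd: "pos_def d S"
  shows "\<exists>R. (\<forall>i j. R i j = R j i) \<and> (\<forall>i<d. \<forall>j<d. S i j = (\<Sum>m<d. R i m * R j m)) \<and>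
    (\<forall>i j. inv_sqrt d S i j = inv_sqrt d S j i) \<and>
    (\<forall>i<d. \<forall>j<d. (\<Sum>k<d. inv_sqrt d S i k * R k j) = (if i = j then 1 else 0))"
proof -
  have sym: "S i j = S j i" if "i < d" "j < d" for i j using pd that by (auto simp: pos_def_def)
  obtain x where x: "ortho d x"
    and diag: "\<And>i j. i < d \<Longrightarrow> j < d \<Longrightarrow> i \<noteq> j \<Longrightarrow> (\<Sum>k<d. \<Sum>l<d. x (k, i) * S k l * x (l, j)) = 0"
    using symmetric_diagonalisation[of d S, OF sym] by auto
  have col: "(\<Sum>k<d. x (k, i) * x (k, j)) = (if i = j then 1 else 0)" if "i < d" "j < d" for i j
    using x that by (auto simp: ortho_def)
  have row: "(\<Sum>k<d. x (i, k) * x (j, k)) = (if i = j then 1 else 0)" if "i < d" "j < d" for i j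
    using x that by (auto simp: ortho_def)
  have zero: "x (i, j) = 0" if "d \<le> i \<or> d \<le> j" for i j using x that by (auto simp: ortho_def)
  define ev where "ev = (\<lambda>i. \<Sum>k<d. \<Sum>l<d. x (k, i) * S k l * x (l, i))"
  have ev_pos: "ev m > 0" if "m < d" for m
  proof -
    have "\<exists>k<d. x (k, m) \<noteq> 0"
    proof (rule ccontr)
      assume "\<not> ?thesis"
      then have "(\<Sum>k<d. x (k, m) * x (k, m)) = 0" by (intro sum.neutral) auto
      then show False using col[OF that that] by simp
    qed
    moreover have "\<forall>v. (\<exists>i<d. v i \<noteq> 0) \<longrightarrow> (\<Sum>i<d. \<Sum>j<d. v i * S i j * v j) > 0"
      using pd by (simp add: pos_def_def)
    ultimately show ?thesis unfolding ev_def by (elim allE[where x = "\<lambda>k. x (k, m)"]) simp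
  qed
  have coef: "v i = (\<Sum>m<d. (\<Sum>k<d. x (k, m) * v k) * x (i, m))" if "i < d" for v i
  proof -
    have "(\<Sum>m<d. (\<Sum>k<d. x (k, m) * v k) * x (i, m)) = (\<Sum>k<d. v k * (\<Sum>m<d. x (k, m) * x (i, m)))"
      unfolding sum_distrib_left sum_distrib_right
      by (subst sum.swap) (simp add: mult_ac)
    also have "\<dots> = (\<Sum>k<d. if k = i then v k else 0)" using that by (intro sum.cong) (auto simp: row)
    finally show ?thesis using that by simp
  qed
  have eig: "(\<Sum>l<d. S i l * x (l, m)) = ev m * x (i, m)" if "i < d" "m < d" for i m
  proof -
    have "(\<Sum>l<d. S i l * x (l, m)) = (\<Sum>m'<d. (\<Sum>k<d. x (k, m') * (\<Sum>l<d. S k l * x (l, m))) * x (i, m'))"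
      using coef[OF that(1), of "\<lambda>i. \<Sum>l<d. S i l * x (l, m)"] .
    also have "\<dots> = (\<Sum>m'<d. if m' = m then ev m * x (i, m) else 0)"
      using that by (intro sum.cong refl) (auto simp: ev_def sum_distrib_left mult.assoc diag[simplified mult.assoc])
    finally show ?thesis using that by simp
  qed
  \<comment> \<open>Functional calculus: \<open>h\<close> acts on the spectrum while the
    eigenvectors stay, so products of such matrices become products of the functions.\<close>
  define F where "F = (\<lambda>(h :: nat \<Rightarrow> real) i j. \<Sum>m<d. x (i, m) * h m * x (j, m))"
  have Fsym: "F h i j = F h j i" for h i j unfolding F_def by (intro sum.cong) (auto simp: mult_ac)
  have Feig: "(\<Sum>l<d. F h i l * x (l, m)) = h m * x (i, m)" if "m < d" for h i m
  proof -
    have "(\<Sum>l<d. F h i l * x (l, m)) = (\<Sum>m'<d. x (i, m') * h m' * (\<Sum>l<d. x (l, m') * x (l, m)))"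
      unfolding F_def sum_distrib_right sum_distrib_left by (subst sum.swap) (simp add: mult_ac)
    also have "\<dots> = (\<Sum>m'<d. if m' = m then h m * x (i, m) else 0)"
      using that by (intro sum.cong refl) (auto simp: col)
    finally show ?thesis using that by simp
  qed
  have expand: "P i j = F h i j" if "i < d" "j < d"
    and "\<And>m. m < d \<Longrightarrow> (\<Sum>l<d. P i l * x (l, m)) = h m * x (i, m)" for P h i j
  proof -
    have "P i j = (\<Sum>m<d. (\<Sum>k<d. x (k, m) * P i k) * x (j, m))" by (rule coef) fact
    also have "\<dots> = F h i j" unfolding F_def
      by (intro sum.cong refl) (simp add: that(3)[symmetric] mult_ac)
    finally show ?thesis .
  qed
  have FF: "(\<Sum>k<d. F h i k * F h' k j) = F (\<lambda>m. h m * h' m) i j" if "i < d" "j < d" for h h' i j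
  proof (rule expand[OF that])
    fix m assume m: "m < d"
    have "(\<Sum>l<d. (\<Sum>k<d. F h i k * F h' k l) * x (l, m)) = (\<Sum>k<d. F h i k * (\<Sum>l<d. F h' k l * x (l, m)))"
      unfolding sum_distrib_right sum_distrib_left by (subst sum.swap) (simp add: mult_ac)
    also have "\<dots> = (\<Sum>k<d. F h i k * (h' m * x (k, m)))"
      by (simp add: Feig m)
    also have "\<dots> = h' m * (\<Sum>k<d. F h i k * x (k, m))"
      by (simp add: sum_distrib_left mult_ac)
    finally show "(\<Sum>l<d. (\<Sum>k<d. F h i k * F h' k l) * x (l, m)) = h m * h' m * x (i, m)"
      by (simp add: Feig m)
  qed
  have SF: "S i j = F ev i j" if "i < d" "j < d" for i j
    using that eig by (intro expand) auto
  have F1: "F h i j = (if i = j then 1 else 0)" if "i < d" "j < d" "\<And>m. m < d \<Longrightarrow> h m = 1" for h i j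
    using row[OF that(1,2)] that(3) by (simp add: F_def)
  define R where "R = F (\<lambda>m. sqrt (ev m))"
  define B where "B = F (\<lambda>m. 1 / sqrt (ev m))"
  have "inv_sqrt d S = B"
    unfolding inv_sqrt_def
  proof (rule the_equality, intro conjI allI impI)
    show "B \<in> mat_space d d" by (auto simp: mat_space_def B_def F_def zero)
    show "pos_semidef d B"
      unfolding pos_semidef_def
    proof (intro conjI allI impI)
      fix i j show "B i j = B j i" unfolding B_def by (rule Fsym)
    next
      fix v :: "nat \<Rightarrow> real"
      let ?f = "\<lambda>i j m. 1 / sqrt (ev m) * ((v i * x (i, m)) * (v j * x (j, m)))"
      have "(\<Sum>i<d. \<Sum>j<d. v i * B i j * v j) = (\<Sum>i<d. \<Sum>j<d. \<Sum>m<d. ?f i j m)"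
        unfolding B_def F_def by (simp add: sum_distrib_left sum_distrib_right mult_ac)
      also have "\<dots> = (\<Sum>i<d. \<Sum>m<d. \<Sum>j<d. ?f i j m)"
        by (intro sum.cong refl sum.swap)
      also have "\<dots> = (\<Sum>m<d. \<Sum>i<d. \<Sum>j<d. ?f i j m)"
        by (rule sum.swap)
      also have "\<dots> = (\<Sum>m<d. 1 / sqrt (ev m) * (\<Sum>i<d. v i * x (i, m))\<^sup>2)"
        by (simp only: power2_eq_square sum_product) (simp only: sum_distrib_left)
      also have "\<dots> \<ge> 0" using ev_pos by (intro sum_nonneg mult_nonneg_nonneg) (auto simp: less_imp_le)
      finally show "0 \<le> (\<Sum>i<d. \<Sum>j<d. v i * B i j * v j)" .
    qed
    fix i j assume ij: "i < d" "j < d"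
    have "matmul d (matmul d B B) S i j = (\<Sum>l<d. F (\<lambda>m. 1 / sqrt (ev m) * (1 / sqrt (ev m))) i l * F ev l j)"
      unfolding matmul_def B_def using ij by (intro sum.cong refl) (simp add: FF SF)
    also have "\<dots> = F (\<lambda>m. 1 / sqrt (ev m) * (1 / sqrt (ev m)) * ev m) i j" by (rule FF[OF ij])
    also have "\<dots> = (if i = j then 1 else 0)"
      using ij ev_pos by (intro F1) (auto simp: less_imp_le less_imp_neq[symmetric])
    finally show "matmul d (matmul d B B) S i j = (if i = j then 1 else 0)" .
  next
    fix C assume C: "C \<in> mat_space d d \<and> pos_semidef d C \<and>
      (\<forall>i<d. \<forall>j<d. matmul d (matmul d C C) S i j = (if i = j then 1 else 0))"
    have eigC: "(\<Sum>l<d. C i l * x (l, m)) = 1 / sqrt (ev m) * x (i, m)" if "i < d" "m < d" for i m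
    proof -
      let ?\<mu> = "1 / sqrt (ev m)"
      define C1 where "C1 = (\<lambda>i. \<Sum>l<d. C i l * x (l, m))"
      \<comment> \<open>For the eigenvector \<open>x\<close> the equation on \<open>C\<close> gives
        \<open>C C x = \<mu>^2 x\<close>, hence \<open>C y = - \<mu> y\<close> for
        \<open>y = C x - \<mu> x\<close>. As the quadratic form of \<open>C\<close> is nonnegative
        and \<mu> is positive, \<open>y\<close> must vanish.\<close>
      define y where "y = (\<lambda>i. C1 i - ?\<mu> * x (i, m))"
      have \<mu>: "?\<mu> > 0" using ev_pos[OF that(2)] by simp
      have C2: "(\<Sum>l<d. C i l * C1 l) = ?\<mu>\<^sup>2 * x (i, m)" if i: "i < d" for i
      proof -
        have "x (i, m) = (\<Sum>j<d. matmul d (matmul d C C) S i j * x (j, m))"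
        proof -
          have "(\<Sum>j<d. matmul d (matmul d C C) S i j * x (j, m)) = (\<Sum>j<d. if j = i then x (j, m) else 0)"
            using C i by (intro sum.cong refl) simp
          then show ?thesis using i by simp
        qed
        also have "\<dots> = (\<Sum>k<d. matmul d C C i k * (\<Sum>j<d. S k j * x (j, m)))"
          unfolding matmul_def[of _ _ S] sum_distrib_left sum_distrib_right
          by (subst sum.swap) (simp add: mult_ac)
        also have "\<dots> = (\<Sum>k<d. matmul d C C i k * (ev m * x (k, m)))"
          using \<open>m < d\<close> by (simp add: eig)
        also have "\<dots> = ev m * (\<Sum>k<d. matmul d C C i k * x (k, m))"
          by (simp add: sum_distrib_left mult_ac)
        also have "(\<Sum>k<d. matmul d C C i k * x (k, m)) = (\<Sum>l<d. C i l * C1 l)"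
          unfolding matmul_def C1_def sum_distrib_left sum_distrib_right
          by (subst sum.swap) (simp add: mult_ac)
        finally show ?thesis using ev_pos[OF \<open>m < d\<close>]
          by (simp add: power_divide less_imp_le field_simps)
      qed
      have "(\<Sum>l<d. C i l * y l) = - ?\<mu> * y i" if i: "i < d" for i
      proof -
        have "(\<Sum>l<d. C i l * y l) = (\<Sum>l<d. C i l * C1 l) - ?\<mu> * C1 i"
          by (simp add: y_def C1_def right_diff_distrib sum_subtractf sum_distrib_left mult_ac)
        then show ?thesis using C2[OF i] by (simp add: y_def power2_eq_square algebra_simps)
      qed
      then have "(\<Sum>i<d. \<Sum>l<d. y i * C i l * y l) = (\<Sum>i<d. - ?\<mu> * (y i)\<^sup>2)"
        (is "?L = _")
      proof -
        assume *: "\<And>i. i < d \<Longrightarrow> (\<Sum>l<d. C i l * y l) = - ?\<mu> * y i"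
        have "?L = (\<Sum>i<d. y i * (\<Sum>l<d. C i l * y l))" by (simp add: sum_distrib_left mult.assoc)
        also have "\<dots> = (\<Sum>i<d. - ?\<mu> * (y i)\<^sup>2)"
          by (intro sum.cong refl) (simp add: * power2_eq_square)
        finally show ?thesis .
      qed
      moreover have "(\<Sum>i<d. \<Sum>l<d. y i * C i l * y l) \<ge> 0" using C by (auto simp: pos_semidef_def)
      ultimately have "?\<mu> * (\<Sum>i<d. (y i)\<^sup>2) \<le> 0"
        by (simp add: sum_negf sum_distrib_left)
      then have "(\<Sum>i<d. (y i)\<^sup>2) \<le> 0" using \<mu> by (simp only: mult_le_0_iff) auto
      then have "(\<Sum>i<d. (y i)\<^sup>2) = 0" by (intro antisym sum_nonneg) auto
      then have "y i = 0" using that by (subst (asm) sum_nonneg_eq_0_iff) auto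
      then show ?thesis by (simp add: y_def C1_def)
    qed
    show "C = B"
    proof (intro ext)
      fix i j show "C i j = B i j"
      proof (cases "i < d \<and> j < d")
        case True
        then show ?thesis unfolding B_def using eigC by (intro expand) auto
      next
        case False
        then show ?thesis using C by (auto simp: mat_space_def B_def F_def zero)
      qed
    qed
  qed
  moreover have "R i j = R j i" "B i j = B j i" for i j unfolding R_def B_def by (rule Fsym)+
  moreover have "S i j = (\<Sum>m<d. R i m * R j m)" if "i < d" "j < d" for i j
  proof -
    have "(\<Sum>m<d. R i m * R j m) = (\<Sum>m<d. R i m * R m j)" using \<open>\<And>i j. R i j = R j i\<close> by simp
    also have "\<dots> = F (\<lambda>m. sqrt (ev m) * sqrt (ev m)) i j" unfolding R_def by (rule FF[OF that])
    also have "\<dots> = F ev i j" unfolding F_def using ev_pos by (intro sum.cong) (auto simp: less_imp_le)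
    finally show ?thesis using SF[OF that] by simp
  qed
  moreover have "(\<Sum>k<d. B i k * R k j) = (if i = j then 1 else 0)" if "i < d" "j < d" for i j
    unfolding R_def B_def FF[OF that] using that ev_pos
    by (intro F1) (auto simp: less_imp_neq[symmetric])
  ultimately show ?thesis by (intro exI[of _ R]) auto
qed

section \<open>Change of measure for the priors: Cameron-Martin shift, reflection, second
  moments\<close>

section \<open>Gaussian and uniform priors\<close>

abbreviation (input) RPi :: "'k set \<Rightarrow> ('k \<Rightarrow> real) measure" where
  "RPi I \<equiv> PiM I (\<lambda>_. borel)"

text \<open>What is used of a perturbation: its law is symmetric, with mean zero and covariance
  \<open>s\<close> times the identity, the latter expressed through squares of affine functionals.
  With \<open>s = 0\<close> this includes the point mass at 0, which accompanies a uniform prior on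
  a finite set.\<close>

definition noise :: "'k set \<Rightarrow> real \<Rightarrow> ('k \<Rightarrow> real) measure \<Rightarrow> bool" where
  "noise I s \<gamma> \<longleftrightarrow> prob_space \<gamma> \<and> sets \<gamma> = sets (RPi I) \<and>
    (\<forall>F. F \<in> borel_measurable (RPi I) \<longrightarrow>
       (\<integral>\<^sup>+g. F (\<lambda>k\<in>I. - g k) \<partial>\<gamma>) = (\<integral>\<^sup>+g. (F g :: ennreal) \<partial>\<gamma>)) \<and>
    (\<forall>c v. (\<integral>\<^sup>+g. ennreal ((c + (\<Sum>k\<in>I. g k * v k))\<^sup>2) \<partial>\<gamma>) = ennreal (c\<^sup>2 + s * (\<Sum>k\<in>I. (v k)\<^sup>2)))"

abbreviation gauss :: "real \<Rightarrow> real measure" where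
  "gauss \<sigma> \<equiv> density lborel (normal_density 0 \<sigma>)"

abbreviation gaussn :: "'k set \<Rightarrow> real \<Rightarrow> ('k \<Rightarrow> real) measure" where
  "gaussn I \<sigma> \<equiv> PiM I (\<lambda>_. gauss \<sigma>)"

lemma sets_gaussn: "sets (gaussn I \<sigma>) = sets (RPi I)"
  by (intro sets_PiM_cong) simp_all

lemma product_sigma_finite_gauss: "0 < \<sigma> \<Longrightarrow> product_sigma_finite (\<lambda>_::'k. gauss \<sigma>)"
  by (auto simp: product_sigma_finite_def intro!: prob_space_imp_sigma_finite prob_space_normal_density)

lemma emeasure_gaussn: "0 < \<sigma> \<Longrightarrow> emeasure (gaussn I \<sigma>) (space (gaussn I \<sigma>)) = 1"
  by (intro prob_space.emeasure_space_1 prob_space_PiM prob_space_normal_density)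

text \<open>Cameron-Martin in one dimension: completing the square in the shifted density leaves a
  linear exponent in \<open>x\<close>, which is odd and will cancel under sign flips, and a
  quadratic constant, which is the cost of recentring.\<close>

lemma gauss_shift:
  assumes \<sigma>: "0 < \<sigma>" and [measurable]: "F \<in> borel_measurable borel"
  shows "(\<integral>\<^sup>+x. F x \<partial>gauss \<sigma>) =
    (\<integral>\<^sup>+x. F (a + x) * ennreal (exp (- (a / \<sigma>\<^sup>2) * x - a\<^sup>2 / (2 * \<sigma>\<^sup>2))) \<partial>gauss \<sigma>)"
proof -
  let ?e = "\<lambda>x. exp (- (a / \<sigma>\<^sup>2) * x - a\<^sup>2 / (2 * \<sigma>\<^sup>2))"
  have "(\<integral>\<^sup>+x. F x \<partial>gauss \<sigma>) = (\<integral>\<^sup>+x. ennreal (normal_density 0 \<sigma> x) * F x \<partial>lborel)"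
    by (simp add: nn_integral_density)
  also have "\<dots> = (\<integral>\<^sup>+x. ennreal (normal_density 0 \<sigma> (a + x)) * F (a + x) \<partial>lborel)"
    using nn_integral_real_affine[of "\<lambda>x. ennreal (normal_density 0 \<sigma> x) * F x" 1 a] by simp
  also have "\<dots> = (\<integral>\<^sup>+x. ennreal (normal_density 0 \<sigma> x) *
      (F (a + x) * ennreal (?e x)) \<partial>lborel)"
  proof (intro nn_integral_cong)
    fix x
    have "- (a + x - 0)\<^sup>2 / (2 * \<sigma>\<^sup>2) = - (x - 0)\<^sup>2 / (2 * \<sigma>\<^sup>2) + (- (a / \<sigma>\<^sup>2) * x - a\<^sup>2 / (2 * \<sigma>\<^sup>2))"
      using \<sigma> by (simp add: field_simps power2_eq_square)
    then have "normal_density 0 \<sigma> (a + x) = normal_density 0 \<sigma> x * ?e x"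
      unfolding normal_density_def by (simp only: exp_add mult.assoc)
    then show "ennreal (normal_density 0 \<sigma> (a + x)) * F (a + x) = ennreal (normal_density 0 \<sigma> x) *
      (F (a + x) * ennreal (?e x))"
      by (simp add: ennreal_mult mult_ac)
  qed
  also have "\<dots> = (\<integral>\<^sup>+x. F (a + x) * ennreal (?e x) \<partial>gauss \<sigma>)"
    by (simp add: nn_integral_density)
  finally show ?thesis .
qed

lemma gauss_flip:
  assumes [measurable]: "F \<in> borel_measurable borel"
  shows "(\<integral>\<^sup>+x. F (- x) \<partial>gauss \<sigma>) = (\<integral>\<^sup>+x. F x \<partial>gauss \<sigma>)"
  using nn_integral_real_affine[of "\<lambda>x. ennreal (normal_density 0 \<sigma> x) * F x" "-1" 0]
  by (simp add: nn_integral_density normal_density_def)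

lemma gauss_square:
  assumes \<sigma>: "0 < \<sigma>"
  shows "(\<integral>\<^sup>+x. ennreal ((c + x * v)\<^sup>2) \<partial>gauss \<sigma>) = ennreal (c\<^sup>2 + \<sigma>\<^sup>2 * v\<^sup>2)"
proof -
  have "has_bochner_integral lborel (\<lambda>x. c\<^sup>2 * (normal_density 0 \<sigma> x * (x - 0) ^ (2 * 0)) + 2 * c * v * (normal_density 0 \<sigma> x * (x - 0) ^ (2 * 0 + 1))
     + v\<^sup>2 * (normal_density 0 \<sigma> x * (x - 0) ^ (2 * 1)))
     (c\<^sup>2 * (fact (2 * 0) / ((2 / \<sigma>\<^sup>2) ^ 0 * fact 0)) + 2 * c * v * 0 + v\<^sup>2 * (fact (2 * 1) / ((2 / \<sigma>\<^sup>2)^1 * fact 1)))"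
    by (intro has_bochner_integral_add has_bochner_integral_mult_right normal_moment_even normal_moment_odd \<sigma>)
  then have "has_bochner_integral lborel (\<lambda>x. normal_density 0 \<sigma> x * (c + x * v)\<^sup>2) (c\<^sup>2 + \<sigma>\<^sup>2 * v\<^sup>2)"
    by (simp add: power2_eq_square algebra_simps)
  then have "(\<integral>\<^sup>+x. ennreal (normal_density 0 \<sigma> x * (c + x * v)\<^sup>2) \<partial>lborel) = ennreal (c\<^sup>2 + \<sigma>\<^sup>2 * v\<^sup>2)"
    by (subst nn_integral_eq_integral) (auto simp: has_bochner_integral_iff)
  then show ?thesis by (simp add: nn_integral_density ennreal_mult)
qed

lemma measurable_coord_map:
  fixes \<phi> :: "'k \<Rightarrow> real \<Rightarrow> real"
  assumes "\<And>k. \<phi> k \<in> borel_measurable borel"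
  shows "(\<lambda>g. \<lambda>k\<in>I. \<phi> k (g k)) \<in> RPi I \<rightarrow>\<^sub>M RPi I"
  using assms by (intro measurable_restrict measurable_compose[OF measurable_component_singleton]) auto

lemma measurable_coord_add:
  fixes A :: "'k \<Rightarrow> real"
  shows "(\<lambda>g. \<lambda>k\<in>I. A k + g k) \<in> RPi I \<rightarrow>\<^sub>M RPi I"
  using measurable_coord_map[of "\<lambda>k x. A k + x"] by simp

text \<open>Tensorises a one-dimensional change of variables, splitting off one coordinate by Fubini
  at each step, so that the densities multiply. Both the shift (with its exponential density) and
  the reflection (with density 1) are instances.\<close>

lemma gaussn_substitution:
  fixes \<phi> :: "'k \<Rightarrow> real \<Rightarrow> real" and \<rho> :: "'k \<Rightarrow> real \<Rightarrow> ennreal"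
  assumes I: "finite I" and \<sigma>: "0 < \<sigma>"
    and m [measurable]: "\<And>k. \<phi> k \<in> borel_measurable borel" "\<And>k. \<rho> k \<in> borel_measurable borel"
    and one: "\<And>k F. F \<in> borel_measurable borel \<Longrightarrow> (\<integral>\<^sup>+x. F x \<partial>gauss \<sigma>) = (\<integral>\<^sup>+x. F (\<phi> k x) * \<rho> k x \<partial>gauss \<sigma>)"
    and "F \<in> borel_measurable (RPi I)"
  shows "(\<integral>\<^sup>+g. F g \<partial>gaussn I \<sigma>) = (\<integral>\<^sup>+g. F (\<lambda>k\<in>I. \<phi> k (g k)) * (\<Prod>k\<in>I. \<rho> k (g k)) \<partial>gaussn I \<sigma>)"
  using I assms(6)
proof (induction I arbitrary: F rule: finite_induct)
  case empty
  interpret product_sigma_finite "\<lambda>_::'k. gauss \<sigma>" by (rule product_sigma_finite_gauss[OF \<sigma>])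
  show ?case by (simp add: nn_integral_empty emeasure_gaussn[OF \<sigma>])
next
  case (insert i I)
  interpret product_sigma_finite "\<lambda>_::'k. gauss \<sigma>" by (rule product_sigma_finite_gauss[OF \<sigma>])
  note [measurable_cong] = sets_gaussn
  have [measurable]: "F \<in> borel_measurable (RPi (insert i I))" by fact
  have upd: "(\<lambda>(x, y). x(i := y)) \<in> RPi I \<Otimes>\<^sub>M borel \<rightarrow>\<^sub>M RPi (insert i I)"
    using measurable_add_dim[of i I "\<lambda>_. borel :: real measure"] by (simp add: split_beta')
  have Fm: "(\<lambda>(x, y). F (x(i := y))) \<in> borel_measurable (RPi I \<Otimes>\<^sub>M borel)"
    using measurable_compose[OF upd \<open>F \<in> _\<close>] by (simp add: split_beta')
  have Fm1: "(\<lambda>y. F (x(i := y))) \<in> borel_measurable borel" if "x \<in> space (RPi I)" for x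
    using measurable_Pair2[OF Fm that] by simp
  have "(\<integral>\<^sup>+g. F g \<partial>gaussn (insert i I) \<sigma>) = (\<integral>\<^sup>+x. (\<integral>\<^sup>+y. F (x(i := y)) \<partial>gauss \<sigma>) \<partial>gaussn I \<sigma>)"
    by (rule product_nn_integral_insert[OF insert(1,2)]) simp
  also have "\<dots> = (\<integral>\<^sup>+x. (\<integral>\<^sup>+y. F (x(i := \<phi> i y)) * \<rho> i y \<partial>gauss \<sigma>) \<partial>gaussn I \<sigma>)"
    using Fm1 by (intro nn_integral_cong one) (simp add: space_PiM)
  \<comment> \<open>The new coordinate has been substituted inside; the induction hypothesis is now
    applied to the whole inner integral as a function of the old coordinates.\<close>
  also have "\<dots> = (\<integral>\<^sup>+x. (\<integral>\<^sup>+y. F ((\<lambda>k\<in>I. \<phi> k (x k))(i := \<phi> i y)) * \<rho> i y \<partial>gauss \<sigma>) * (\<Prod>k\<in>I. \<rho> k (x k)) \<partial>gaussn I \<sigma>)"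
  proof (rule insert.IH)
    have "(\<lambda>(x, y). (x, \<phi> i y)) \<in> RPi I \<Otimes>\<^sub>M borel \<rightarrow>\<^sub>M RPi I \<Otimes>\<^sub>M borel"
      by measurable
    from measurable_compose[OF this Fm]
    have "(\<lambda>(x, y). F (x(i := \<phi> i y))) \<in> borel_measurable (RPi I \<Otimes>\<^sub>M borel)"
      by (simp add: split_beta')
    then have "(\<lambda>(x, y). F (x(i := \<phi> i y)) * \<rho> i y) \<in> borel_measurable (RPi I \<Otimes>\<^sub>M gauss \<sigma>)"
      by measurable
    then show "(\<lambda>x. \<integral>\<^sup>+y. F (x(i := \<phi> i y)) * \<rho> i y \<partial>gauss \<sigma>) \<in> borel_measurable (RPi I)"
      by (intro sigma_finite_measure.borel_measurable_nn_integral sigma_finite_measures)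
  qed
  also have "\<dots> = (\<integral>\<^sup>+x. (\<integral>\<^sup>+y. F (\<lambda>k\<in>insert i I. \<phi> k ((x(i := y)) k)) * (\<Prod>k\<in>insert i I. \<rho> k ((x(i := y)) k)) \<partial>gauss \<sigma>) \<partial>gaussn I \<sigma>)"
  proof (rule nn_integral_cong)
    fix x assume x: "x \<in> space (gaussn I \<sigma>)"
    have e1: "(\<lambda>k\<in>I. \<phi> k (x k))(i := \<phi> i y) = (\<lambda>k\<in>insert i I. \<phi> k ((x(i := y)) k))" for y
      using insert(2) by (auto simp: fun_eq_iff restrict_def)
    have e2: "\<rho> i y * (\<Prod>k\<in>I. \<rho> k (x k)) = (\<Prod>k\<in>insert i I. \<rho> k ((x(i := y)) k))" for y
    proof -
      have "(\<Prod>k\<in>I. \<rho> k ((x(i := y)) k)) = (\<Prod>k\<in>I. \<rho> k (x k))"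
        using insert(2) by (intro prod.cong) auto
      then show ?thesis using insert(1,2) by simp
    qed
    have "(\<lambda>k\<in>I. \<phi> k (x k)) \<in> space (RPi I)" by (simp add: space_PiM)
    from measurable_compose[OF m(1) Fm1[OF this]]
    show "(\<integral>\<^sup>+y. F ((\<lambda>k\<in>I. \<phi> k (x k))(i := \<phi> i y)) * \<rho> i y \<partial>gauss \<sigma>) * (\<Prod>k\<in>I. \<rho> k (x k)) =
        (\<integral>\<^sup>+y. F (\<lambda>k\<in>insert i I. \<phi> k ((x(i := y)) k)) * (\<Prod>k\<in>insert i I. \<rho> k ((x(i := y)) k)) \<partial>gauss \<sigma>)"
      by (subst nn_integral_multc[symmetric]) (measurable, simp only: mult.assoc e1 e2)
  qed
  also have "\<dots> = (\<integral>\<^sup>+g. F (\<lambda>k\<in>insert i I. \<phi> k (g k)) * (\<Prod>k\<in>insert i I. \<rho> k (g k)) \<partial>gaussn (insert i I) \<sigma>)"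
    by (rule product_nn_integral_insert[OF insert(1,2), symmetric])
      (use measurable_compose[OF measurable_coord_map[OF m(1)] \<open>F \<in> _\<close>] in measurable)
  finally show ?case .
qed

lemma gaussn_shift:
  assumes "finite I" "0 < \<sigma>" "F \<in> borel_measurable (RPi I)"
  shows "(\<integral>\<^sup>+g. F g \<partial>gaussn I \<sigma>) = (\<integral>\<^sup>+g. F (\<lambda>k\<in>I. A k + g k) *
    ennreal (exp (- (\<Sum>k\<in>I. A k / \<sigma>\<^sup>2 * g k) - (\<Sum>k\<in>I. (A k)\<^sup>2) / (2 * \<sigma>\<^sup>2))) \<partial>gaussn I \<sigma>)"
proof -
  have "(\<integral>\<^sup>+g. F g \<partial>gaussn I \<sigma>) = (\<integral>\<^sup>+g. F (\<lambda>k\<in>I. A k + g k) *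
    (\<Prod>k\<in>I. ennreal (exp (- (A k / \<sigma>\<^sup>2) * g k - (A k)\<^sup>2 / (2 * \<sigma>\<^sup>2)))) \<partial>gaussn I \<sigma>)"
    by (rule gaussn_substitution[OF assms(1,2) _ _ gauss_shift[OF assms(2)] assms(3)]) measurable
  then show ?thesis
    by (simp add: prod_ennreal exp_sum[OF assms(1), symmetric] sum_subtractf sum_negf sum_divide_distrib)
qed

lemma gaussn_flip:
  assumes "finite I" "0 < \<sigma>" "F \<in> borel_measurable (RPi I)"
  shows "(\<integral>\<^sup>+g. F (\<lambda>k\<in>I. - g k) \<partial>gaussn I \<sigma>) = (\<integral>\<^sup>+g. F g \<partial>gaussn I \<sigma>)"
  using gaussn_substitution[OF assms(1,2) _ _ _ assms(3), of "\<lambda>_. uminus" "\<lambda>_ _. 1"] by (simp add: gauss_flip)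

lemma gaussn_square:
  assumes I: "finite I" and \<sigma>: "0 < \<sigma>"
  shows "(\<integral>\<^sup>+g. ennreal ((c + (\<Sum>k\<in>I. g k * v k))\<^sup>2) \<partial>gaussn I \<sigma>) = ennreal (c\<^sup>2 + \<sigma>\<^sup>2 * (\<Sum>k\<in>I. (v k)\<^sup>2))"
  using I
proof (induction I arbitrary: c rule: finite_induct)
  case empty
  interpret product_sigma_finite "\<lambda>_::'a. gauss \<sigma>" by (rule product_sigma_finite_gauss[OF \<sigma>])
  show ?case by (simp add: nn_integral_empty emeasure_gaussn[OF \<sigma>])
next
  case (insert i I)
  interpret product_sigma_finite "\<lambda>_::'a. gauss \<sigma>" by (rule product_sigma_finite_gauss[OF \<sigma>])
  note [measurable_cong] = sets_gaussn
  have pI: "prob_space (gaussn I \<sigma>)" by (intro prob_space_PiM prob_space_normal_density \<sigma>)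
  have "(\<integral>\<^sup>+g. ennreal ((c + (\<Sum>k\<in>insert i I. g k * v k))\<^sup>2) \<partial>gaussn (insert i I) \<sigma>)
    = (\<integral>\<^sup>+x. (\<integral>\<^sup>+y. ennreal ((c + (\<Sum>k\<in>insert i I. (x(i := y)) k * v k))\<^sup>2) \<partial>gauss \<sigma>) \<partial>gaussn I \<sigma>)"
    by (rule product_nn_integral_insert[OF insert(1,2)]) measurable
  also have "\<dots> = (\<integral>\<^sup>+x. (\<integral>\<^sup>+y. ennreal (((c + (\<Sum>k\<in>I. x k * v k)) + y * v i)\<^sup>2) \<partial>gauss \<sigma>) \<partial>gaussn I \<sigma>)"
  proof -
    have "(\<Sum>k\<in>I. (x(i := y)) k * v k) = (\<Sum>k\<in>I. x k * v k)" for x :: "'a \<Rightarrow> real" and y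
      using insert(2) by (intro sum.cong) auto
    then show ?thesis using insert(1,2) by (simp add: algebra_simps)
  qed
  also have "\<dots> = (\<integral>\<^sup>+x. ennreal ((c + (\<Sum>k\<in>I. x k * v k))\<^sup>2) + ennreal (\<sigma>\<^sup>2 * (v i)\<^sup>2) \<partial>gaussn I \<sigma>)"
    by (simp add: gauss_square[OF \<sigma>] ennreal_plus)
  also have "\<dots> = (\<integral>\<^sup>+x. ennreal ((c + (\<Sum>k\<in>I. x k * v k))\<^sup>2) \<partial>gaussn I \<sigma>) + ennreal (\<sigma>\<^sup>2 * (v i)\<^sup>2)"
    by (subst nn_integral_add) (auto simp: prob_space.emeasure_space_1[OF pI])
  also have "\<dots> = ennreal (c\<^sup>2 + \<sigma>\<^sup>2 * (\<Sum>k\<in>I. (v k)\<^sup>2)) + ennreal (\<sigma>\<^sup>2 * (v i)\<^sup>2)"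
    by (simp add: insert.IH)
  also have "\<dots> = ennreal (c\<^sup>2 + \<sigma>\<^sup>2 * (\<Sum>k\<in>insert i I. (v k)\<^sup>2))"
    using insert(1,2)
    by (simp add: ennreal_plus[symmetric] sum_nonneg algebra_simps del: ennreal_plus)
  finally show ?case .
qed

lemma noise_gaussn:
  assumes "finite I" "0 < \<sigma>"
  shows "noise I (\<sigma>\<^sup>2) (gaussn I \<sigma>)"
  unfolding noise_def
  by (intro conjI allI impI prob_space_PiM prob_space_normal_density sets_gaussn gaussn_flip gaussn_square assms)

lemma noise_zero:
  assumes "finite I"
  shows "noise I 0 (return (RPi I) (\<lambda>k\<in>I. 0))"
proof -
  let ?z = "\<lambda>k\<in>I. 0 :: real"
  have sp: "?z \<in> space (RPi I)" by (simp add: space_PiM)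
  have flip: "(\<lambda>g :: _ \<Rightarrow> real. \<lambda>k\<in>I. - g k) \<in> RPi I \<rightarrow>\<^sub>M RPi I"
    using measurable_coord_map[of "\<lambda>_. uminus"] by simp
  have z: "(\<lambda>k\<in>I. - (if k \<in> I then 0 else undefined)) = ?z" by (auto simp: fun_eq_iff)
  have "(\<lambda>g. ennreal ((c + (\<Sum>k\<in>I. g k * v k))\<^sup>2)) \<in> borel_measurable (RPi I)" for c v
    by measurable
  then show ?thesis unfolding noise_def
    using sp measurable_compose[OF flip]
    by (auto intro!: prob_space_return simp: nn_integral_return z)
qed

abbreviation pert :: "'k set \<Rightarrow> ('k \<Rightarrow> real) \<Rightarrow> ('k \<Rightarrow> real) \<Rightarrow> 'k \<Rightarrow> real" where
  "pert I A g \<equiv> (\<lambda>k\<in>I. A k + g k)"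

text \<open>The prior \<open>\<mu>\<close> dominates the law of \<open>A\<close> plus noise \<open>\<gamma>\<close>, up to a log-density consisting of the cost \<open>m\<close>
  and of a linear term, which disappears under symmetrisation.\<close>

definition recentres where
  "recentres I \<gamma> m A L \<mu> \<longleftrightarrow> (\<forall>F. F \<in> borel_measurable (RPi I) \<longrightarrow>
    (\<integral>\<^sup>+g. F (pert I A g) * ennreal (exp (- (\<Sum>k\<in>I. L k * g k) - m)) \<partial>\<gamma>) \<le> (\<integral>\<^sup>+x. F x \<partial>\<mu>))"

lemma recentresD:
  "recentres I \<gamma> m A L \<mu> \<Longrightarrow> F \<in> borel_measurable (RPi I) \<Longrightarrow>
    (\<integral>\<^sup>+g. F (pert I A g) * ennreal (exp (- (\<Sum>k\<in>I. L k * g k) - m)) \<partial>\<gamma>) \<le> (\<integral>\<^sup>+x. F x \<partial>\<mu>)"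
  by (simp add: recentres_def)

text \<open>The two branches follow the minimum in the cost. The uniform prior gives each element
  mass \<open>1 / card S\<close>, hence cost \<open>ln (card S)\<close> with no noise at all. The
  Gaussian of variance \<open>1 / (2 * \<rho>)\<close> is shifted at a cost of \<rho> times the
  squared norm, at most \<open>\<rho> * R\<close>. Either way \<open>s * \<rho> \<le> 1 / 2\<close>,
  which is the link to the second moment bound.\<close>

lemma prior_exists:
  fixes e :: "'b \<Rightarrow> 'k \<Rightarrow> real"
  assumes I: "finite I" and S: "S \<noteq> {}" and \<rho>: "0 < \<rho>"
    and R: "\<And>A. A \<in> S \<Longrightarrow> (\<Sum>k\<in>I. (e A k)\<^sup>2) \<le> R"
  shows "\<exists>\<mu> \<gamma> s. prob_space \<mu> \<and> sets \<mu> = sets (RPi I) \<and> noise I s \<gamma> \<and>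
    0 \<le> s \<and> s * \<rho> \<le> 1 / 2 \<and> (\<forall>A\<in>S. \<exists>L. recentres I \<gamma> (if finite S then min (\<rho> * R) (ln (real (card S))) else \<rho> * R) (e A) L \<mu>)"
    (is "\<exists>\<mu> \<gamma> s. _ \<and> _ \<and> _ \<and> _ \<and> _ \<and> ?P \<mu> \<gamma>")
proof (cases "finite S \<and> ln (real (card S)) \<le> \<rho> * R")
  case True
  then have fin: "finite S" and m: "min (\<rho> * R) (ln (real (card S))) = ln (real (card S))" by auto
  define r where "r = (\<lambda>A. \<lambda>k\<in>I. e A k)"
  define \<mu> where "\<mu> = distr (uniform_count_measure S) (RPi I) r"
  define \<gamma> where "\<gamma> = return (RPi I) (\<lambda>k\<in>I. 0::real)"
  have rm: "r \<in> uniform_count_measure S \<rightarrow>\<^sub>M RPi I"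
    by (auto simp: measurable_def r_def space_PiM space_uniform_count_measure sets_uniform_count_measure)
  have "prob_space \<mu>" unfolding \<mu>_def
    using fin S rm by (intro prob_space.prob_space_distr prob_space_uniform_count_measure)
  moreover have "?P \<mu> \<gamma>"
  proof
    fix A assume A: "A \<in> S"
    have "(\<integral>\<^sup>+g. F (\<lambda>k\<in>I. e A k + g k) * ennreal (exp (- (\<Sum>k\<in>I. 0 * g k) - ln (real (card S)))) \<partial>\<gamma>) \<le> (\<integral>\<^sup>+x. F x \<partial>\<mu>)" (is "?l \<le> _")
      if [measurable]: "F \<in> borel_measurable (RPi I)" for F
    proof -
      have c: "0 < card S" using fin S by (simp add: card_gt_0_iff)
      have sp: "(\<lambda>k\<in>I. 0 :: real) \<in> space (RPi I)" by (simp add: space_PiM)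
      have "(\<lambda>g. \<lambda>k\<in>I. e A k + g k) \<in> RPi I \<rightarrow>\<^sub>M RPi I"
        by (rule measurable_coord_add)
      from measurable_compose[OF this \<open>F \<in> _\<close>]
      have "(\<lambda>g. F (\<lambda>k\<in>I. e A k + g k) * ennreal (exp (- (\<Sum>k\<in>I. 0 * g k) - ln (real (card S))))) \<in> borel_measurable (RPi I)"
        by measurable
      then have "?l
         = F (\<lambda>k\<in>I. e A k + (\<lambda>k\<in>I. 0) k) * ennreal (1 / real (card S))"
        unfolding \<gamma>_def using sp c by (subst nn_integral_return) (auto simp: exp_minus inverse_eq_divide)
      also have "(\<lambda>k\<in>I. e A k + (\<lambda>k\<in>I. 0) k) = r A" by (auto simp: r_def fun_eq_iff)
      \<comment> \<open>The other atoms contribute nonnegatively, so a single one is a lower bound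
        for the sum.\<close>
      also have "F (r A) * ennreal (1 / real (card S)) \<le> (\<Sum>B\<in>S. F (r B)) * ennreal (1 / real (card S))"
        using fin A by (intro mult_right_mono member_le_sum) auto
      also have "\<dots> = (\<integral>\<^sup>+x. F x \<partial>\<mu>)"
        unfolding \<mu>_def using rm fin c
        by (simp add: nn_integral_distr uniform_count_measure_def nn_integral_point_measure_finite sum_distrib_left sum_distrib_right mult_ac divide_ennreal_def ennreal_of_nat_eq_real_of_nat inverse_ennreal divide_inverse)
      finally show ?thesis .
    qed
    then show "\<exists>L. recentres I \<gamma> (if finite S then min (\<rho> * R) (ln (real (card S))) else \<rho> * R) (e A) L \<mu>"
      using fin m by (intro exI[of _ "\<lambda>_. 0"]) (simp add: recentres_def)
  qed
  ultimately show ?thesis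
    using noise_zero[OF I] by (intro exI[of _ \<mu>] exI[of _ \<gamma>] exI[of _ 0]) (auto simp: \<mu>_def \<gamma>_def)
next
  case False
  then have m: "(if finite S then min (\<rho> * R) (ln (real (card S))) else \<rho> * R) = \<rho> * R" by auto
  define \<sigma> where "\<sigma> = sqrt (1 / (2 * \<rho>))"
  have \<sigma>: "0 < \<sigma>" and \<sigma>2: "\<sigma>\<^sup>2 = 1 / (2 * \<rho>)" using \<rho> by (auto simp: \<sigma>_def)
  have "?P (gaussn I \<sigma>) (gaussn I \<sigma>)"
  proof
    fix A assume A: "A \<in> S"
    have "(\<Sum>k\<in>I. (e A k)\<^sup>2) / (2 * \<sigma>\<^sup>2) \<le> \<rho> * R" using R[OF A] \<rho> by (simp add: \<sigma>2)
    then show "\<exists>L. recentres I (gaussn I \<sigma>) (if finite S then min (\<rho> * R) (ln (real (card S))) else \<rho> * R) (e A) L (gaussn I \<sigma>)"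
      unfolding m recentres_def
      by (intro exI[of _ "\<lambda>k. e A k / \<sigma>\<^sup>2"] allI impI, subst gaussn_shift[OF I \<sigma>, of _ "e A"])
        (auto intro!: nn_integral_mono mult_left_mono ennreal_leI)
  qed
  then show ?thesis
    using noise_gaussn[OF I \<sigma>] \<rho> by (intro exI[of _ "gaussn I \<sigma>"] exI[of _ "\<sigma>\<^sup>2"])
      (auto simp: sets_gaussn \<sigma>2 noise_def)
qed

section \<open>Frobenius bounds through the norm of a Gram matrix, and regrouping of index
  sums\<close>

section \<open>Operator norms and Gram families\<close>

text \<open>A supremum of reals is an upper bound only for a bounded set; the Frobenius norm
  provides the bound by Cauchy-Schwarz.\<close>

lemma mat_opnorm_bdd:
  "bdd_above ((\<lambda>x. sqrt (\<Sum>i<m. (\<Sum>j<n. A i j * x j)\<^sup>2)) ` {x::nat\<Rightarrow>real. (\<Sum>j<n. (x j)\<^sup>2) \<le> 1})"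
proof (rule bdd_aboveI2)
  fix x :: "nat \<Rightarrow> real" assume "x \<in> {x. (\<Sum>j<n. (x j)\<^sup>2) \<le> 1}"
  then have x: "(\<Sum>j<n. (x j)\<^sup>2) \<le> 1" by simp
  have "(\<Sum>j<n. A i j * x j)\<^sup>2 \<le> (\<Sum>j<n. (A i j)\<^sup>2)" for i
    using Cauchy_Schwarz_ineq_sum[of "A i" x "{..<n}"] mult_left_mono[OF x, of "\<Sum>j<n. (A i j)\<^sup>2"]
    by (simp add: sum_nonneg)
  then show "sqrt (\<Sum>i<m. (\<Sum>j<n. A i j * x j)\<^sup>2) \<le> sqrt (\<Sum>i<m. \<Sum>j<n. (A i j)\<^sup>2)"
    by (intro real_sqrt_le_mono sum_mono) auto
qed

lemma mat_opnorm_upper: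
  "(\<Sum>j<n. (x j)\<^sup>2) \<le> 1 \<Longrightarrow> sqrt (\<Sum>i<m. (\<Sum>j<n. A i j * x j)\<^sup>2) \<le> mat_opnorm m n A"
  unfolding mat_opnorm_def by (rule cSUP_upper[OF _ mat_opnorm_bdd]) simp

lemma mat_opnorm_nonneg: "0 \<le> mat_opnorm m n A"
  using mat_opnorm_upper[where n = n and x = "\<lambda>_. 0" and m = m and A = A] by simp

lemma mat_opnorm_bound:
  "(\<Sum>i<m. (\<Sum>j<n. A i j * x j)\<^sup>2) \<le> (mat_opnorm m n A)\<^sup>2 * (\<Sum>j<n. (x j)\<^sup>2)"
proof (cases "(\<Sum>j<n. (x j)\<^sup>2) = 0")
  case True
  then have "x j = 0" if "j < n" for j using that by (subst (asm) sum_nonneg_eq_0_iff) auto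
  then show ?thesis by simp
next
  case False
  define c where "c = sqrt (\<Sum>j<n. (x j)\<^sup>2)"
  have c2: "c\<^sup>2 = (\<Sum>j<n. (x j)\<^sup>2)" by (simp add: c_def sum_nonneg)
  then have c: "c\<^sup>2 > 0" using False by (simp add: sum_nonneg less_le)
  have "(\<Sum>j<n. (x j / c)\<^sup>2) = 1"
    using c c2 by (simp add: power_divide sum_divide_distrib[symmetric])
  then have "sqrt (\<Sum>i<m. (\<Sum>j<n. A i j * (x j / c))\<^sup>2) \<le> mat_opnorm m n A"
    by (intro mat_opnorm_upper) simp
  then have "(\<Sum>i<m. (\<Sum>j<n. A i j * (x j / c))\<^sup>2) \<le> (mat_opnorm m n A)\<^sup>2"
    using sqrt_le_D by blast
  then show ?thesis using c
    by (simp add: sum_divide_distrib[symmetric] power_divide c2[symmetric] divide_le_eq)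
qed

lemma quadratic_form_le:
  "(\<Sum>i<n. \<Sum>j<n. y i * P i j * y j) \<le> mat_opnorm n n P * (\<Sum>i<n. (y i)\<^sup>2)"
proof -
  have "(\<Sum>i<n. \<Sum>j<n. y i * P i j * y j)\<^sup>2 = (\<Sum>i<n. y i * (\<Sum>j<n. P i j * y j))\<^sup>2"
    by (simp add: sum_distrib_left mult.assoc)
  also have "\<dots> \<le> (\<Sum>i<n. (y i)\<^sup>2) * (\<Sum>i<n. (\<Sum>j<n. P i j * y j)\<^sup>2)"
    by (rule Cauchy_Schwarz_ineq_sum)
  also have "\<dots> \<le> (\<Sum>i<n. (y i)\<^sup>2) * ((mat_opnorm n n P)\<^sup>2 * (\<Sum>j<n. (y j)\<^sup>2))"
    by (intro mult_left_mono mat_opnorm_bound sum_nonneg) auto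
  also have "\<dots> = (mat_opnorm n n P * (\<Sum>i<n. (y i)\<^sup>2))\<^sup>2" by (simp add: power2_eq_square)
  finally show ?thesis
    by (rule power2_le_imp_le) (intro mult_nonneg_nonneg mat_opnorm_nonneg sum_nonneg, auto)
qed

lemma diag_entry_le_opnorm:
  assumes "k < n" shows "P k k \<le> mat_opnorm n n P"
proof -
  have "(\<Sum>j<n. (if i = k then 1 else 0) * P i j * (if j = k then 1 else 0)) = (if i = k then P k k else 0)" for i
    using assms by (simp add: if_distrib cong: if_cong)
  moreover have "(\<Sum>i<n. (if i = k then 1 else 0 :: real)\<^sup>2) = 1"
  proof -
    have "(if i = k then 1 else 0 :: real)\<^sup>2 = (if i = k then 1 else 0)" for i by simp
    then show ?thesis using assms by simp
  qed
  ultimately show ?thesis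
    using quadratic_form_le[where n = n and P = P and y = "\<lambda>i. if i = k then 1 else 0"] assms by simp
qed

text \<open>With \<open>U\<close> the matrix whose rows are the \<open>u k\<close>, \<open>P\<close>
  is the Gram matrix \<open>U^T U\<close>, flattened by \<phi>, and the left side is the squared
  Frobenius norm of \<open>U W U^T\<close>. Multiplying by \<open>U\<close> on either side costs at
  most the norm of \<open>P\<close>. The effective-rank estimates are instances in which
  \<open>K\<close> collects the freely summed indices.\<close>

lemma gram_bilinear_bound:
  fixes u :: "'k \<Rightarrow> 'j \<Rightarrow> real" and W :: "'j \<Rightarrow> 'j \<Rightarrow> real"
  assumes fin: "finite K" "finite J" and \<phi>: "bij_betw \<phi> J {..<N}"
    and P: "\<And>i j. i \<in> J \<Longrightarrow> j \<in> J \<Longrightarrow> P (\<phi> i) (\<phi> j) = (\<Sum>k\<in>K. u k i * u k j)"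
  shows "(\<Sum>k\<in>K. \<Sum>k'\<in>K. (\<Sum>i\<in>J. \<Sum>j\<in>J. W i j * (u k i * u k' j))\<^sup>2)
    \<le> (mat_opnorm N N P)\<^sup>2 * (\<Sum>i\<in>J. \<Sum>j\<in>J. (W i j)\<^sup>2)"
proof -
  let ?c = "mat_opnorm N N P"
  have le: "(\<Sum>k\<in>K. (\<Sum>j\<in>J. u k j * x j)\<^sup>2) \<le> ?c * (\<Sum>j\<in>J. (x j)\<^sup>2)" for x
  proof -
    let ?y = "\<lambda>n. x (the_inv_into J \<phi> n)"
    have y: "?y (\<phi> j) = x j" if "j \<in> J" for j
      using \<phi> that by (simp add: bij_betw_def the_inv_into_f_f)
    have "(\<Sum>k\<in>K. (\<Sum>j\<in>J. u k j * x j)\<^sup>2) = (\<Sum>k\<in>K. \<Sum>i\<in>J. \<Sum>j\<in>J. x i * (u k i * u k j) * x j)"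
      by (simp add: power2_eq_square sum_product mult_ac)
    also have "\<dots> = (\<Sum>i\<in>J. \<Sum>k\<in>K. \<Sum>j\<in>J. x i * (u k i * u k j) * x j)" by (rule sum.swap)
    also have "\<dots> = (\<Sum>i\<in>J. \<Sum>j\<in>J. \<Sum>k\<in>K. x i * (u k i * u k j) * x j)"
      by (intro sum.cong refl sum.swap)
    also have "\<dots> = (\<Sum>i\<in>J. \<Sum>j\<in>J. ?y (\<phi> i) * P (\<phi> i) (\<phi> j) * ?y (\<phi> j))"
      by (intro sum.cong refl) (simp add: y P sum_distrib_left sum_distrib_right)
    also have "\<dots> = (\<Sum>i<N. \<Sum>j<N. ?y i * P i j * ?y j)"
      unfolding sum.reindex_bij_betw[OF \<phi>, of "\<lambda>j. ?y i * P i j * ?y j" for i]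
        sum.reindex_bij_betw[OF \<phi>, of "\<lambda>i. \<Sum>j<N. ?y i * P i j * ?y j"] ..
    also have "\<dots> \<le> ?c * (\<Sum>i<N. (?y i)\<^sup>2)" by (rule quadratic_form_le)
    also have "(\<Sum>i<N. (?y i)\<^sup>2) = (\<Sum>j\<in>J. (?y (\<phi> j))\<^sup>2)"
      by (rule sum.reindex_bij_betw[OF \<phi>, symmetric])
    finally show ?thesis by (simp add: y cong: sum.cong)
  qed
  have inner: "(\<Sum>i\<in>J. \<Sum>j\<in>J. W i j * (u k i * u k' j)) = (\<Sum>j\<in>J. u k' j * (\<Sum>i\<in>J. u k i * W i j))" for k k'
  proof -
    have "(\<Sum>i\<in>J. \<Sum>j\<in>J. W i j * (u k i * u k' j)) = (\<Sum>j\<in>J. \<Sum>i\<in>J. W i j * (u k i * u k' j))"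
      by (rule sum.swap)
    then show ?thesis by (simp add: sum_distrib_left mult_ac)
  qed
  have "(\<Sum>k\<in>K. \<Sum>k'\<in>K. (\<Sum>i\<in>J. \<Sum>j\<in>J. W i j * (u k i * u k' j))\<^sup>2) =
        (\<Sum>k\<in>K. \<Sum>k'\<in>K. (\<Sum>j\<in>J. u k' j * (\<Sum>i\<in>J. u k i * W i j))\<^sup>2)"
    by (simp only: inner)
  \<comment> \<open>The right factor \<open>U^T\<close> is removed for each \<open>k\<close>; after
    the exchange of sums the left factor goes for each \<open>j\<close>.\<close>
  also have "\<dots> \<le> (\<Sum>k\<in>K. ?c * (\<Sum>j\<in>J. (\<Sum>i\<in>J. u k i * W i j)\<^sup>2))"
    by (intro sum_mono le)
  also have "\<dots> = ?c * (\<Sum>j\<in>J. \<Sum>k\<in>K. (\<Sum>i\<in>J. u k i * W i j)\<^sup>2)"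
    unfolding sum_distrib_left by (rule sum.swap)
  also have "\<dots> \<le> ?c * (\<Sum>j\<in>J. ?c * (\<Sum>i\<in>J. (W i j)\<^sup>2))"
    by (intro mult_left_mono sum_mono le mat_opnorm_nonneg)
  also have "\<dots> = ?c\<^sup>2 * (\<Sum>j\<in>J. \<Sum>i\<in>J. (W i j)\<^sup>2)"
    by (simp add: sum_distrib_left power2_eq_square mult_ac)
  also have "(\<Sum>j\<in>J. \<Sum>i\<in>J. (W i j)\<^sup>2) = (\<Sum>i\<in>J. \<Sum>j\<in>J. (W i j)\<^sup>2)" by (rule sum.swap)
  finally show ?thesis .
qed

text \<open>The rearrangement at the level of sums: row and column parts are paired per tensor
  factor on one side, and collected into a row and a column multi-index on the other.\<close>

lemma sum_regroup2:
  fixes h :: "'x \<times> 'x \<Rightarrow> 'y \<times> 'y \<Rightarrow> 'r :: comm_monoid_add"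
  shows "(\<Sum>x\<in>X \<times> X. \<Sum>y\<in>Y \<times> Y. h x y) =
    (\<Sum>u\<in>X \<times> Y. \<Sum>v\<in>X \<times> Y. h (fst u, fst v) (snd u, snd v))"
proof -
  have "(\<Sum>x\<in>X \<times> X. \<Sum>y\<in>Y \<times> Y. h x y) = (\<Sum>x\<in>X. \<Sum>x'\<in>X. \<Sum>y\<in>Y. \<Sum>y'\<in>Y. h (x, x') (y, y'))"
    by (simp add: sum.cartesian_product')
  also have "\<dots> = (\<Sum>x\<in>X. \<Sum>y\<in>Y. \<Sum>x'\<in>X. \<Sum>y'\<in>Y. h (x, x') (y, y'))"
    by (intro sum.cong refl sum.swap)
  also have "\<dots> = (\<Sum>u\<in>X \<times> Y. \<Sum>v\<in>X \<times> Y. h (fst u, fst v) (snd u, snd v))"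
    by (simp add: sum.cartesian_product')
  finally show ?thesis .
qed

lemma sum_regroup3:
  fixes h :: "'x \<times> 'x \<Rightarrow> 'y \<times> 'y \<Rightarrow> 'z \<times> 'z \<Rightarrow> 'r :: comm_monoid_add"
  shows "(\<Sum>x\<in>X \<times> X. \<Sum>y\<in>Y \<times> Y. \<Sum>z\<in>Z \<times> Z. h x y z) =
    (\<Sum>u\<in>X \<times> Y \<times> Z. \<Sum>v\<in>X \<times> Y \<times> Z. h (fst u, fst v) (fst (snd u), fst (snd v)) (snd (snd u), snd (snd v)))"
proof -
  have "(\<Sum>x\<in>X \<times> X. \<Sum>y\<in>Y \<times> Y. \<Sum>z\<in>Z \<times> Z. h x y z) =
    (\<Sum>x\<in>X \<times> X. \<Sum>u\<in>Y \<times> Z. \<Sum>v\<in>Y \<times> Z. h x (fst u, fst v) (snd u, snd v))"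
    by (intro sum.cong refl sum_regroup2)
  also have "\<dots> = (\<Sum>x\<in>X \<times> X. \<Sum>y\<in>(Y \<times> Z) \<times> (Y \<times> Z). h x (fst (fst y), fst (snd y)) (snd (fst y), snd (snd y)))"
    by (simp add: sum.cartesian_product split_beta)
  finally show ?thesis by (simp add: sum_regroup2)
qed

lemma bij_betw_pair_index: "bij_betw (\<lambda>(b, c). b * r + c) ({..<q} \<times> {..<r}) {..<q * r :: nat}"
proof (cases "r = 0")
  case False
  show ?thesis
  proof (rule bij_betwI[where g = "\<lambda>n. (n div r, n mod r)"])
    show "(\<lambda>(b, c). b * r + c) \<in> {..<q} \<times> {..<r} \<rightarrow> {..<q * r}"
    proof (intro Pi_I, clarify)
      fix b c assume "b < q" "c < r"
      then have "b * r + c < Suc b * r" by simp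
      also have "\<dots> \<le> q * r" using \<open>b < q\<close> by (intro mult_le_mono1) simp
      finally show "b * r + c < q * r" .
    qed
    show "(\<lambda>n. (n div r, n mod r)) \<in> {..<q * r} \<rightarrow> {..<q} \<times> {..<r}"
      using False by (auto simp: less_mult_imp_div_less)
  qed (use False in auto)
qed (auto simp: bij_betw_def)

lemma sum_pair_index:
  fixes f :: "nat \<Rightarrow> 'r :: comm_monoid_add"
  shows "(\<Sum>n<q * r. f n) = (\<Sum>x\<in>{..<q} \<times> {..<r}. f (fst x * r + snd x))"
  using sum.reindex_bij_betw[OF bij_betw_pair_index, of f r q] by (simp add: split_beta)

lemma bij_betw_triple_index:
  "bij_betw (\<lambda>(a, b, c). a * q * r + b * r + c) ({..<p} \<times> {..<q} \<times> {..<r}) {..<p * q * r :: nat}"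
proof -
  have "bij_betw (map_prod id (\<lambda>(b, c). b * r + c)) ({..<p} \<times> {..<q} \<times> {..<r}) ({..<p} \<times> {..<q * r})"
    by (intro bij_betw_map_prod bij_betw_pair_index) simp
  note bij_betw_trans[OF this bij_betw_pair_index]
  moreover have "(\<lambda>(b, c). b * (q * r) + c) \<circ> map_prod id (\<lambda>(b, c). b * r + c) = (\<lambda>(a, b, c). a * q * r + b * r + c)"
    by (auto simp: fun_eq_iff)
  ultimately show ?thesis by (simp add: mult.assoc)
qed

section \<open>Multi-affine expansion of the trilinear form under three independent centred
  noises\<close>

section \<open>The second moment of a perturbed trilinear form\<close>

lemma noise_prob: "noise I s \<gamma> \<Longrightarrow> prob_space \<gamma>"
  and noise_sets: "noise I s \<gamma> \<Longrightarrow> sets \<gamma> = sets (RPi I)"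
  by (auto simp: noise_def)

lemma noise_flip:
  "noise I s \<gamma> \<Longrightarrow> F \<in> borel_measurable (RPi I) \<Longrightarrow>
    (\<integral>\<^sup>+g. F (\<lambda>k\<in>I. - g k) \<partial>\<gamma>) = (\<integral>\<^sup>+g. (F g :: ennreal) \<partial>\<gamma>)"
  by (simp add: noise_def)

text \<open>\<phi> names the noise coordinates that \<open>f\<close> really sees. Extending the
  coefficients by zero to the rest of \<open>I\<close> reduces the claim to the defining moment
  identity of \<open>noise\<close>.\<close>

lemma noise_affine_square:
  assumes N: "noise I s \<gamma>" and fin: "finite I" and \<phi>: "inj_on \<phi> J" "\<phi> ` J \<subseteq> I"
    and f: "\<And>g. f g = c + (\<Sum>j\<in>J. g (\<phi> j) * v j)"
  shows "(\<lambda>g. ennreal ((f g)\<^sup>2)) \<in> borel_measurable \<gamma>"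
    and "(\<integral>\<^sup>+g. ennreal ((f g)\<^sup>2) \<partial>\<gamma>) = ennreal (c\<^sup>2 + s * (\<Sum>j\<in>J. (v j)\<^sup>2))"
proof -
  note [measurable_cong] = noise_sets[OF N]
  define v' where "v' = (\<lambda>k. if k \<in> \<phi> ` J then v (the_inv_into J \<phi> k) else 0)"
  have v': "v' (\<phi> j) = v j" if "j \<in> J" for j
    using \<phi>(1) that by (simp add: v'_def the_inv_into_f_f)
  have f': "f g = c + (\<Sum>k\<in>I. g k * v' k)" for g
  proof -
    have "(\<Sum>k\<in>I. g k * v' k) = (\<Sum>k\<in>\<phi> ` J. g k * v' k)"
      using fin \<phi>(2) by (intro sum.mono_neutral_right) (auto simp: v'_def)
    also have "\<dots> = (\<Sum>j\<in>J. g (\<phi> j) * v j)"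
      using v' by (simp add: sum.reindex[OF \<phi>(1)])
    finally show ?thesis by (simp add: f)
  qed
  have "(\<Sum>k\<in>I. (v' k)\<^sup>2) = (\<Sum>k\<in>\<phi> ` J. (v' k)\<^sup>2)"
    using fin \<phi>(2) by (intro sum.mono_neutral_right) (auto simp: v'_def)
  also have "\<dots> = (\<Sum>j\<in>J. (v j)\<^sup>2)"
    using v' by (simp add: sum.reindex[OF \<phi>(1)])
  finally show "(\<integral>\<^sup>+g. ennreal ((f g)\<^sup>2) \<partial>\<gamma>) = ennreal (c\<^sup>2 + s * (\<Sum>j\<in>J. (v j)\<^sup>2))"
    using N by (simp add: noise_def f')
  show "(\<lambda>g. ennreal ((f g)\<^sup>2)) \<in> borel_measurable \<gamma>"
    unfolding f' by measurable
qed

lemma noise_affine_squares: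
  assumes N: "noise I s \<gamma>" and s: "0 \<le> s" and fin: "finite I" "finite W" and \<alpha>: "0 \<le> \<alpha>"
    and \<phi>: "\<And>w. w \<in> W \<Longrightarrow> inj_on (\<phi> w) J" "\<And>w. w \<in> W \<Longrightarrow> \<phi> w ` J \<subseteq> I"
    and f: "\<And>w g. w \<in> W \<Longrightarrow> f w g = c w + (\<Sum>j\<in>J. g (\<phi> w j) * v w j)"
  shows "(\<lambda>g. ennreal (\<alpha> * (\<Sum>w\<in>W. (f w g)\<^sup>2))) \<in> borel_measurable \<gamma>" (is ?m)
    and "(\<integral>\<^sup>+g. ennreal (\<alpha> * (\<Sum>w\<in>W. (f w g)\<^sup>2)) \<partial>\<gamma>) =
      ennreal (\<alpha> * (\<Sum>w\<in>W. (c w)\<^sup>2 + s * (\<Sum>j\<in>J. (v w j)\<^sup>2)))" (is ?i)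
proof -
  have m: "(\<lambda>g. ennreal ((f w g)\<^sup>2)) \<in> borel_measurable \<gamma>"
    and i: "(\<integral>\<^sup>+g. ennreal ((f w g)\<^sup>2) \<partial>\<gamma>) = ennreal ((c w)\<^sup>2 + s * (\<Sum>j\<in>J. (v w j)\<^sup>2))"
    if "w \<in> W" for w
    using noise_affine_square[OF N fin(1) \<phi>[OF that] f[OF that]] by auto
  have eq: "ennreal (\<alpha> * (\<Sum>w\<in>W. (f w g)\<^sup>2)) = ennreal \<alpha> * (\<Sum>w\<in>W. ennreal ((f w g)\<^sup>2))" for g
    using \<alpha> by (simp add: ennreal_mult sum_nonneg)
  have ms: "(\<lambda>g. \<Sum>w\<in>W. ennreal ((f w g)\<^sup>2)) \<in> borel_measurable \<gamma>"
    using m by (intro borel_measurable_sum) auto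
  then show ?m unfolding eq by measurable
  have "(\<integral>\<^sup>+g. (\<Sum>w\<in>W. ennreal ((f w g)\<^sup>2)) \<partial>\<gamma>) = (\<Sum>w\<in>W. ennreal ((c w)\<^sup>2 + s * (\<Sum>j\<in>J. (v w j)\<^sup>2)))"
    by (simp only: nn_integral_sum[OF m] i cong: sum.cong)
  then have "(\<integral>\<^sup>+g. ennreal \<alpha> * (\<Sum>w\<in>W. ennreal ((f w g)\<^sup>2)) \<partial>\<gamma>) =
    ennreal \<alpha> * (\<Sum>w\<in>W. ennreal ((c w)\<^sup>2 + s * (\<Sum>j\<in>J. (v w j)\<^sup>2)))"
    by (simp only: nn_integral_cmult[OF ms])
  also have "\<dots> = ennreal (\<alpha> * (\<Sum>w\<in>W. (c w)\<^sup>2 + s * (\<Sum>j\<in>J. (v w j)\<^sup>2)))"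
    using \<alpha> s by (subst sum_ennreal) (auto simp: ennreal_mult[symmetric] sum_nonneg)
  finally show ?i unfolding eq .
qed

lemma nn_integral_add4:
  assumes [measurable]: "f1 \<in> borel_measurable M" "f2 \<in> borel_measurable M"
    "f3 \<in> borel_measurable M" "f4 \<in> borel_measurable M"
  shows "(\<integral>\<^sup>+x. f1 x + f2 x + f3 x + f4 x \<partial>M) =
    (\<integral>\<^sup>+x. f1 x \<partial>M) + (\<integral>\<^sup>+x. f2 x \<partial>M) + (\<integral>\<^sup>+x. f3 x \<partial>M) + (\<integral>\<^sup>+x. f4 x \<partial>M)"
  by (simp add: nn_integral_add)

text \<open>The contraction with its arguments read as vectors over finite index sets, so that noise
  can be added to each of them coordinatewise; \<open>contract_eq_tform\<close> makes the
  link.\<close>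

definition tform :: "'a set \<Rightarrow> 'b set \<Rightarrow> 'c set \<Rightarrow> nat \<Rightarrow> nat \<Rightarrow> ('a \<Rightarrow> 'b \<Rightarrow> 'c \<Rightarrow> real) \<Rightarrow>
    ('a \<times> nat \<Rightarrow> real) \<Rightarrow> (nat \<times> 'b \<times> nat \<Rightarrow> real) \<Rightarrow> ('c \<times> nat \<Rightarrow> real) \<Rightarrow> real" where
  "tform I J K l1 l3 E x1 x2 x3 =
    (\<Sum>s<l1. \<Sum>t<l3. \<Sum>a\<in>I. \<Sum>b\<in>J. \<Sum>c\<in>K. x1 (a, s) * x2 (s, b, t) * x3 (c, t) * E a b c)"

text \<open>The gradient of \<open>tform\<close> in its first argument; \<open>tcoef2\<close> and
  \<open>tcoef3\<close> are the gradients in the other two.\<close>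

definition tcoef1 where
  "tcoef1 J K l3 E x2 x3 a s = (\<Sum>t<l3. \<Sum>b\<in>J. \<Sum>c\<in>K. x2 (s, b, t) * x3 (c, t) * (E a b c :: real))"

definition tcoef2 where
  "tcoef2 I K E x1 x3 s b t = (\<Sum>a\<in>I. \<Sum>c\<in>K. x1 (a, s :: nat) * x3 (c, t :: nat) * (E a b c :: real))"

definition tcoef3 where
  "tcoef3 I J l1 E x1 x2 c t = (\<Sum>s<l1. \<Sum>a\<in>I. \<Sum>b\<in>J. x1 (a, s) * x2 (s, b, t :: nat) * (E a b c :: real))"

lemma tform_lin1: "tform I J K l1 l3 E x1 x2 x3 = (\<Sum>j\<in>I \<times> {..<l1}. x1 j * tcoef1 J K l3 E x2 x3 (fst j) (snd j))" (is "?l = _")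
proof -
  let ?f = "\<lambda>s t a b c. x1 (a, s) * x2 (s, b, t) * x3 (c, t) * E a b c"
  have "?l = (\<Sum>s<l1. \<Sum>a\<in>I. \<Sum>t<l3. \<Sum>b\<in>J. \<Sum>c\<in>K. ?f s t a b c)"
    unfolding tform_def by (intro sum.cong refl sum.swap)
  also have "\<dots> = (\<Sum>a\<in>I. \<Sum>s<l1. \<Sum>t<l3. \<Sum>b\<in>J. \<Sum>c\<in>K. ?f s t a b c)"
    by (rule sum.swap)
  finally show ?thesis by (simp add: sum.cartesian_product' tcoef1_def sum_distrib_left mult_ac)
qed

lemma tform_lin2: "tform I J K l1 l3 E x1 x2 x3 =
  (\<Sum>j\<in>{..<l1} \<times> J \<times> {..<l3}. x2 j * tcoef2 I K E x1 x3 (fst j) (fst (snd j)) (snd (snd j)))" (is "?l = _")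
proof -
  let ?f = "\<lambda>s t a b c. x1 (a, s) * x2 (s, b, t) * x3 (c, t) * E a b c"
  have "?l = (\<Sum>s<l1. \<Sum>t<l3. \<Sum>b\<in>J. \<Sum>a\<in>I. \<Sum>c\<in>K. ?f s t a b c)"
    unfolding tform_def by (intro sum.cong refl sum.swap)
  also have "\<dots> = (\<Sum>s<l1. \<Sum>b\<in>J. \<Sum>t<l3. \<Sum>a\<in>I. \<Sum>c\<in>K. ?f s t a b c)"
    by (intro sum.cong refl sum.swap)
  finally show ?thesis by (simp add: sum.cartesian_product' tcoef2_def sum_distrib_left mult_ac)
qed

lemma tform_lin3: "tform I J K l1 l3 E x1 x2 x3 =
  (\<Sum>j\<in>K \<times> {..<l3}. x3 j * tcoef3 I J l1 E x1 x2 (fst j) (snd j))" (is "?l = _")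
proof -
  let ?f = "\<lambda>s t a b c. x1 (a, s) * x2 (s, b, t) * x3 (c, t) * E a b c"
  have "?l = (\<Sum>s<l1. \<Sum>t<l3. \<Sum>a\<in>I. \<Sum>c\<in>K. \<Sum>b\<in>J. ?f s t a b c)"
    unfolding tform_def by (intro sum.cong refl sum.swap)
  also have "\<dots> = (\<Sum>s<l1. \<Sum>t<l3. \<Sum>c\<in>K. \<Sum>a\<in>I. \<Sum>b\<in>J. ?f s t a b c)"
    by (intro sum.cong refl sum.swap)
  also have "\<dots> = (\<Sum>t<l3. \<Sum>s<l1. \<Sum>c\<in>K. \<Sum>a\<in>I. \<Sum>b\<in>J. ?f s t a b c)"
    by (rule sum.swap)
  also have "\<dots> = (\<Sum>t<l3. \<Sum>c\<in>K. \<Sum>s<l1. \<Sum>a\<in>I. \<Sum>b\<in>J. ?f s t a b c)"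
    by (intro sum.cong refl sum.swap)
  also have "\<dots> = (\<Sum>c\<in>K. \<Sum>t<l3. \<Sum>s<l1. \<Sum>a\<in>I. \<Sum>b\<in>J. ?f s t a b c)"
    by (rule sum.swap)
  finally show ?thesis by (simp add: sum.cartesian_product' tcoef3_def sum_distrib_left mult_ac)
qed

lemma tcoef2_lin1: "tcoef2 I K E x1 x3 s b t = (\<Sum>a\<in>I. x1 (a, s) * (\<Sum>c\<in>K. x3 (c, t) * E a b c))"
  by (simp add: tcoef2_def sum_distrib_left mult_ac)

lemma tcoef3_lin1: "tcoef3 I J l1 E x1 x2 c t =
  (\<Sum>j\<in>I \<times> {..<l1}. x1 j * (\<Sum>b\<in>J. x2 (snd j, b, t) * E (fst j) b c))"
  unfolding tcoef3_def
  by (subst sum.swap) (simp add: sum.cartesian_product' sum_distrib_left mult_ac)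

lemma tcoef3_lin2: "tcoef3 I J l1 E x1 x2 c t =
  (\<Sum>j\<in>{..<l1} \<times> J. x2 (fst j, snd j, t) * (\<Sum>a\<in>I. x1 (a, fst j) * E a (snd j) c))"
proof -
  have "tcoef3 I J l1 E x1 x2 c t = (\<Sum>s<l1. \<Sum>b\<in>J. \<Sum>a\<in>I. x1 (a, s) * x2 (s, b, t) * E a b c)"
    unfolding tcoef3_def by (intro sum.cong refl sum.swap)
  then show ?thesis by (simp add: sum.cartesian_product' sum_distrib_left mult_ac)
qed

lemma affine_of_linear:
  fixes A g v :: "_ \<Rightarrow> real"
  assumes "\<And>j. j \<in> J \<Longrightarrow> \<phi> j \<in> I"
  shows "(\<Sum>j\<in>J. (\<lambda>k\<in>I. A k + g k) (\<phi> j) * v j) = (\<Sum>j\<in>J. A (\<phi> j) * v j) + (\<Sum>j\<in>J. g (\<phi> j) * v j)"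
  using assms by (simp add: algebra_simps sum.distrib)

text \<open>Each integration replaces the square of an affine function by its square at the centre
  plus \<open>s\<close> times the sum of its squared coefficients. Three integrations, innermost
  noise first, double the number of sums each time; the eight results are indexed by the set of
  arguments that noise has replaced.\<close>

lemma tform_second_moment:
  fixes E :: "'e \<Rightarrow> 'a \<Rightarrow> 'b \<Rightarrow> 'c \<Rightarrow> real"
  assumes fin: "finite I" "finite J" "finite K" "finite Es"
    and N1: "noise (I \<times> {..<l1}) s1 \<gamma>1" and N2: "noise ({..<l1} \<times> J \<times> {..<l3}) s2 \<gamma>2"
    and N3: "noise (K \<times> {..<l3}) s3 \<gamma>3" and s: "0 \<le> s1" "0 \<le> s2" "0 \<le> s3"
  shows "(\<integral>\<^sup>+g1. \<integral>\<^sup>+g2. \<integral>\<^sup>+g3. ennreal (\<Sum>e\<in>Es. (tform I J K l1 l3 (E e)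
      (pert (I \<times> {..<l1}) A1 g1) (pert ({..<l1} \<times> J \<times> {..<l3}) A2 g2) (pert (K \<times> {..<l3}) A3 g3))\<^sup>2)
      \<partial>\<gamma>3 \<partial>\<gamma>2 \<partial>\<gamma>1) =
    ennreal ((\<Sum>e\<in>Es. (tform I J K l1 l3 (E e) A1 A2 A3)\<^sup>2)
      + s1 * (\<Sum>e\<in>Es. \<Sum>j\<in>I \<times> {..<l1}. (tcoef1 J K l3 (E e) A2 A3 (fst j) (snd j))\<^sup>2)
      + s2 * (\<Sum>(e, s, b, t)\<in>Es \<times> {..<l1} \<times> J \<times> {..<l3}. (tcoef2 I K (E e) A1 A3 s b t)\<^sup>2)
      + s1 * s2 * (\<Sum>(e, s, b, t)\<in>Es \<times> {..<l1} \<times> J \<times> {..<l3}. \<Sum>a\<in>I. (\<Sum>c\<in>K. A3 (c, t) * E e a b c)\<^sup>2)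
      + s3 * (\<Sum>(e, c, t)\<in>Es \<times> K \<times> {..<l3}. (tcoef3 I J l1 (E e) A1 A2 c t)\<^sup>2)
      + s1 * s3 * (\<Sum>(e, c, t)\<in>Es \<times> K \<times> {..<l3}. \<Sum>j\<in>I \<times> {..<l1}. (\<Sum>b\<in>J. A2 (snd j, b, t) * E e (fst j) b c)\<^sup>2)
      + s2 * s3 * (\<Sum>(e, c, t, s, b)\<in>Es \<times> K \<times> {..<l3} \<times> {..<l1} \<times> J. (\<Sum>a\<in>I. A1 (a, s) * E e a b c)\<^sup>2)
      + s1 * s2 * s3 * (\<Sum>(e, c, t, s, b)\<in>Es \<times> K \<times> {..<l3} \<times> {..<l1} \<times> J. \<Sum>a\<in>I. (E e a b c)\<^sup>2))"
    (is "_ = ennreal ?t")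
proof -
  let ?I1 = "I \<times> {..<l1}" let ?I2 = "{..<l1} \<times> J \<times> {..<l3}" let ?I3 = "K \<times> {..<l3}"
  let ?W2 = "Es \<times> {..<l1} \<times> J \<times> {..<l3}" and ?W3 = "Es \<times> K \<times> {..<l3}"
    and ?W4 = "Es \<times> K \<times> {..<l3} \<times> {..<l1} \<times> J"
  let ?y1 = "pert ?I1 A1" and ?y2 = "pert ?I2 A2" and ?y3 = "pert ?I3 A3"
  have f1: "finite ?I1" "finite ?I2" "finite ?I3" "finite ?W2" "finite ?W3" "finite ?W4" using fin by auto
  let ?t2 = "\<lambda>x w. tcoef2 I K (E (fst w)) x A3 (fst (snd w)) (fst (snd (snd w))) (snd (snd (snd w)))"
    and ?t3 = "\<lambda>x y w. tcoef3 I J l1 (E (fst w)) x y (fst (snd w)) (snd (snd w))"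
    and ?t4 = "\<lambda>x w. \<Sum>a\<in>I. x (a, fst (snd (snd (snd w)))) * E (fst w) a (snd (snd (snd (snd w)))) (fst (snd w))"
  have step3: "(\<integral>\<^sup>+g3. ennreal (\<Sum>e\<in>Es. (tform I J K l1 l3 (E e) y1 y2 (?y3 g3))\<^sup>2) \<partial>\<gamma>3) =
     ennreal ((\<Sum>e\<in>Es. (tform I J K l1 l3 (E e) y1 y2 A3)\<^sup>2)
      + s3 * (\<Sum>w\<in>?W3. (?t3 y1 y2 w)\<^sup>2))" for y1 y2
  proof -
    have eq: "tform I J K l1 l3 (E e) y1 y2 (?y3 g) = tform I J K l1 l3 (E e) y1 y2 A3
       + (\<Sum>j\<in>?I3. g j * tcoef3 I J l1 (E e) y1 y2 (fst j) (snd j))" for e g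
      unfolding tform_lin3 by (subst affine_of_linear[where \<phi> = "\<lambda>j. j"]) auto
    have "(\<integral>\<^sup>+g3. ennreal (1 * (\<Sum>e\<in>Es. (tform I J K l1 l3 (E e) y1 y2 (?y3 g3))\<^sup>2)) \<partial>\<gamma>3) =
      ennreal (1 * (\<Sum>e\<in>Es. (tform I J K l1 l3 (E e) y1 y2 A3)\<^sup>2
        + s3 * (\<Sum>j\<in>?I3. (tcoef3 I J l1 (E e) y1 y2 (fst j) (snd j))\<^sup>2)))"
      by (rule noise_affine_squares(2)[OF N3 s(3) f1(3) fin(4), where \<phi> = "\<lambda>_ j. j"])
        (auto simp: eq)
    then show ?thesis by (simp add: sum.distrib sum_distrib_left sum.cartesian_product')
  qed
  have step2: "(\<integral>\<^sup>+g2. ennreal ((\<Sum>e\<in>Es. (tform I J K l1 l3 (E e) y1 (?y2 g2) A3)\<^sup>2)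
      + s3 * (\<Sum>w\<in>?W3. (?t3 y1 (?y2 g2) w)\<^sup>2)) \<partial>\<gamma>2) =
     ennreal ((\<Sum>e\<in>Es. (tform I J K l1 l3 (E e) y1 A2 A3)\<^sup>2)
      + s2 * (\<Sum>w\<in>?W2. (?t2 y1 w)\<^sup>2)
      + s3 * (\<Sum>w\<in>?W3. (?t3 y1 A2 w)\<^sup>2)
      + s2 * s3 * (\<Sum>w\<in>?W4. (?t4 y1 w)\<^sup>2))" (is "?l = _") for y1
  proof -
    have eA: "\<And>e g. e \<in> Es \<Longrightarrow> tform I J K l1 l3 (E e) y1 (?y2 g) A3 = tform I J K l1 l3 (E e) y1 A2 A3
       + (\<Sum>j\<in>?I2. g j * tcoef2 I K (E e) y1 A3 (fst j) (fst (snd j)) (snd (snd j)))"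
      unfolding tform_lin2 by (subst affine_of_linear[where \<phi> = "\<lambda>j. j"]) auto
    note A = noise_affine_squares[OF N2 s(2) f1(2) fin(4) zero_le_one, where \<phi> = "\<lambda>_ j. j" and J = ?I2, OF _ _ eA, simplified mult_1]
    \<comment> \<open>For fixed \<open>(e, c, t)\<close> only the entries of the second argument
      with last index \<open>t\<close> occur, whence the embedding of the pairs
      \<open>(s, b)\<close> that serves as \<phi>.\<close>
    have eB: "\<And>w g. w \<in> ?W3 \<Longrightarrow> ?t3 y1 (?y2 g) w =
       ?t3 y1 A2 w + (\<Sum>j\<in>{..<l1} \<times> J. g (fst j, snd j, snd (snd w)) *
         (\<Sum>a\<in>I. y1 (a, fst j) * E (fst w) a (snd j) (fst (snd w))))"
      unfolding tcoef3_lin2 by (subst affine_of_linear) auto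
    note B = noise_affine_squares[OF N2 s(2) f1(2) f1(5) s(3), where \<phi> = "\<lambda>w j. (fst j, snd j, snd (snd w))" and J = "{..<l1} \<times> J", OF _ _ eB]
    have "?l =
      (\<integral>\<^sup>+g2. ennreal (\<Sum>e\<in>Es. (tform I J K l1 l3 (E e) y1 (?y2 g2) A3)\<^sup>2)
      + ennreal (s3 * (\<Sum>w\<in>?W3. (?t3 y1 (?y2 g2) w)\<^sup>2)) \<partial>\<gamma>2)"
      using s by (intro nn_integral_cong ennreal_plus) (auto intro!: sum_nonneg mult_nonneg_nonneg)
    also have "\<dots> = ennreal (\<Sum>e\<in>Es. (tform I J K l1 l3 (E e) y1 A2 A3)\<^sup>2
        + s2 * (\<Sum>j\<in>?I2. (tcoef2 I K (E e) y1 A3 (fst j) (fst (snd j)) (snd (snd j)))\<^sup>2))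
      + ennreal (s3 * (\<Sum>w\<in>?W3. (?t3 y1 A2 w)\<^sup>2
        + s2 * (\<Sum>j\<in>{..<l1} \<times> J. (\<Sum>a\<in>I. y1 (a, fst j) * E (fst w) a (snd j) (fst (snd w)))\<^sup>2)))"
    proof -
      have iB: "inj_on (\<lambda>j. (fst j, snd j, snd (snd w))) ({..<l1} \<times> J)" "(\<lambda>j. (fst j, snd j, snd (snd w))) ` ({..<l1} \<times> J) \<subseteq> ?I2"
        if "w \<in> ?W3" for w :: "'e \<times> 'c \<times> nat"
        using that by (auto simp: inj_on_def)
      show ?thesis
        by (subst nn_integral_add) (use A B iB in \<open>auto\<close>)
    qed
    also have "\<dots> = ennreal ((\<Sum>e\<in>Es. (tform I J K l1 l3 (E e) y1 A2 A3)\<^sup>2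
        + s2 * (\<Sum>j\<in>?I2. (tcoef2 I K (E e) y1 A3 (fst j) (fst (snd j)) (snd (snd j)))\<^sup>2))
      + s3 * (\<Sum>w\<in>?W3. (?t3 y1 A2 w)\<^sup>2
        + s2 * (\<Sum>j\<in>{..<l1} \<times> J. (\<Sum>a\<in>I. y1 (a, fst j) * E (fst w) a (snd j) (fst (snd w)))\<^sup>2)))"
      using s by (intro ennreal_plus[symmetric]) (auto intro!: sum_nonneg mult_nonneg_nonneg add_nonneg_nonneg)
    finally show ?thesis
      by (simp add: sum.distrib sum_distrib_left sum.cartesian_product' algebra_simps)
  qed
  show ?thesis
    unfolding step3 step2
  proof -
    let ?FA = "\<lambda>x. \<Sum>e\<in>Es. (tform I J K l1 l3 (E e) x A2 A3)\<^sup>2"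
    let ?FB = "\<lambda>x. s2 * (\<Sum>w\<in>?W2. (?t2 x w)\<^sup>2)"
    let ?FC = "\<lambda>x. s3 * (\<Sum>w\<in>?W3. (?t3 x A2 w)\<^sup>2)"
    let ?FD = "\<lambda>x. s2 * s3 * (\<Sum>w\<in>?W4. (?t4 x w)\<^sup>2)"
    \<comment> \<open>\<open>?a\<close> to \<open>?d\<close> are the integrals of the four sums left
      by the two inner steps, each split into a centre and a first-noise part.\<close>
    let ?a = "\<Sum>e\<in>Es. (tform I J K l1 l3 (E e) A1 A2 A3)\<^sup>2
       + s1 * (\<Sum>j\<in>?I1. (tcoef1 J K l3 (E e) A2 A3 (fst j) (snd j))\<^sup>2)"
    let ?b = "s2 * (\<Sum>w\<in>?W2. (?t2 A1 w)\<^sup>2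
       + s1 * (\<Sum>j\<in>I. (\<Sum>c\<in>K. A3 (c, snd (snd (snd w))) * E (fst w) j (fst (snd (snd w))) c)\<^sup>2))"
    let ?c = "s3 * (\<Sum>w\<in>?W3. (?t3 A1 A2 w)\<^sup>2
       + s1 * (\<Sum>j\<in>?I1. (\<Sum>b\<in>J. A2 (snd j, b, snd (snd w)) * E (fst w) (fst j) b (fst (snd w)))\<^sup>2))"
    let ?d = "s2 * s3 * (\<Sum>w\<in>?W4. (?t4 A1 w)\<^sup>2
       + s1 * (\<Sum>a\<in>I. (E (fst w) a (snd (snd (snd (snd w)))) (fst (snd w)))\<^sup>2))"
    have eA: "\<And>e g. e \<in> Es \<Longrightarrow> tform I J K l1 l3 (E e) (?y1 g) A2 A3 = tform I J K l1 l3 (E e) A1 A2 A3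
       + (\<Sum>j\<in>?I1. g j * tcoef1 J K l3 (E e) A2 A3 (fst j) (snd j))"
      unfolding tform_lin1 by (subst affine_of_linear[where \<phi> = "\<lambda>j. j"]) auto
    note A = noise_affine_squares[OF N1 s(1) f1(1) fin(4) zero_le_one, where \<phi> = "\<lambda>_ j. j" and J = ?I1, OF _ _ eA, simplified mult_1]
    have eB: "\<And>w g. w \<in> ?W2 \<Longrightarrow> ?t2 (?y1 g) w =
       ?t2 A1 w
       + (\<Sum>j\<in>I. g (j, fst (snd w)) * (\<Sum>c\<in>K. A3 (c, snd (snd (snd w))) * E (fst w) j (fst (snd (snd w))) c))"
      unfolding tcoef2_lin1 by (subst affine_of_linear) auto
    note B = noise_affine_squares[OF N1 s(1) f1(1) f1(4) s(2), where \<phi> = "\<lambda>w j. (j, fst (snd w))" and J = I, OF _ _ eB]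
    have eC: "\<And>w g. w \<in> ?W3 \<Longrightarrow> ?t3 (?y1 g) A2 w =
       ?t3 A1 A2 w
       + (\<Sum>j\<in>?I1. g j * (\<Sum>b\<in>J. A2 (snd j, b, snd (snd w)) * E (fst w) (fst j) b (fst (snd w))))"
      unfolding tcoef3_lin1 by (subst affine_of_linear[where \<phi> = "\<lambda>j. j"]) auto
    note C = noise_affine_squares[OF N1 s(1) f1(1) f1(5) s(3), where \<phi> = "\<lambda>_ j. j" and J = ?I1, OF _ _ eC]
    have eD: "\<And>w g. w \<in> ?W4 \<Longrightarrow> (?t4 (?y1 g) w) =
       (?t4 A1 w)
       + (?t4 g w)"
      by (subst affine_of_linear) auto
    note D = noise_affine_squares[OF N1 s(1) f1(1) f1(6) mult_nonneg_nonneg[OF s(2,3)], where \<phi> = "\<lambda>w a. (a, fst (snd (snd (snd w))))" and J = I, OF _ _ eD]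
    have iB: "inj_on (\<lambda>j. (j, fst (snd w))) I" "(\<lambda>j. (j, fst (snd w))) ` I \<subseteq> ?I1" if "w \<in> ?W2" for w :: "'e \<times> nat \<times> 'b \<times> nat"
      using that by (auto simp: inj_on_def)
    have iD: "inj_on (\<lambda>a. (a, fst (snd (snd (snd w))))) I" "(\<lambda>a. (a, fst (snd (snd (snd w))))) ` I \<subseteq> ?I1"
      if "w \<in> ?W4" for w :: "'e \<times> 'c \<times> nat \<times> nat \<times> 'b"
      using that by (auto simp: inj_on_def)
    have mA: "(\<lambda>g. ennreal (?FA (?y1 g))) \<in> borel_measurable \<gamma>1" using A(1) by simp
    have mB: "(\<lambda>g. ennreal (?FB (?y1 g))) \<in> borel_measurable \<gamma>1" using iB by (intro B(1))
    have mC: "(\<lambda>g. ennreal (?FC (?y1 g))) \<in> borel_measurable \<gamma>1" by (intro C(1)) auto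
    have mD: "(\<lambda>g. ennreal (?FD (?y1 g))) \<in> borel_measurable \<gamma>1" using iD by (intro D(1))
    have pos: "0 \<le> ?FA x" "0 \<le> ?FB x" "0 \<le> ?FC x" "0 \<le> ?FD x" for x
      using s by (auto intro!: sum_nonneg mult_nonneg_nonneg)
    have "(\<integral>\<^sup>+g. ennreal (?FA (?y1 g) + ?FB (?y1 g) + ?FC (?y1 g) + ?FD (?y1 g)) \<partial>\<gamma>1) =
      (\<integral>\<^sup>+g. ennreal (?FA (?y1 g)) + ennreal (?FB (?y1 g)) + ennreal (?FC (?y1 g)) + ennreal (?FD (?y1 g)) \<partial>\<gamma>1)"
      (is "?lhs = _")
      using pos by (intro nn_integral_cong) (simp only: ennreal_plus add_nonneg_nonneg)
    also have "\<dots> = (\<integral>\<^sup>+g. ennreal (?FA (?y1 g)) \<partial>\<gamma>1) + (\<integral>\<^sup>+g. ennreal (?FB (?y1 g)) \<partial>\<gamma>1)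
      + (\<integral>\<^sup>+g. ennreal (?FC (?y1 g)) \<partial>\<gamma>1) + (\<integral>\<^sup>+g. ennreal (?FD (?y1 g)) \<partial>\<gamma>1)"
      by (rule nn_integral_add4[OF mA mB mC mD])
    also have "(\<integral>\<^sup>+g. ennreal (?FA (?y1 g)) \<partial>\<gamma>1) = ennreal ?a" using A(2) by simp
    also have "(\<integral>\<^sup>+g. ennreal (?FB (?y1 g)) \<partial>\<gamma>1) = ennreal ?b"
      using iB by (intro B(2))
    also have "(\<integral>\<^sup>+g. ennreal (?FC (?y1 g)) \<partial>\<gamma>1) = ennreal ?c"
      by (intro C(2)) auto
    also have "(\<integral>\<^sup>+g. ennreal (?FD (?y1 g)) \<partial>\<gamma>1) = ennreal ?d"
      using iD by (intro D(2))
    finally have eq: "?lhs =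
      ennreal ?a + ennreal ?b + ennreal ?c + ennreal ?d" .
    have p: "0 \<le> ?a" "0 \<le> ?b" "0 \<le> ?c" "0 \<le> ?d"
      using s by (auto intro!: mult_nonneg_nonneg sum_nonneg add_nonneg_nonneg)
    have "ennreal ?a + ennreal ?b + ennreal ?c + ennreal ?d = ennreal (?a + ?b + ?c + ?d)"
      using p by (simp only: ennreal_plus add_nonneg_nonneg)
    moreover have "?a = (\<Sum>e\<in>Es. (tform I J K l1 l3 (E e) A1 A2 A3)\<^sup>2)
      + s1 * (\<Sum>e\<in>Es. \<Sum>j\<in>?I1. (tcoef1 J K l3 (E e) A2 A3 (fst j) (snd j))\<^sup>2)"
      by (simp only: sum.distrib sum_distrib_left)
    moreover have "?b = s2 * (\<Sum>(e, s, b, t)\<in>?W2. (tcoef2 I K (E e) A1 A3 s b t)\<^sup>2)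
      + s1 * s2 * (\<Sum>(e, s, b, t)\<in>?W2. \<Sum>a\<in>I. (\<Sum>c\<in>K. A3 (c, t) * E e a b c)\<^sup>2)"
      unfolding split_beta by (simp only: sum.distrib sum_distrib_left distrib_left mult_ac)
    moreover have "?c = s3 * (\<Sum>(e, c, t)\<in>?W3. (tcoef3 I J l1 (E e) A1 A2 c t)\<^sup>2)
      + s1 * s3 * (\<Sum>(e, c, t)\<in>?W3. \<Sum>j\<in>?I1. (\<Sum>b\<in>J. A2 (snd j, b, t) * E e (fst j) b c)\<^sup>2)"
      unfolding split_beta by (simp only: sum.distrib sum_distrib_left distrib_left mult_ac)
    moreover have "?d = s2 * s3 * (\<Sum>(e, c, t, s, b)\<in>?W4. (\<Sum>a\<in>I. A1 (a, s) * E e a b c)\<^sup>2)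
      + s1 * s2 * s3 * (\<Sum>(e, c, t, s, b)\<in>?W4. \<Sum>a\<in>I. (E e a b c)\<^sup>2)"
      unfolding split_beta by (simp only: sum.distrib sum_distrib_left distrib_left mult_ac)
    ultimately have "ennreal ?a + ennreal ?b + ennreal ?c + ennreal ?d = ennreal (?a + ?b + ?c + ?d)"
      and "?a + ?b + ?c + ?d = ?t"
      by (simp_all only: add_ac)
    then show "?lhs = ennreal ?t"
      using eq by simp
  qed
qed

section \<open>Gram matrices of the rearranged factors are partial traces; the eight terms of the
  second moment\<close>

section \<open>Partial traces and the rearrangement\<close>

text \<open>The rearranged tensor with each index kept as a pair (row part, column part), which
  avoids \<open>div\<close> and \<open>mod\<close> until the comparison with
  \<open>rearr\<close>.\<close>

definition krear :: "nat \<Rightarrow> nat \<Rightarrow> (nat \<Rightarrow> nat \<Rightarrow> real) \<Rightarrow> nat \<times> nat \<Rightarrow> nat \<times> nat \<Rightarrow> nat \<times> nat \<Rightarrow> real" where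
  "krear q r D a b c = D (fst a * q * r + fst b * r + fst c) (snd a * q * r + snd b * r + snd c)"

text \<open>If \<open>S = R R\<^sup>T\<close>, the squared pairings of a matrix \<open>V\<close> with these rank-one matrices sum up over \<open>e\<close>
  to \<open>\<parallel>R\<^sup>T V R\<parallel>\<close> squared in Frobenius norm.\<close>

definition kfac :: "nat \<Rightarrow> nat \<Rightarrow> (nat \<Rightarrow> nat \<Rightarrow> real) \<Rightarrow> nat \<times> nat \<Rightarrow> nat \<times> nat \<Rightarrow> nat \<times> nat \<Rightarrow> nat \<times> nat \<Rightarrow> real" where
  "kfac q r R e a b c = R (fst a * q * r + fst b * r + fst c) (fst e) * R (snd a * q * r + snd b * r + snd c) (snd e)"

lemma triple_index_less:
  assumes "a < p" "b < q" "c < r" shows "a * q * r + b * r + c < p * q * (r :: nat)"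
  using bij_betw_apply[OF bij_betw_triple_index[of q r p], of "(a, b, c)"] assms by simp

lemma Tr1_index: "Tr1 p q r S (b * r + c) (b' * r + c') =
    (\<Sum>a<p. S (a * q * r + b * r + c) (a * q * r + b' * r + c'))"
  by (simp add: Tr1_def ptr_left_def add.assoc mult.assoc)

lemma Tr2_index: "c < r \<Longrightarrow> c' < r \<Longrightarrow> Tr2 p q r S (a * r + c) (a' * r + c') =
    (\<Sum>b<q. S (a * q * r + b * r + c) (a' * q * r + b * r + c'))"
  by (simp add: Tr2_def ptr_mid_def)

lemma Tr3_index: "Tr3 p q r S (a * q + b) (a' * q + b') =
    (\<Sum>c<r. S (a * q * r + b * r + c) (a' * q * r + b' * r + c))"
  by (simp add: Tr3_def ptr_right_def distrib_right)

lemma Tr12_index: "c < r \<Longrightarrow> c' < r \<Longrightarrow> Tr12 p q r S c c' =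
    (\<Sum>a<p. \<Sum>b<q. S (a * q * r + b * r + c) (a * q * r + b * r + c'))"
  by (simp add: Tr12_def ptr_left_def Tr2_index)

lemma Tr23_index: "Tr23 p q r S a a' =
    (\<Sum>c<r. \<Sum>b<q. S (a * q * r + b * r + c) (a' * q * r + b * r + c))"
  by (simp add: Tr23_def ptr_right_def Tr2_index)

lemma Tr13_index: "Tr13 p q r S b b' =
    (\<Sum>a<p. \<Sum>c<r. S (a * q * r + b * r + c) (a * q * r + b' * r + c))"
  by (simp add: Tr13_def ptr_left_def Tr3_index)

lemma sum_square_pairs: "(\<Sum>x\<in>X \<times> X. f x) = (\<Sum>i\<in>X. \<Sum>j\<in>X. f (i, j))"
  by (rule sum.cartesian_product')

lemma sum_times_swap: "(\<Sum>k\<in>M \<times> A. g k) = (\<Sum>x\<in>A. \<Sum>m\<in>M. g (m, x))"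
  unfolding sum.cartesian_product' by (rule sum.swap)

lemma sum_times_swap2: "(\<Sum>k\<in>M \<times> A \<times> B. g k) = (\<Sum>x\<in>A. \<Sum>y\<in>B. \<Sum>m\<in>M. g (m, x, y))"
  unfolding sum_times_swap[of _ M] by (rule sum.cartesian_product')

text \<open>Exposes the single coefficient tensor that is paired with \<open>E\<close>; it is the
  \<open>W\<close> of the Gram estimate without free indices.\<close>

lemma tform_tensor:
  "tform I J K l1 l3 E x1 x2 x3 = (\<Sum>a\<in>I. \<Sum>b\<in>J. \<Sum>c\<in>K.
    (\<Sum>s<l1. x1 (a, s) * (\<Sum>t<l3. x2 (s, b, t) * x3 (c, t))) * E a b c)"
proof -
  let ?f = "\<lambda>s t a b c. x1 (a, s) * x2 (s, b, t) * x3 (c, t) * E a b c"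
  have "tform I J K l1 l3 E x1 x2 x3 = (\<Sum>w\<in>{..<l1} \<times> {..<l3}. \<Sum>z\<in>I \<times> J \<times> K.
    ?f (fst w) (snd w) (fst z) (fst (snd z)) (snd (snd z)))"
    unfolding tform_def by (simp only: sum.cartesian_product' fst_conv snd_conv)
  also have "\<dots> = (\<Sum>z\<in>I \<times> J \<times> K. \<Sum>w\<in>{..<l1} \<times> {..<l3}.
    ?f (fst w) (snd w) (fst z) (fst (snd z)) (snd (snd z)))" by (rule sum.swap)
  also have "\<dots> = (\<Sum>a\<in>I. \<Sum>b\<in>J. \<Sum>c\<in>K. \<Sum>s<l1. \<Sum>t<l3. ?f s t a b c)"
    by (simp only: sum.cartesian_product' fst_conv snd_conv)
  finally show ?thesis by (simp only: sum_distrib_left sum_distrib_right mult_ac)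
qed

lemma column_norm_le:
  fixes x :: "'a \<times> nat \<Rightarrow> real"
  assumes x: "\<And>y. (\<Sum>a\<in>I. (\<Sum>s<l. x (a, s) * y s)\<^sup>2) \<le> (\<Sum>s<l. (y s)\<^sup>2)" and s: "s < l"
  shows "(\<Sum>a\<in>I. (x (a, s))\<^sup>2) \<le> 1"
proof -
  have "(\<Sum>s'<l. x (a, s') * (if s' = s then 1 else 0)) = x (a, s)" for a
    using s by (simp add: if_distrib cong: if_cong)
  moreover have "(\<Sum>s'<l. (if s' = s then 1 else 0 :: real)\<^sup>2) = 1"
  proof -
    have "(if s' = s then 1 else 0 :: real)\<^sup>2 = (if s' = s then 1 else 0)" for s' by simp
    then show ?thesis using s by simp
  qed
  ultimately show ?thesis using x[of "\<lambda>s'. if s' = s then 1 else 0"] by simp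
qed

lemma sum_tuple3: "(\<Sum>(e, c, t)\<in>A \<times> C \<times> T. f e c t) = (\<Sum>t\<in>T. \<Sum>e\<in>A. \<Sum>c\<in>C. f e c t)"
  (is "?l = _")
proof -
  have "?l = (\<Sum>e\<in>A. \<Sum>c\<in>C. \<Sum>t\<in>T. f e c t)"
    by (simp add: sum.cartesian_product')
  also have "\<dots> = (\<Sum>e\<in>A. \<Sum>t\<in>T. \<Sum>c\<in>C. f e c t)" by (intro sum.cong refl sum.swap)
  also have "\<dots> = (\<Sum>t\<in>T. \<Sum>e\<in>A. \<Sum>c\<in>C. f e c t)" by (rule sum.swap)
  finally show ?thesis .
qed

lemma sum_tuple4: "(\<Sum>(e, s, b, t)\<in>A \<times> S \<times> B \<times> T. f e s b t) = (\<Sum>s\<in>S. \<Sum>t\<in>T. \<Sum>e\<in>A. \<Sum>b\<in>B. f e s b t)"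
  (is "?l = _")
proof -
  have "?l = (\<Sum>e\<in>A. \<Sum>s\<in>S. \<Sum>b\<in>B. \<Sum>t\<in>T. f e s b t)"
    by (simp add: sum.cartesian_product')
  also have "\<dots> = (\<Sum>s\<in>S. \<Sum>e\<in>A. \<Sum>b\<in>B. \<Sum>t\<in>T. f e s b t)" by (rule sum.swap)
  also have "\<dots> = (\<Sum>s\<in>S. \<Sum>e\<in>A. \<Sum>t\<in>T. \<Sum>b\<in>B. f e s b t)" by (intro sum.cong refl sum.swap)
  also have "\<dots> = (\<Sum>s\<in>S. \<Sum>t\<in>T. \<Sum>e\<in>A. \<Sum>b\<in>B. f e s b t)" by (intro sum.cong refl sum.swap)
  finally show ?thesis .
qed

lemma sum_tuple5: "(\<Sum>(e, c, t, s, b)\<in>A \<times> C \<times> T \<times> S \<times> B. f e c t s b) =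
  (\<Sum>s\<in>S. \<Sum>t\<in>T. \<Sum>e\<in>A. \<Sum>c\<in>C. \<Sum>b\<in>B. f e c t s b)"
  (is "?l = _")
proof -
  have "?l = (\<Sum>e\<in>A. \<Sum>c\<in>C. \<Sum>t\<in>T. \<Sum>s\<in>S. \<Sum>b\<in>B. f e c t s b)"
    by (simp add: sum.cartesian_product')
  also have "\<dots> = (\<Sum>t\<in>T. \<Sum>e\<in>A. \<Sum>c\<in>C. \<Sum>s\<in>S. \<Sum>b\<in>B. f e c t s b)"
    using sum_tuple3[of "\<lambda>e c t. \<Sum>s\<in>S. \<Sum>b\<in>B. f e c t s b" A C T] by (simp add: sum.cartesian_product')
  also have "\<dots> = (\<Sum>t\<in>T. \<Sum>s\<in>S. \<Sum>e\<in>A. \<Sum>c\<in>C. \<Sum>b\<in>B. f e c t s b)"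
    using sum_tuple3[of "\<lambda>e c s. \<Sum>b\<in>B. f e c t s b" A C S for t] by (simp add: sum.cartesian_product')
  also have "\<dots> = (\<Sum>s\<in>S. \<Sum>t\<in>T. \<Sum>e\<in>A. \<Sum>c\<in>C. \<Sum>b\<in>B. f e c t s b)" by (rule sum.swap)
  finally show ?thesis .
qed

text \<open>Common pattern of the estimates \<open>gram_abc\<close> to \<open>gram_b\<close>:
  \<open>W\<close> depends on some of the rearranged indices, and the others are summed outside the
  square. Attaching the row and column parts of these free indices to the two components of
  \<open>e\<close> makes the summand an entry of \<open>U W U^T\<close>, and the Gram matrix of
  \<open>U\<close> is then the partial trace of \<open>S\<close> over the free factors.\<close>

locale kron_factor =
  fixes p q r d :: nat and R S :: "nat \<Rightarrow> nat \<Rightarrow> real"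
  assumes S: "\<And>i j. i < p * q * r \<Longrightarrow> j < p * q * r \<Longrightarrow> S i j = (\<Sum>m<d. R i m * R j m)"
begin

abbreviation "PP \<equiv> {..<p} \<times> {..<p}"
abbreviation "QQ \<equiv> {..<q} \<times> {..<q}"
abbreviation "RR \<equiv> {..<r} \<times> {..<r}"
abbreviation "kf \<equiv> kfac q r R"
abbreviation "DD \<equiv> {..<d} \<times> {..<d}"

lemma S_index: "a < p \<Longrightarrow> b < q \<Longrightarrow> c < r \<Longrightarrow> a' < p \<Longrightarrow> b' < q \<Longrightarrow> c' < r \<Longrightarrow>
  S (a * q * r + b * r + c) (a' * q * r + b' * r + c') =
  (\<Sum>m<d. R (a * q * r + b * r + c) m * R (a' * q * r + b' * r + c') m)"
  by (intro S triple_index_less)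

lemma gram_abc:
  "(\<Sum>e\<in>DD. (\<Sum>a\<in>PP. \<Sum>b\<in>QQ. \<Sum>c\<in>RR. W a b c * kf e a b c)\<^sup>2)
    \<le> (mat_opnorm (p * q * r) (p * q * r) S)\<^sup>2 * (\<Sum>a\<in>PP. \<Sum>b\<in>QQ. \<Sum>c\<in>RR. (W a b c)\<^sup>2)"
  (is "?l \<le> ?c * _")
proof -
  define u where "u = (\<lambda>m j. R (fst j * q * r + fst (snd j) * r + snd (snd j)) m)"
  have "?l =
    (\<Sum>k\<in>{..<d}. \<Sum>k'\<in>{..<d}. (\<Sum>i\<in>{..<p}\<times>{..<q}\<times>{..<r}. \<Sum>j\<in>{..<p}\<times>{..<q}\<times>{..<r}.
      W (fst i, fst j) (fst (snd i), fst (snd j)) (snd (snd i), snd (snd j)) * (u k i * u k' j))\<^sup>2)"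
    unfolding sum_regroup3 unfolding sum_square_pairs by (simp add: kfac_def u_def)
  also have "\<dots> \<le> ?c * (\<Sum>i\<in>{..<p}\<times>{..<q}\<times>{..<r}. \<Sum>j\<in>{..<p}\<times>{..<q}\<times>{..<r}.
      (W (fst i, fst j) (fst (snd i), fst (snd j)) (snd (snd i), snd (snd j)))\<^sup>2)"
    by (rule gram_bilinear_bound[OF _ _ bij_betw_triple_index]) (auto simp: u_def S_index)
  finally show ?thesis unfolding sum_regroup3[of "\<lambda>a b c. (W a b c)\<^sup>2"] .
qed

lemma gram_bc:
  "(\<Sum>e\<in>DD. \<Sum>a\<in>PP. (\<Sum>b\<in>QQ. \<Sum>c\<in>RR. W b c * kf e a b c)\<^sup>2)
    \<le> (mat_opnorm (q * r) (q * r) (Tr1 p q r S))\<^sup>2 * (\<Sum>b\<in>QQ. \<Sum>c\<in>RR. (W b c)\<^sup>2)"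
  (is "?l \<le> ?c * _")
proof -
  define u where "u = (\<lambda>k j. R (snd k * q * r + fst j * r + snd j) (fst k))"
  have "?l =
    (\<Sum>k\<in>{..<d}\<times>{..<p}. \<Sum>k'\<in>{..<d}\<times>{..<p}. (\<Sum>i\<in>{..<q}\<times>{..<r}. \<Sum>j\<in>{..<q}\<times>{..<r}.
      W (fst i, fst j) (snd i, snd j) * (u k i * u k' j))\<^sup>2)"
    unfolding sum_regroup2 by (simp add: kfac_def u_def)
  also have "\<dots> \<le> ?c * (\<Sum>i\<in>{..<q}\<times>{..<r}. \<Sum>j\<in>{..<q}\<times>{..<r}.
      (W (fst i, fst j) (snd i, snd j))\<^sup>2)"
    by (rule gram_bilinear_bound[OF _ _ bij_betw_pair_index])
      (auto simp: u_def S_index Tr1_index sum_times_swap sum.cartesian_product')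
  finally show ?thesis unfolding sum_regroup2[of "\<lambda>b c. (W b c)\<^sup>2"] .
qed

lemma gram_ac:
  "(\<Sum>e\<in>DD. \<Sum>b\<in>QQ. (\<Sum>a\<in>PP. \<Sum>c\<in>RR. W a c * kf e a b c)\<^sup>2)
    \<le> (mat_opnorm (p * r) (p * r) (Tr2 p q r S))\<^sup>2 * (\<Sum>a\<in>PP. \<Sum>c\<in>RR. (W a c)\<^sup>2)"
  (is "?l \<le> ?c * _")
proof -
  define u where "u = (\<lambda>k j. R (fst j * q * r + snd k * r + snd j) (fst k))"
  have "?l =
    (\<Sum>k\<in>{..<d}\<times>{..<q}. \<Sum>k'\<in>{..<d}\<times>{..<q}. (\<Sum>i\<in>{..<p}\<times>{..<r}. \<Sum>j\<in>{..<p}\<times>{..<r}.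
      W (fst i, fst j) (snd i, snd j) * (u k i * u k' j))\<^sup>2)"
    unfolding sum_regroup2 by (simp add: kfac_def u_def)
  also have "\<dots> \<le> ?c * (\<Sum>i\<in>{..<p}\<times>{..<r}. \<Sum>j\<in>{..<p}\<times>{..<r}.
      (W (fst i, fst j) (snd i, snd j))\<^sup>2)"
    by (rule gram_bilinear_bound[OF _ _ bij_betw_pair_index])
      (auto simp: u_def S_index Tr2_index sum_times_swap sum.cartesian_product')
  finally show ?thesis unfolding sum_regroup2[of "\<lambda>b c. (W b c)\<^sup>2"] .
qed

lemma gram_ab:
  "(\<Sum>e\<in>DD. \<Sum>c\<in>RR. (\<Sum>a\<in>PP. \<Sum>b\<in>QQ. W a b * kf e a b c)\<^sup>2)
    \<le> (mat_opnorm (p * q) (p * q) (Tr3 p q r S))\<^sup>2 * (\<Sum>a\<in>PP. \<Sum>b\<in>QQ. (W a b)\<^sup>2)"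
  (is "?l \<le> ?c * _")
proof -
  define u where "u = (\<lambda>k j. R (fst j * q * r + snd j * r + snd k) (fst k))"
  have "?l =
    (\<Sum>k\<in>{..<d}\<times>{..<r}. \<Sum>k'\<in>{..<d}\<times>{..<r}. (\<Sum>i\<in>{..<p}\<times>{..<q}. \<Sum>j\<in>{..<p}\<times>{..<q}.
      W (fst i, fst j) (snd i, snd j) * (u k i * u k' j))\<^sup>2)"
    unfolding sum_regroup2 by (simp add: kfac_def u_def)
  also have "\<dots> \<le> ?c * (\<Sum>i\<in>{..<p}\<times>{..<q}. \<Sum>j\<in>{..<p}\<times>{..<q}.
      (W (fst i, fst j) (snd i, snd j))\<^sup>2)"
    by (rule gram_bilinear_bound[OF _ _ bij_betw_pair_index])
      (auto simp: u_def S_index Tr3_index sum_times_swap sum.cartesian_product')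
  finally show ?thesis unfolding sum_regroup2[of "\<lambda>b c. (W b c)\<^sup>2"] .
qed

lemma bij_betw_ident: "bij_betw (\<lambda>x. x) A A"
  by (simp add: bij_betw_def)

lemma gram_c:
  "(\<Sum>e\<in>DD. \<Sum>a\<in>PP. \<Sum>b\<in>QQ. (\<Sum>c\<in>RR. W c * kf e a b c)\<^sup>2)
    \<le> (mat_opnorm r r (Tr12 p q r S))\<^sup>2 * (\<Sum>c\<in>RR. (W c)\<^sup>2)"
  (is "?l \<le> ?c * _")
proof -
  define u where "u = (\<lambda>k j. R (fst (snd k) * q * r + snd (snd k) * r + j) (fst k))"
  have "?l =
    (\<Sum>k\<in>{..<d}\<times>{..<p}\<times>{..<q}. \<Sum>k'\<in>{..<d}\<times>{..<p}\<times>{..<q}. (\<Sum>i\<in>{..<r}. \<Sum>j\<in>{..<r}.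
      W (i, j) * (u k i * u k' j))\<^sup>2)"
    unfolding sum_regroup3 unfolding sum_square_pairs by (simp add: kfac_def u_def)
  also have "\<dots> \<le> ?c * (\<Sum>i\<in>{..<r}. \<Sum>j\<in>{..<r}. (W (i, j))\<^sup>2)"
    by (rule gram_bilinear_bound[OF _ _ bij_betw_ident])
      (auto simp: u_def S_index Tr12_index sum_times_swap2)
  finally show ?thesis unfolding sum_square_pairs .
qed

lemma gram_a:
  "(\<Sum>e\<in>DD. \<Sum>c\<in>RR. \<Sum>b\<in>QQ. (\<Sum>a\<in>PP. W a * kf e a b c)\<^sup>2)
    \<le> (mat_opnorm p p (Tr23 p q r S))\<^sup>2 * (\<Sum>a\<in>PP. (W a)\<^sup>2)"
  (is "?l \<le> ?c * _")
proof -
  define u where "u = (\<lambda>k j. R (j * q * r + snd (snd k) * r + fst (snd k)) (fst k))"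
  have "?l =
    (\<Sum>k\<in>{..<d}\<times>{..<r}\<times>{..<q}. \<Sum>k'\<in>{..<d}\<times>{..<r}\<times>{..<q}. (\<Sum>i\<in>{..<p}. \<Sum>j\<in>{..<p}.
      W (i, j) * (u k i * u k' j))\<^sup>2)"
    unfolding sum_regroup3 unfolding sum_square_pairs by (simp add: kfac_def u_def)
  also have "\<dots> \<le> ?c * (\<Sum>i\<in>{..<p}. \<Sum>j\<in>{..<p}. (W (i, j))\<^sup>2)"
    by (rule gram_bilinear_bound[OF _ _ bij_betw_ident])
      (auto simp: u_def S_index Tr23_index sum_times_swap2)
  finally show ?thesis unfolding sum_square_pairs .
qed

lemma gram_b:
  "(\<Sum>e\<in>DD. \<Sum>a\<in>PP. \<Sum>c\<in>RR. (\<Sum>b\<in>QQ. W b * kf e a b c)\<^sup>2)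
    \<le> (mat_opnorm q q (Tr13 p q r S))\<^sup>2 * (\<Sum>b\<in>QQ. (W b)\<^sup>2)"
  (is "?l \<le> ?c * _")
proof -
  define u where "u = (\<lambda>k j. R (fst (snd k) * q * r + j * r + snd (snd k)) (fst k))"
  have "?l =
    (\<Sum>k\<in>{..<d}\<times>{..<p}\<times>{..<r}. \<Sum>k'\<in>{..<d}\<times>{..<p}\<times>{..<r}. (\<Sum>i\<in>{..<q}. \<Sum>j\<in>{..<q}.
      W (i, j) * (u k i * u k' j))\<^sup>2)"
    unfolding sum_regroup3 unfolding sum_square_pairs by (simp add: kfac_def u_def)
  also have "\<dots> \<le> ?c * (\<Sum>i\<in>{..<q}. \<Sum>j\<in>{..<q}. (W (i, j))\<^sup>2)"
    by (rule gram_bilinear_bound[OF _ _ bij_betw_ident])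
      (auto simp: u_def S_index Tr13_index sum_times_swap2)
  finally show ?thesis unfolding sum_square_pairs .
qed

text \<open>With every index free, the sum of squares splits into one factor for the row part and
  one for the column part, each adding up over \<open>m\<close> to the trace.\<close>

lemma gram_full:
  "(\<Sum>e\<in>DD. \<Sum>a\<in>PP. \<Sum>b\<in>QQ. \<Sum>c\<in>RR. (kf e a b c)\<^sup>2) = (Tr123 p q r S)\<^sup>2"
proof -
  define f where "f = (\<lambda>m. \<Sum>j\<in>{..<p}\<times>{..<q}\<times>{..<r}. (R (fst j * q * r + fst (snd j) * r + snd (snd j)) m)\<^sup>2)"
  have "(\<Sum>a\<in>PP. \<Sum>b\<in>QQ. \<Sum>c\<in>RR. (kf e a b c)\<^sup>2) = f (fst e) * f (snd e)" for e
    unfolding sum_regroup3 by (simp add: kfac_def f_def power_mult_distrib sum_product)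
  then have "(\<Sum>e\<in>DD. \<Sum>a\<in>PP. \<Sum>b\<in>QQ. \<Sum>c\<in>RR. (kf e a b c)\<^sup>2) = (\<Sum>m<d. \<Sum>m'<d. f m * f m')"
    by (simp add: sum_square_pairs)
  also have "\<dots> = (\<Sum>m<d. f m)\<^sup>2" by (simp add: power2_eq_square sum_product)
  also have "(\<Sum>m<d. f m) = (\<Sum>j\<in>{..<p}\<times>{..<q}\<times>{..<r}. \<Sum>m<d. (R (fst j * q * r + fst (snd j) * r + snd (snd j)) m)\<^sup>2)"
    unfolding f_def by (rule sum.swap)
  also have "\<dots> = (\<Sum>j\<in>{..<p}\<times>{..<q}\<times>{..<r}. (\<lambda>i. S i i) ((\<lambda>(a, b, c). a * q * r + b * r + c) j))"
    by (intro sum.cong refl) (auto simp: S_index power2_eq_square)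
  also have "\<dots> = Tr123 p q r S"
    unfolding Tr123_def mat_trace_def by (rule sum.reindex_bij_betw[OF bij_betw_triple_index])
  finally show ?thesis .
qed

text \<open>By chaining the hypotheses on the norms, the term in which noise replaces a given set of
  arguments is at most \<open>N^2\<close> times the product of \<open>s1 * e1^2\<close>,
  \<open>s2 * e2^2 * l1 * l3\<close>, \<open>s3 * e3^2\<close> over that set. Each factor is at most
  1/2, and the eight products then add up to at most \<open>(1 + 1/2)^3 = 27/8\<close>. The factor
  \<open>l1 * l3\<close> belongs to the second argument alone: while \<open>x2\<close> is present
  its norm absorbs the sums over \<open>s\<close> and \<open>t\<close>, and without it these sums
  are free.\<close>

lemma second_moment_bound:
  fixes x1 x3 :: "(nat \<times> nat) \<times> nat \<Rightarrow> real" and x2 :: "nat \<times> (nat \<times> nat) \<times> nat \<Rightarrow> real"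
  defines "N \<equiv> mat_opnorm (p * q * r) (p * q * r) S"
    and "c1 \<equiv> mat_opnorm (q * r) (q * r) (Tr1 p q r S)" and "c2 \<equiv> mat_opnorm (p * r) (p * r) (Tr2 p q r S)"
    and "c3 \<equiv> mat_opnorm (p * q) (p * q) (Tr3 p q r S)" and "c12 \<equiv> mat_opnorm r r (Tr12 p q r S)"
    and "c23 \<equiv> mat_opnorm p p (Tr23 p q r S)" and "c13 \<equiv> mat_opnorm q q (Tr13 p q r S)"
  assumes x1: "\<And>y. (\<Sum>a\<in>PP. (\<Sum>s<l1. x1 (a, s) * y s)\<^sup>2) \<le> (\<Sum>s<l1. (y s)\<^sup>2)"
    and x3: "\<And>y. (\<Sum>c\<in>RR. (\<Sum>t<l3. x3 (c, t) * y t)\<^sup>2) \<le> (\<Sum>t<l3. (y t)\<^sup>2)"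
    and x2: "(\<Sum>s<l1. \<Sum>b\<in>QQ. \<Sum>t<l3. (x2 (s, b, t))\<^sup>2) \<le> 1"
    and s: "0 \<le> s1" "0 \<le> s2" "0 \<le> s3" and e: "0 \<le> e1" "0 \<le> e2" "0 \<le> e3"
    and se: "s1 * e1\<^sup>2 \<le> 1 / 2" "s2 * (e2\<^sup>2 * real (l1 * l3)) \<le> 1 / 2" "s3 * e3\<^sup>2 \<le> 1 / 2"
    and c: "c1 \<le> e1 * N" "c2 \<le> e2 * N" "c3 \<le> e3 * N" "c12 \<le> e1 * c2" "c23 \<le> e2 * c3" "c13 \<le> e3 * c1"
      "\<bar>Tr123 p q r S\<bar> \<le> e3 * c12"
  shows "(\<Sum>e\<in>DD. (tform PP QQ RR l1 l3 (kf e) x1 x2 x3)\<^sup>2)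
      + s1 * (\<Sum>e\<in>DD. \<Sum>j\<in>PP \<times> {..<l1}. (tcoef1 QQ RR l3 (kf e) x2 x3 (fst j) (snd j))\<^sup>2)
      + s2 * (\<Sum>(e, s, b, t)\<in>DD \<times> {..<l1} \<times> QQ \<times> {..<l3}. (tcoef2 PP RR (kf e) x1 x3 s b t)\<^sup>2)
      + s1 * s2 * (\<Sum>(e, s, b, t)\<in>DD \<times> {..<l1} \<times> QQ \<times> {..<l3}. \<Sum>a\<in>PP. (\<Sum>c\<in>RR. x3 (c, t) * kf e a b c)\<^sup>2)
      + s3 * (\<Sum>(e, c, t)\<in>DD \<times> RR \<times> {..<l3}. (tcoef3 PP QQ l1 (kf e) x1 x2 c t)\<^sup>2)
      + s1 * s3 * (\<Sum>(e, c, t)\<in>DD \<times> RR \<times> {..<l3}. \<Sum>j\<in>PP \<times> {..<l1}. (\<Sum>b\<in>QQ. x2 (snd j, b, t) * kf e (fst j) b c)\<^sup>2)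
      + s2 * s3 * (\<Sum>(e, c, t, s, b)\<in>DD \<times> RR \<times> {..<l3} \<times> {..<l1} \<times> QQ. (\<Sum>a\<in>PP. x1 (a, s) * kf e a b c)\<^sup>2)
      + s1 * s2 * s3 * (\<Sum>(e, c, t, s, b)\<in>DD \<times> RR \<times> {..<l3} \<times> {..<l1} \<times> QQ. \<Sum>a\<in>PP. (kf e a b c)\<^sup>2)
    \<le> 27 / 8 * N\<^sup>2"
proof -
  let ?L = "real (l1 * l3)"
  note col1 = column_norm_le[OF x1] and col3 = column_norm_le[OF x3]
  have L: "(\<Sum>s<l1. \<Sum>t<l3. B) = ?L * B" for B by (simp add: algebra_simps)
  have x2': "(\<Sum>s<l1. \<Sum>t<l3. \<Sum>b\<in>QQ. (x2 (s, b, t))\<^sup>2) \<le> 1"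
  proof -
    have "(\<Sum>s<l1. \<Sum>t<l3. \<Sum>b\<in>QQ. (x2 (s, b, t))\<^sup>2) = (\<Sum>s<l1. \<Sum>b\<in>QQ. \<Sum>t<l3. (x2 (s, b, t))\<^sup>2)"
      by (intro sum.cong refl sum.swap)
    with x2 show ?thesis by simp
  qed
  \<comment> \<open>Contracting with \<open>x1\<close> or \<open>x3\<close> does not increase a
    Frobenius norm, so the partially contracted coefficient tensors inherit norm at most 1 from
    \<open>x2\<close>.\<close>
  have fbc: "(\<Sum>s<l1. \<Sum>b\<in>QQ. \<Sum>c\<in>RR. (\<Sum>t<l3. x2 (s, b, t) * x3 (c, t))\<^sup>2) \<le> 1"
  proof -
    have "(\<Sum>s<l1. \<Sum>b\<in>QQ. \<Sum>c\<in>RR. (\<Sum>t<l3. x2 (s, b, t) * x3 (c, t))\<^sup>2)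
      \<le> (\<Sum>s<l1. \<Sum>b\<in>QQ. \<Sum>t<l3. (x2 (s, b, t))\<^sup>2)"
      using x3[of "\<lambda>t. x2 (s, b, t)" for s b] by (intro sum_mono) (simp add: mult.commute)
    with x2 show ?thesis by simp
  qed
  have fab: "(\<Sum>t<l3. \<Sum>a\<in>PP. \<Sum>b\<in>QQ. (\<Sum>s<l1. x1 (a, s) * x2 (s, b, t))\<^sup>2) \<le> 1"
  proof -
    have "(\<Sum>t<l3. \<Sum>a\<in>PP. \<Sum>b\<in>QQ. (\<Sum>s<l1. x1 (a, s) * x2 (s, b, t))\<^sup>2) =
      (\<Sum>t<l3. \<Sum>b\<in>QQ. \<Sum>a\<in>PP. (\<Sum>s<l1. x1 (a, s) * x2 (s, b, t))\<^sup>2)"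
      by (intro sum.cong refl sum.swap)
    also have "\<dots> \<le> (\<Sum>t<l3. \<Sum>b\<in>QQ. \<Sum>s<l1. (x2 (s, b, t))\<^sup>2)"
      by (intro sum_mono x1)
    also have "\<dots> = (\<Sum>t<l3. \<Sum>s<l1. \<Sum>b\<in>QQ. (x2 (s, b, t))\<^sup>2)" by (intro sum.cong refl sum.swap)
    also have "\<dots> = (\<Sum>s<l1. \<Sum>t<l3. \<Sum>b\<in>QQ. (x2 (s, b, t))\<^sup>2)" by (rule sum.swap)
    finally show ?thesis using x2' by simp
  qed
  have fabc: "(\<Sum>a\<in>PP. \<Sum>b\<in>QQ. \<Sum>c\<in>RR. (\<Sum>s<l1. x1 (a, s) * (\<Sum>t<l3. x2 (s, b, t) * x3 (c, t)))\<^sup>2) \<le> 1"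
  proof -
    let ?y = "\<lambda>s b c. \<Sum>t<l3. x2 (s, b, t) * x3 (c, t)"
    have "(\<Sum>a\<in>PP. \<Sum>b\<in>QQ. \<Sum>c\<in>RR. (\<Sum>s<l1. x1 (a, s) * ?y s b c)\<^sup>2) =
      (\<Sum>b\<in>QQ. \<Sum>a\<in>PP. \<Sum>c\<in>RR. (\<Sum>s<l1. x1 (a, s) * ?y s b c)\<^sup>2)" by (rule sum.swap)
    also have "\<dots> = (\<Sum>b\<in>QQ. \<Sum>c\<in>RR. \<Sum>a\<in>PP. (\<Sum>s<l1. x1 (a, s) * ?y s b c)\<^sup>2)"
      by (intro sum.cong refl sum.swap)
    also have "\<dots> \<le> (\<Sum>b\<in>QQ. \<Sum>c\<in>RR. \<Sum>s<l1. (?y s b c)\<^sup>2)" by (intro sum_mono x1)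
    also have "\<dots> = (\<Sum>b\<in>QQ. \<Sum>s<l1. \<Sum>c\<in>RR. (?y s b c)\<^sup>2)" by (intro sum.cong refl sum.swap)
    also have "\<dots> = (\<Sum>s<l1. \<Sum>b\<in>QQ. \<Sum>c\<in>RR. (?y s b c)\<^sup>2)" by (rule sum.swap)
    finally show ?thesis using fbc by simp
  qed
  have le1: "B * x \<le> B" if "x \<le> 1" "0 \<le> B" for B x :: real
    using mult_left_mono[OF that] by simp
  have T1: "(\<Sum>e\<in>DD. (tform PP QQ RR l1 l3 (kf e) x1 x2 x3)\<^sup>2) \<le> N\<^sup>2"
  proof -
    have "(\<Sum>e\<in>DD. (tform PP QQ RR l1 l3 (kf e) x1 x2 x3)\<^sup>2) \<le> N\<^sup>2 *
       (\<Sum>a\<in>PP. \<Sum>b\<in>QQ. \<Sum>c\<in>RR. (\<Sum>s<l1. x1 (a, s) * (\<Sum>t<l3. x2 (s, b, t) * x3 (c, t)))\<^sup>2)"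
      unfolding N_def tform_tensor by (rule gram_abc)
    also have "\<dots> \<le> N\<^sup>2" using fabc by (rule le1) simp
    finally show ?thesis .
  qed
  have T2: "(\<Sum>e\<in>DD. \<Sum>j\<in>PP \<times> {..<l1}. (tcoef1 QQ RR l3 (kf e) x2 x3 (fst j) (snd j))\<^sup>2) \<le> c1\<^sup>2" (is "?l \<le> _")
  proof -
    \<comment> \<open>The coefficients of \<open>E\<close> do not involve \<open>a\<close>; this
      index is therefore free, and the estimate is the one with \<open>Tr1\<close>.\<close>
    have tc: "tcoef1 QQ RR l3 E x2 x3 a s = (\<Sum>b\<in>QQ. \<Sum>c\<in>RR. (\<Sum>t<l3. x2 (s, b, t) * x3 (c, t)) * E a b c)" for E a s
    proof -
      have "tcoef1 QQ RR l3 E x2 x3 a s = (\<Sum>b\<in>QQ. \<Sum>t<l3. \<Sum>c\<in>RR. x2 (s, b, t) * x3 (c, t) * E a b c)"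
        unfolding tcoef1_def by (rule sum.swap)
      also have "\<dots> = (\<Sum>b\<in>QQ. \<Sum>c\<in>RR. \<Sum>t<l3. x2 (s, b, t) * x3 (c, t) * E a b c)"
        by (intro sum.cong refl sum.swap)
      finally show ?thesis by (simp only: sum_distrib_right)
    qed
    have "?l =
      (\<Sum>e\<in>DD. \<Sum>s<l1. \<Sum>a\<in>PP. (tcoef1 QQ RR l3 (kf e) x2 x3 a s)\<^sup>2)"
      by (simp add: sum_times_swap)
    also have "\<dots> = (\<Sum>s<l1. \<Sum>e\<in>DD. \<Sum>a\<in>PP. (tcoef1 QQ RR l3 (kf e) x2 x3 a s)\<^sup>2)"
      by (rule sum.swap)
    also have "\<dots> \<le> (\<Sum>s<l1. c1\<^sup>2 * (\<Sum>b\<in>QQ. \<Sum>c\<in>RR. (\<Sum>t<l3. x2 (s, b, t) * x3 (c, t))\<^sup>2))"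
      unfolding tc c1_def by (intro sum_mono gram_bc)
    also have "\<dots> \<le> c1\<^sup>2" unfolding sum_distrib_left[symmetric] using fbc by (rule le1) simp
    finally show ?thesis .
  qed
  have T3: "(\<Sum>(e, s, b, t)\<in>DD \<times> {..<l1} \<times> QQ \<times> {..<l3}. (tcoef2 PP RR (kf e) x1 x3 s b t)\<^sup>2) \<le> ?L * c2\<^sup>2" (is "?l \<le> _")
  proof -
    have "?l
      = (\<Sum>s<l1. \<Sum>t<l3. \<Sum>e\<in>DD. \<Sum>b\<in>QQ. (tcoef2 PP RR (kf e) x1 x3 s b t)\<^sup>2)"
      by (rule sum_tuple4)
    also have "\<dots> \<le> (\<Sum>s<l1. \<Sum>t<l3. c2\<^sup>2 * (\<Sum>a\<in>PP. \<Sum>c\<in>RR. (x1 (a, s) * x3 (c, t))\<^sup>2))"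
      unfolding tcoef2_def c2_def by (intro sum_mono gram_ac)
    also have "\<dots> \<le> (\<Sum>s<l1. \<Sum>t<l3. c2\<^sup>2)"
    proof (intro sum_mono le1)
      fix s t assume "s \<in> {..<l1}" "t \<in> {..<l3}"
      then have "(\<Sum>a\<in>PP. (x1 (a, s))\<^sup>2) * (\<Sum>c\<in>RR. (x3 (c, t))\<^sup>2) \<le> 1 * 1"
        by (intro mult_mono col1 col3 sum_nonneg) auto
      then show "(\<Sum>a\<in>PP. \<Sum>c\<in>RR. (x1 (a, s) * x3 (c, t))\<^sup>2) \<le> 1"
        by (simp only: power_mult_distrib sum_product mult_1)
    qed simp
    finally show ?thesis unfolding L .
  qed
  \<comment> \<open>Here \<open>x1\<close> and \<open>x2\<close> are both replaced: \<open>a\<close>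
    and \<open>b\<close> are free, which gives \<open>Tr12\<close>. The summand is constant in
    \<open>s\<close>, and each column of \<open>x3\<close> has norm at most 1.\<close>
  have T4: "(\<Sum>(e, s, b, t)\<in>DD \<times> {..<l1} \<times> QQ \<times> {..<l3}. \<Sum>a\<in>PP. (\<Sum>c\<in>RR. x3 (c, t) * kf e a b c)\<^sup>2) \<le> ?L * c12\<^sup>2" (is "?l \<le> _")
  proof -
    have "?l
      = (\<Sum>s<l1. \<Sum>t<l3. \<Sum>e\<in>DD. \<Sum>b\<in>QQ. \<Sum>a\<in>PP. (\<Sum>c\<in>RR. x3 (c, t) * kf e a b c)\<^sup>2)"
      by (rule sum_tuple4)
    also have "\<dots> = (\<Sum>s<l1. \<Sum>t<l3. \<Sum>e\<in>DD. \<Sum>a\<in>PP. \<Sum>b\<in>QQ. (\<Sum>c\<in>RR. x3 (c, t) * kf e a b c)\<^sup>2)"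
      by (intro sum.cong refl sum.swap)
    also have "\<dots> \<le> (\<Sum>s<l1. \<Sum>t<l3. c12\<^sup>2 * (\<Sum>c\<in>RR. (x3 (c, t))\<^sup>2))"
      unfolding c12_def by (intro sum_mono gram_c)
    also have "\<dots> \<le> (\<Sum>s<l1. \<Sum>t<l3. c12\<^sup>2)" by (intro sum_mono le1 col3) auto
    finally show ?thesis unfolding L .
  qed
  have T5: "(\<Sum>(e, c, t)\<in>DD \<times> RR \<times> {..<l3}. (tcoef3 PP QQ l1 (kf e) x1 x2 c t)\<^sup>2) \<le> c3\<^sup>2" (is "?l \<le> _")
  proof -
    have tc: "tcoef3 PP QQ l1 E x1 x2 c t = (\<Sum>a\<in>PP. \<Sum>b\<in>QQ. (\<Sum>s<l1. x1 (a, s) * x2 (s, b, t)) * E a b c)" for E c t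
    proof -
      have "tcoef3 PP QQ l1 E x1 x2 c t = (\<Sum>a\<in>PP. \<Sum>s<l1. \<Sum>b\<in>QQ. x1 (a, s) * x2 (s, b, t) * E a b c)"
        unfolding tcoef3_def by (rule sum.swap)
      also have "\<dots> = (\<Sum>a\<in>PP. \<Sum>b\<in>QQ. \<Sum>s<l1. x1 (a, s) * x2 (s, b, t) * E a b c)"
        by (intro sum.cong refl sum.swap)
      finally show ?thesis by (simp only: sum_distrib_right)
    qed
    have "?l =
      (\<Sum>t<l3. \<Sum>e\<in>DD. \<Sum>c\<in>RR. (tcoef3 PP QQ l1 (kf e) x1 x2 c t)\<^sup>2)"
      by (rule sum_tuple3)
    also have "\<dots> \<le> (\<Sum>t<l3. c3\<^sup>2 * (\<Sum>a\<in>PP. \<Sum>b\<in>QQ. (\<Sum>s<l1. x1 (a, s) * x2 (s, b, t))\<^sup>2))"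
      unfolding tc c3_def by (intro sum_mono gram_ab)
    also have "\<dots> \<le> c3\<^sup>2" unfolding sum_distrib_left[symmetric] using fab by (rule le1) simp
    finally show ?thesis .
  qed
  \<comment> \<open>Although \<open>x1\<close> and \<open>x3\<close> are both replaced, no factor
    \<open>l1 * l3\<close> arises: the slices of \<open>x2\<close> along \<open>b\<close> have
    squared norms adding up to at most 1.\<close>
  have T6: "(\<Sum>(e, c, t)\<in>DD \<times> RR \<times> {..<l3}. \<Sum>j\<in>PP \<times> {..<l1}. (\<Sum>b\<in>QQ. x2 (snd j, b, t) * kf e (fst j) b c)\<^sup>2) \<le> c13\<^sup>2" (is "?l \<le> _")
  proof -
    have "?l
      = (\<Sum>s<l1. \<Sum>t<l3. \<Sum>e\<in>DD. \<Sum>c\<in>RR. \<Sum>a\<in>PP. (\<Sum>b\<in>QQ. x2 (s, b, t) * kf e a b c)\<^sup>2)"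
      (is "_ = (\<Sum>s<l1. \<Sum>t<l3. \<Sum>e\<in>DD. \<Sum>c\<in>RR. ?g s t e c)")
    proof -
      have "?l = (\<Sum>t<l3. \<Sum>e\<in>DD. \<Sum>c\<in>RR. \<Sum>j\<in>PP \<times> {..<l1}. (\<Sum>b\<in>QQ. x2 (snd j, b, t) * kf e (fst j) b c)\<^sup>2)"
        by (rule sum_tuple3)
      also have "\<dots> = (\<Sum>t<l3. \<Sum>e\<in>DD. \<Sum>c\<in>RR. \<Sum>s<l1. ?g s t e c)"
        by (simp only: sum_times_swap[of _ PP "{..<l1}"] fst_conv snd_conv)
      also have "\<dots> = (\<Sum>t<l3. \<Sum>e\<in>DD. \<Sum>s<l1. \<Sum>c\<in>RR. ?g s t e c)" by (intro sum.cong refl sum.swap)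
      also have "\<dots> = (\<Sum>t<l3. \<Sum>s<l1. \<Sum>e\<in>DD. \<Sum>c\<in>RR. ?g s t e c)" by (intro sum.cong refl sum.swap)
      also have "\<dots> = (\<Sum>s<l1. \<Sum>t<l3. \<Sum>e\<in>DD. \<Sum>c\<in>RR. ?g s t e c)" by (rule sum.swap)
      finally show ?thesis .
    qed
    also have "\<dots> = (\<Sum>s<l1. \<Sum>t<l3. \<Sum>e\<in>DD. \<Sum>a\<in>PP. \<Sum>c\<in>RR. (\<Sum>b\<in>QQ. x2 (s, b, t) * kf e a b c)\<^sup>2)"
      by (intro sum.cong refl sum.swap)
    also have "\<dots> \<le> (\<Sum>s<l1. \<Sum>t<l3. c13\<^sup>2 * (\<Sum>b\<in>QQ. (x2 (s, b, t))\<^sup>2))"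
      unfolding c13_def by (intro sum_mono gram_b)
    also have "\<dots> \<le> c13\<^sup>2" unfolding sum_distrib_left[symmetric] using x2' by (rule le1) simp
    finally show ?thesis .
  qed
  have T7: "(\<Sum>(e, c, t, s, b)\<in>DD \<times> RR \<times> {..<l3} \<times> {..<l1} \<times> QQ. (\<Sum>a\<in>PP. x1 (a, s) * kf e a b c)\<^sup>2) \<le> ?L * c23\<^sup>2" (is "?l \<le> _")
  proof -
    have "?l
      = (\<Sum>s<l1. \<Sum>t<l3. \<Sum>e\<in>DD. \<Sum>c\<in>RR. \<Sum>b\<in>QQ. (\<Sum>a\<in>PP. x1 (a, s) * kf e a b c)\<^sup>2)"
      by (rule sum_tuple5)
    also have "\<dots> \<le> (\<Sum>s<l1. \<Sum>t<l3. c23\<^sup>2 * (\<Sum>a\<in>PP. (x1 (a, s))\<^sup>2))"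
      unfolding c23_def by (intro sum_mono gram_a)
    also have "\<dots> \<le> (\<Sum>s<l1. \<Sum>t<l3. c23\<^sup>2)" by (intro sum_mono le1 col1) auto
    finally show ?thesis unfolding L .
  qed
  have T8: "(\<Sum>(e, c, t, s, b)\<in>DD \<times> RR \<times> {..<l3} \<times> {..<l1} \<times> QQ. \<Sum>a\<in>PP. (kf e a b c)\<^sup>2) = ?L * (Tr123 p q r S)\<^sup>2" (is "?l = _")
  proof -
    have eq: "(\<Sum>c\<in>RR. \<Sum>b\<in>QQ. \<Sum>a\<in>PP. (kf e a b c)\<^sup>2) = (\<Sum>a\<in>PP. \<Sum>b\<in>QQ. \<Sum>c\<in>RR. (kf e a b c)\<^sup>2)" for e
    proof -
      have "(\<Sum>c\<in>RR. \<Sum>b\<in>QQ. \<Sum>a\<in>PP. (kf e a b c)\<^sup>2) = (\<Sum>c\<in>RR. \<Sum>a\<in>PP. \<Sum>b\<in>QQ. (kf e a b c)\<^sup>2)"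
        by (intro sum.cong refl sum.swap)
      also have "\<dots> = (\<Sum>a\<in>PP. \<Sum>c\<in>RR. \<Sum>b\<in>QQ. (kf e a b c)\<^sup>2)" by (rule sum.swap)
      also have "\<dots> = (\<Sum>a\<in>PP. \<Sum>b\<in>QQ. \<Sum>c\<in>RR. (kf e a b c)\<^sup>2)" by (intro sum.cong refl sum.swap)
      finally show ?thesis .
    qed
    have "?l
      = (\<Sum>s<l1. \<Sum>t<l3. \<Sum>e\<in>DD. \<Sum>c\<in>RR. \<Sum>b\<in>QQ. \<Sum>a\<in>PP. (kf e a b c)\<^sup>2)"
      by (rule sum_tuple5)
    then show ?thesis unfolding eq gram_full L .
  qed
  have nn: "0 \<le> N" "0 \<le> c1" "0 \<le> c2" "0 \<le> c3" "0 \<le> c12" "0 \<le> c23" "0 \<le> c13"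
    unfolding N_def c1_def c2_def c3_def c12_def c23_def c13_def by (rule mat_opnorm_nonneg)+
  define a1 where "a1 = s1 * e1\<^sup>2"
  define a2 where "a2 = s2 * (e2\<^sup>2 * ?L)"
  define a3 where "a3 = s3 * e3\<^sup>2"
  have a: "0 \<le> a1" "0 \<le> a2" "0 \<le> a3" "a1 \<le> 1/2" "a2 \<le> 1/2" "a3 \<le> 1/2"
    using s se unfolding a1_def a2_def a3_def by auto
  \<comment> \<open>Every double trace needs two links: for instance \<open>c12\<close> against
    \<open>c2\<close> costs \<open>e1\<close>, and \<open>c2\<close> against \<open>N\<close> costs
    \<open>e2\<close>. The full trace passes through \<open>c12\<close>.\<close>
  have n: "c12 \<le> e1 * e2 * N" "c23 \<le> e2 * e3 * N" "c13 \<le> e1 * e3 * N" "\<bar>Tr123 p q r S\<bar> \<le> e1 * e2 * e3 * N"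
  proof -
    show n1: "c12 \<le> e1 * e2 * N" using c(4) mult_left_mono[OF c(2) e(1)] by simp
    show "c23 \<le> e2 * e3 * N" using c(5) mult_left_mono[OF c(3) e(2)] by simp
    show "c13 \<le> e1 * e3 * N" using c(6) mult_left_mono[OF c(1) e(3)] by (simp add: mult_ac)
    show "\<bar>Tr123 p q r S\<bar> \<le> e1 * e2 * e3 * N" using c(7) mult_left_mono[OF n1 e(3)] by (simp add: mult_ac)
  qed
  have U: "s1 * c1\<^sup>2 \<le> a1 * N\<^sup>2" "s2 * (?L * c2\<^sup>2) \<le> a2 * N\<^sup>2" "s3 * c3\<^sup>2 \<le> a3 * N\<^sup>2"
    "s1 * s2 * (?L * c12\<^sup>2) \<le> a1 * a2 * N\<^sup>2" "s1 * s3 * c13\<^sup>2 \<le> a1 * a3 * N\<^sup>2" "s2 * s3 * (?L * c23\<^sup>2) \<le> a2 * a3 * N\<^sup>2"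
    "s1 * s2 * s3 * (?L * (Tr123 p q r S)\<^sup>2) \<le> a1 * a2 * a3 * N\<^sup>2"
  proof -
    have sq: "x\<^sup>2 \<le> (k * N)\<^sup>2" if "\<bar>x\<bar> \<le> k * N" for x k using that by (metis abs_ge_zero power2_abs power_mono)
    have sq': "K * x\<^sup>2 \<le> K * (k * N)\<^sup>2" if "\<bar>x\<bar> \<le> k * N" "0 \<le> K" for x k K
      using sq[OF that(1)] that(2) by (rule mult_left_mono)
    show "s1 * c1\<^sup>2 \<le> a1 * N\<^sup>2" using sq'[of c1 e1 s1] nn c s by (simp add: a1_def power_mult_distrib mult_ac)
    show "s2 * (?L * c2\<^sup>2) \<le> a2 * N\<^sup>2" using sq'[of c2 e2 "s2 * ?L"] nn c s by (simp add: a2_def power_mult_distrib mult_ac)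
    show "s3 * c3\<^sup>2 \<le> a3 * N\<^sup>2" using sq'[of c3 e3 s3] nn c s by (simp add: a3_def power_mult_distrib mult_ac)
    show "s1 * s2 * (?L * c12\<^sup>2) \<le> a1 * a2 * N\<^sup>2" using sq'[of c12 "e1 * e2" "s1 * s2 * ?L"] nn n s by (simp add: a1_def a2_def power_mult_distrib mult_ac)
    show "s1 * s3 * c13\<^sup>2 \<le> a1 * a3 * N\<^sup>2" using sq'[of c13 "e1 * e3" "s1 * s3"] nn n s by (simp add: a1_def a3_def power_mult_distrib mult_ac)
    show "s2 * s3 * (?L * c23\<^sup>2) \<le> a2 * a3 * N\<^sup>2" using sq'[of c23 "e2 * e3" "s2 * s3 * ?L"] nn n s by (simp add: a2_def a3_def power_mult_distrib mult_ac)
    show "s1 * s2 * s3 * (?L * (Tr123 p q r S)\<^sup>2) \<le> a1 * a2 * a3 * N\<^sup>2"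
      using sq'[of "Tr123 p q r S" "e1 * e2 * e3" "s1 * s2 * s3 * ?L"] n s by (simp add: a1_def a2_def a3_def power_mult_distrib mult_ac)
  qed
  have prods: "a1 * a2 \<le> 1/4" "a1 * a3 \<le> 1/4" "a2 * a3 \<le> 1/4" "a1 * a2 * a3 \<le> 1/8"
  proof -
    show p12: "a1 * a2 \<le> 1/4" using mult_mono[OF a(4,5)] a by simp
    show "a1 * a3 \<le> 1/4" using mult_mono[OF a(4,6)] a by simp
    show "a2 * a3 \<le> 1/4" using mult_mono[OF a(5,6)] a by simp
    show "a1 * a2 * a3 \<le> 1/8" using mult_mono[OF p12 a(6)] a by simp
  qed
  have V: "s1 * c1\<^sup>2 \<le> 1/2 * N\<^sup>2" "s2 * (?L * c2\<^sup>2) \<le> 1/2 * N\<^sup>2" "s3 * c3\<^sup>2 \<le> 1/2 * N\<^sup>2"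
    "s1 * s2 * (?L * c12\<^sup>2) \<le> 1/4 * N\<^sup>2" "s1 * s3 * c13\<^sup>2 \<le> 1/4 * N\<^sup>2" "s2 * s3 * (?L * c23\<^sup>2) \<le> 1/4 * N\<^sup>2"
    "s1 * s2 * s3 * (?L * (Tr123 p q r S)\<^sup>2) \<le> 1/8 * N\<^sup>2"
    using U a(4-6) prods by (meson mult_right_mono zero_le_power2 order_trans)+
  show ?thesis
    unfolding T8
    using T1 V mult_left_mono[OF T2 s(1)] mult_left_mono[OF T3 s(2)] mult_left_mono[OF T5 s(3)]
      mult_left_mono[OF T4 mult_nonneg_nonneg[OF s(1,2)]] mult_left_mono[OF T6 mult_nonneg_nonneg[OF s(1,3)]]
      mult_left_mono[OF T7 mult_nonneg_nonneg[OF s(2,3)]]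
    by linarith
qed

end

section \<open>Recentring and sign symmetrisation under truncation; Markov's inequality for the
  prior average\<close>

section \<open>Lower bound for the prior average\<close>

abbreviation (input) prod3 where
  "prod3 M1 M2 M3 \<equiv> M1 \<Otimes>\<^sub>M (M2 \<Otimes>\<^sub>M M3)"

lemma tform_measurable:
  "(\<lambda>x. tform I J K l1 l3 E (fst x) (fst (snd x)) (snd (snd x))) \<in> borel_measurable
    (RPi (I \<times> {..<l1}) \<Otimes>\<^sub>M (RPi ({..<l1} \<times> J \<times> {..<l3}) \<Otimes>\<^sub>M RPi (K \<times> {..<l3})))"
  (is "_ \<in> borel_measurable ?M")
proof -
  have c1: "(\<lambda>x. fst x (a, s) :: real) \<in> borel_measurable ?M" if "a \<in> I" "s < l1" for a s
    using that by (intro measurable_compose[OF measurable_fst measurable_component_singleton]) auto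
  have c2: "(\<lambda>x. fst (snd x) (s, b, t) :: real) \<in> borel_measurable ?M" if "s < l1" "b \<in> J" "t < l3" for s b t
    using that by (intro measurable_compose[OF measurable_compose[OF measurable_snd measurable_fst] measurable_component_singleton]) auto
  have c3: "(\<lambda>x. snd (snd x) (c, t) :: real) \<in> borel_measurable ?M" if "c \<in> K" "t < l3" for c t
    using that by (intro measurable_compose[OF measurable_compose[OF measurable_snd measurable_snd] measurable_component_singleton]) auto
  show ?thesis unfolding tform_def
    by (intro borel_measurable_sum borel_measurable_times borel_measurable_const c1 c2 c3) auto
qed

definition scal :: "'k set \<Rightarrow> real \<Rightarrow> ('k \<Rightarrow> real) \<Rightarrow> 'k \<Rightarrow> real" where
  "scal I \<sigma> g = (\<lambda>k\<in>I. \<sigma> * g k)"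

lemma scal_measurable: "scal I \<sigma> \<in> RPi I \<rightarrow>\<^sub>M RPi I"
  unfolding scal_def[abs_def] by (rule measurable_coord_map) measurable

lemma noise_scal:
  assumes N: "noise I s \<gamma>" and \<sigma>: "\<sigma> \<in> {1, -1}" and F: "F \<in> borel_measurable (RPi I)"
  shows "(\<integral>\<^sup>+g. F (scal I \<sigma> g) \<partial>\<gamma>) = (\<integral>\<^sup>+g. F g \<partial>\<gamma>)"
proof (cases "\<sigma> = 1")
  case True
  \<comment> \<open>\<open>scal I 1\<close> is the identity only on extensional functions, which is
    where \<gamma> lives.\<close>
  have "space \<gamma> = space (RPi I)"
    using noise_sets[OF N] by (rule sets_eq_imp_space_eq)
  then show ?thesis unfolding True scal_def
    by (intro nn_integral_cong) (simp add: space_PiM PiE_iff extensional_restrict)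
next
  case False
  then show ?thesis using noise_flip[OF N F] \<sigma> by (simp add: scal_def)
qed

lemma nn_integral_triple:
  assumes s: "sigma_finite_measure \<mu>2" "sigma_finite_measure \<mu>3" and G: "G \<in> borel_measurable (\<mu>1 \<Otimes>\<^sub>M (\<mu>2 \<Otimes>\<^sub>M \<mu>3))"
  shows "(\<integral>\<^sup>+g. G g \<partial>(\<mu>1 \<Otimes>\<^sub>M (\<mu>2 \<Otimes>\<^sub>M \<mu>3))) = (\<integral>\<^sup>+g1. \<integral>\<^sup>+g2. \<integral>\<^sup>+g3. G (g1, g2, g3) \<partial>\<mu>3 \<partial>\<mu>2 \<partial>\<mu>1)"
proof -
  interpret s2: sigma_finite_measure \<mu>2 by fact
  interpret s3: sigma_finite_measure \<mu>3 by fact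
  interpret s23: pair_sigma_finite \<mu>2 \<mu>3 ..
  have "(\<integral>\<^sup>+g. G g \<partial>(\<mu>1 \<Otimes>\<^sub>M (\<mu>2 \<Otimes>\<^sub>M \<mu>3))) = (\<integral>\<^sup>+g1. \<integral>\<^sup>+g23. G (g1, g23) \<partial>(\<mu>2 \<Otimes>\<^sub>M \<mu>3) \<partial>\<mu>1)"
    by (rule s23.nn_integral_fst[symmetric]) (rule G)
  also have "\<dots> = (\<integral>\<^sup>+g1. \<integral>\<^sup>+g2. \<integral>\<^sup>+g3. G (g1, g2, g3) \<partial>\<mu>3 \<partial>\<mu>2 \<partial>\<mu>1)"
  proof (rule nn_integral_cong)
    fix g1 assume "g1 \<in> space \<mu>1"
    then have "(\<lambda>g23. G (g1, g23)) \<in> borel_measurable (\<mu>2 \<Otimes>\<^sub>M \<mu>3)" by (rule measurable_Pair2[OF G])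
    then show "(\<integral>\<^sup>+g23. G (g1, g23) \<partial>(\<mu>2 \<Otimes>\<^sub>M \<mu>3)) = (\<integral>\<^sup>+g2. \<integral>\<^sup>+g3. G (g1, g2, g3) \<partial>\<mu>3 \<partial>\<mu>2)"
      by (rule s3.nn_integral_fst[symmetric])
  qed
  finally show ?thesis .
qed

lemma measurable_triple_map:
  assumes "f1 \<in> M1 \<rightarrow>\<^sub>M N1" "f2 \<in> M2 \<rightarrow>\<^sub>M N2" "f3 \<in> M3 \<rightarrow>\<^sub>M N3"
  shows "(\<lambda>g. (f1 (fst g), f2 (fst (snd g)), f3 (snd (snd g)))) \<in> M1 \<Otimes>\<^sub>M (M2 \<Otimes>\<^sub>M M3) \<rightarrow>\<^sub>M N1 \<Otimes>\<^sub>M (N2 \<Otimes>\<^sub>M N3)"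
  using assms by measurable

lemma pair_noise_scal:
  assumes N1: "noise I1 s1 \<gamma>1" and N2: "noise I2 s2 \<gamma>2" and N3: "noise I3 s3 \<gamma>3"
    and \<sigma>: "\<sigma>1 \<in> {1, -1}" "\<sigma>2 \<in> {1, -1}" "\<sigma>3 \<in> {1, -1}"
    and F [measurable]: "F \<in> borel_measurable (RPi I1 \<Otimes>\<^sub>M (RPi I2 \<Otimes>\<^sub>M RPi I3))"
  shows "(\<integral>\<^sup>+g. F (scal I1 \<sigma>1 (fst g), scal I2 \<sigma>2 (fst (snd g)), scal I3 \<sigma>3 (snd (snd g))) \<partial>(\<gamma>1 \<Otimes>\<^sub>M (\<gamma>2 \<Otimes>\<^sub>M \<gamma>3)))
    = (\<integral>\<^sup>+g. F g \<partial>(\<gamma>1 \<Otimes>\<^sub>M (\<gamma>2 \<Otimes>\<^sub>M \<gamma>3)))"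
proof -
  interpret p1: prob_space \<gamma>1 by (rule noise_prob[OF N1])
  interpret p2: prob_space \<gamma>2 by (rule noise_prob[OF N2])
  interpret p3: prob_space \<gamma>3 by (rule noise_prob[OF N3])
  note [measurable_cong] = noise_sets[OF N1] noise_sets[OF N2] noise_sets[OF N3]
  note [measurable] = scal_measurable
  have split: "(\<integral>\<^sup>+g. G g \<partial>(\<gamma>1 \<Otimes>\<^sub>M (\<gamma>2 \<Otimes>\<^sub>M \<gamma>3))) = (\<integral>\<^sup>+g1. \<integral>\<^sup>+g2. \<integral>\<^sup>+g3. G (g1, g2, g3) \<partial>\<gamma>3 \<partial>\<gamma>2 \<partial>\<gamma>1)"
    if [measurable]: "G \<in> borel_measurable (RPi I1 \<Otimes>\<^sub>M (RPi I2 \<Otimes>\<^sub>M RPi I3))" for G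
    by (rule nn_integral_triple[OF p2.sigma_finite_measure p3.sigma_finite_measure]) measurable
  have s1: "space \<gamma>1 = space (RPi I1)" and s2: "space \<gamma>2 = space (RPi I2)"
    using noise_sets[OF N1, THEN sets_eq_imp_space_eq] noise_sets[OF N2, THEN sets_eq_imp_space_eq] by simp_all
  have "(\<integral>\<^sup>+g. F (scal I1 \<sigma>1 (fst g), scal I2 \<sigma>2 (fst (snd g)), scal I3 \<sigma>3 (snd (snd g))) \<partial>(\<gamma>1 \<Otimes>\<^sub>M (\<gamma>2 \<Otimes>\<^sub>M \<gamma>3)))
    = (\<integral>\<^sup>+g1. \<integral>\<^sup>+g2. \<integral>\<^sup>+g3. F (scal I1 \<sigma>1 g1, scal I2 \<sigma>2 g2, scal I3 \<sigma>3 g3) \<partial>\<gamma>3 \<partial>\<gamma>2 \<partial>\<gamma>1)"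
    using split[OF measurable_compose[OF measurable_triple_map[OF scal_measurable scal_measurable scal_measurable] F]]
    by (simp only: fst_conv snd_conv)
  also have "\<dots> = (\<integral>\<^sup>+g1. \<integral>\<^sup>+g2. \<integral>\<^sup>+g3. F (scal I1 \<sigma>1 g1, scal I2 \<sigma>2 g2, g3) \<partial>\<gamma>3 \<partial>\<gamma>2 \<partial>\<gamma>1)"
  proof (rule nn_integral_cong, rule nn_integral_cong)
    fix g1 g2 assume "g1 \<in> space \<gamma>1" "g2 \<in> space \<gamma>2"
    then have [measurable]: "scal I1 \<sigma>1 g1 \<in> space (RPi I1)" "scal I2 \<sigma>2 g2 \<in> space (RPi I2)"
      unfolding s1 s2 by (auto intro: measurable_space[OF scal_measurable])
    show "(\<integral>\<^sup>+g3. F (scal I1 \<sigma>1 g1, scal I2 \<sigma>2 g2, scal I3 \<sigma>3 g3) \<partial>\<gamma>3) = (\<integral>\<^sup>+g3. F (scal I1 \<sigma>1 g1, scal I2 \<sigma>2 g2, g3) \<partial>\<gamma>3)"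
      by (rule noise_scal[OF N3 \<sigma>(3), of "\<lambda>g3. F (scal I1 \<sigma>1 g1, scal I2 \<sigma>2 g2, g3)"]) measurable
  qed
  also have "\<dots> = (\<integral>\<^sup>+g1. \<integral>\<^sup>+g2. \<integral>\<^sup>+g3. F (scal I1 \<sigma>1 g1, g2, g3) \<partial>\<gamma>3 \<partial>\<gamma>2 \<partial>\<gamma>1)"
  proof (rule nn_integral_cong)
    fix g1 assume "g1 \<in> space \<gamma>1"
    then have [measurable]: "scal I1 \<sigma>1 g1 \<in> space (RPi I1)"
      unfolding s1 by (auto intro: measurable_space[OF scal_measurable])
    show "(\<integral>\<^sup>+g2. \<integral>\<^sup>+g3. F (scal I1 \<sigma>1 g1, scal I2 \<sigma>2 g2, g3) \<partial>\<gamma>3 \<partial>\<gamma>2) = (\<integral>\<^sup>+g2. \<integral>\<^sup>+g3. F (scal I1 \<sigma>1 g1, g2, g3) \<partial>\<gamma>3 \<partial>\<gamma>2)"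
      by (rule noise_scal[OF N2 \<sigma>(2), of "\<lambda>g2. \<integral>\<^sup>+g3. F (scal I1 \<sigma>1 g1, g2, g3) \<partial>\<gamma>3"]) measurable
  qed
  also have "\<dots> = (\<integral>\<^sup>+g1. \<integral>\<^sup>+g2. \<integral>\<^sup>+g3. F (g1, g2, g3) \<partial>\<gamma>3 \<partial>\<gamma>2 \<partial>\<gamma>1)"
    by (rule noise_scal[OF N1 \<sigma>(1), of "\<lambda>g1. \<integral>\<^sup>+g2. \<integral>\<^sup>+g3. F (g1, g2, g3) \<partial>\<gamma>3 \<partial>\<gamma>2"]) measurable
  also have "\<dots> = (\<integral>\<^sup>+g. F g \<partial>(\<gamma>1 \<Otimes>\<^sub>M (\<gamma>2 \<Otimes>\<^sub>M \<gamma>3)))" by (subst split) measurable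
  finally show ?thesis .
qed

lemma sum_signs: "(\<Sum>\<sigma>\<in>{1, -1}. f (\<sigma> :: real)) = f 1 + f (-1)"
  by simp

lemma pert_scal_average:
  "(\<Sum>j\<in>I. pert I A (scal I 1 g) j * v j) + (\<Sum>j\<in>I. pert I A (scal I (-1) g) j * v j) = 2 * (\<Sum>j\<in>I. A j * v j)"
proof -
  have "(\<Sum>j\<in>I. pert I A (scal I 1 g) j * v j) + (\<Sum>j\<in>I. pert I A (scal I (-1) g) j * v j) =
    (\<Sum>j\<in>I. 2 * (A j * v j))"
    unfolding sum.distrib[symmetric] by (intro sum.cong refl) (simp add: scal_def algebra_simps)
  then show ?thesis by (simp add: sum_distrib_left)
qed

text \<open>The form is affine in each sign separately: adding the two values of a sign doubles the
  form with that argument unperturbed, and the three arguments are treated in turn.\<close>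

lemma tform_sign_average:
  "(\<Sum>\<sigma>\<in>{1, -1} \<times> {1, -1} \<times> {1, -1}. tform I J K l1 l3 E
      (pert (I \<times> {..<l1}) A1 (scal (I \<times> {..<l1}) (fst \<sigma>) g1))
      (pert ({..<l1} \<times> J \<times> {..<l3}) A2 (scal ({..<l1} \<times> J \<times> {..<l3}) (fst (snd \<sigma>)) g2))
      (pert (K \<times> {..<l3}) A3 (scal (K \<times> {..<l3}) (snd (snd \<sigma>)) g3))) = 8 * tform I J K l1 l3 E A1 A2 A3"
proof -
  let ?I1 = "I \<times> {..<l1}" let ?I2 = "{..<l1} \<times> J \<times> {..<l3}" let ?I3 = "K \<times> {..<l3}"
  have t3: "tform I J K l1 l3 E y1 y2 (pert ?I3 A3 (scal ?I3 1 g3)) + tform I J K l1 l3 E y1 y2 (pert ?I3 A3 (scal ?I3 (-1) g3))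
    = 2 * tform I J K l1 l3 E y1 y2 A3" for y1 y2
    unfolding tform_lin3 by (rule pert_scal_average)
  have t2: "tform I J K l1 l3 E y1 (pert ?I2 A2 (scal ?I2 1 g2)) y3 + tform I J K l1 l3 E y1 (pert ?I2 A2 (scal ?I2 (-1) g2)) y3
    = 2 * tform I J K l1 l3 E y1 A2 y3" for y1 y3
    unfolding tform_lin2 by (rule pert_scal_average)
  have t1: "tform I J K l1 l3 E (pert ?I1 A1 (scal ?I1 1 g1)) y2 y3 + tform I J K l1 l3 E (pert ?I1 A1 (scal ?I1 (-1) g1)) y2 y3
    = 2 * tform I J K l1 l3 E A1 y2 y3" for y2 y3
    unfolding tform_lin1 by (rule pert_scal_average)
  show ?thesis
    unfolding sum.cartesian_product' fst_conv snd_conv sum_signs t3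
    unfolding distrib_left[symmetric] t2
    unfolding distrib_left[symmetric] t1 by simp
qed

lemma scal_linear_average:
  "(\<Sum>\<sigma>\<in>{1, -1} \<times> {1, -1} \<times> {1, -1}. (\<Sum>k\<in>I1. L1 k * scal I1 (fst \<sigma>) g1 k) +
      (\<Sum>k\<in>I2. L2 k * scal I2 (fst (snd \<sigma>)) g2 k) + (\<Sum>k\<in>I3. L3 k * scal I3 (snd (snd \<sigma>)) g3 k)) = (0 :: real)"
  unfolding sum.cartesian_product' fst_conv snd_conv sum_signs by (simp add: scal_def sum_negf)

text \<open>Jensen's inequality for the exponential, from its tangent line at the mean
  \<open>m\<close>.\<close>

lemma sum_exp_ge:
  fixes y :: "'i \<Rightarrow> real"
  assumes "(\<Sum>i\<in>I. y i) = real (card I) * m"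
  shows "real (card I) * exp m \<le> (\<Sum>i\<in>I. exp (y i))"
proof -
  have "(\<Sum>i\<in>I. exp m * (1 + (y i - m))) = exp m * (real (card I) + ((\<Sum>i\<in>I. y i) - real (card I) * m))"
    by (simp add: sum_distrib_left[symmetric] sum.distrib sum_subtractf)
  then have "real (card I) * exp m = (\<Sum>i\<in>I. exp m * (1 + (y i - m)))" using assms by simp
  also have "\<dots> \<le> (\<Sum>i\<in>I. exp (y i))"
  proof (intro sum_mono)
    fix i
    have "exp m * (1 + (y i - m)) \<le> exp m * exp (y i - m)" by (intro mult_left_mono) auto
    then show "exp m * (1 + (y i - m)) \<le> exp (y i)" by (simp add: exp_add[symmetric])
  qed
  finally show ?thesis .
qed

text \<open>The priors are independent, so the arguments are recentred one at a time, from the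
  innermost integral outwards, with the others held fixed. Linear terms and costs add in the
  exponent.\<close>

lemma prior_product_ge:
  assumes N1: "noise I1 s1 \<gamma>1" and N2: "noise I2 s2 \<gamma>2" and N3: "noise I3 s3 \<gamma>3"
    and \<mu>: "prob_space \<mu>1" "prob_space \<mu>2" "prob_space \<mu>3" "sets \<mu>1 = sets (RPi I1)"
      "sets \<mu>2 = sets (RPi I2)" "sets \<mu>3 = sets (RPi I3)"
    and p1: "recentres I1 \<gamma>1 m1 A1 L1 \<mu>1"
    and p2: "recentres I2 \<gamma>2 m2 A2 L2 \<mu>2"
    and p3: "recentres I3 \<gamma>3 m3 A3 L3 \<mu>3"
    and G [measurable]: "G \<in> borel_measurable (RPi I1 \<Otimes>\<^sub>M (RPi I2 \<Otimes>\<^sub>M RPi I3))"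
  shows "(\<integral>\<^sup>+g. G (pert I1 A1 (fst g), pert I2 A2 (fst (snd g)), pert I3 A3 (snd (snd g))) *
      ennreal (exp (- ((\<Sum>k\<in>I1. L1 k * fst g k) + (\<Sum>k\<in>I2. L2 k * fst (snd g) k) + (\<Sum>k\<in>I3. L3 k * snd (snd g) k)) - (m1 + m2 + m3)))
      \<partial>(\<gamma>1 \<Otimes>\<^sub>M (\<gamma>2 \<Otimes>\<^sub>M \<gamma>3))) \<le> (\<integral>\<^sup>+x. G x \<partial>(\<mu>1 \<Otimes>\<^sub>M (\<mu>2 \<Otimes>\<^sub>M \<mu>3)))"
  (is "?l \<le> _")
proof -
  interpret g1: prob_space \<gamma>1 by (rule noise_prob[OF N1])
  interpret g2: prob_space \<gamma>2 by (rule noise_prob[OF N2])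
  interpret g3: prob_space \<gamma>3 by (rule noise_prob[OF N3])
  interpret m1: prob_space \<mu>1 by fact
  interpret m2: prob_space \<mu>2 by fact
  interpret m3: prob_space \<mu>3 by fact
  note [measurable_cong] = noise_sets[OF N1] noise_sets[OF N2] noise_sets[OF N3] \<mu>(4-6)
  note [measurable] = measurable_coord_add
  have sp: "space \<gamma>1 = space (RPi I1)" "space \<gamma>2 = space (RPi I2)"
    using noise_sets[OF N1, THEN sets_eq_imp_space_eq] noise_sets[OF N2, THEN sets_eq_imp_space_eq] by simp_all
  let ?e1 = "\<lambda>g. exp (- (\<Sum>k\<in>I1. L1 k * g k) - m1)" and ?e2 = "\<lambda>g. exp (- (\<Sum>k\<in>I2. L2 k * g k) - m2)"
    and ?e3 = "\<lambda>g. exp (- (\<Sum>k\<in>I3. L3 k * g k) - m3)"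
  have em: "(\<lambda>g. ennreal (exp (- (\<Sum>k\<in>I. L k * g k) - m))) \<in> borel_measurable (RPi I)" for I :: "'z set" and L m
    by measurable
  note [measurable] = em
  have "?l =
    (\<integral>\<^sup>+g. G (pert I1 A1 (fst g), pert I2 A2 (fst (snd g)), pert I3 A3 (snd (snd g))) *
      (ennreal (?e3 (snd (snd g))) * (ennreal (?e2 (fst (snd g))) * ennreal (?e1 (fst g)))) \<partial>(\<gamma>1 \<Otimes>\<^sub>M (\<gamma>2 \<Otimes>\<^sub>M \<gamma>3)))"
    by (intro nn_integral_cong) (simp add: ennreal_mult[symmetric] exp_add[symmetric] algebra_simps)
  also have "\<dots> = (\<integral>\<^sup>+g1. \<integral>\<^sup>+g2. \<integral>\<^sup>+g3. G (pert I1 A1 g1, pert I2 A2 g2, pert I3 A3 g3) *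
      (ennreal (?e3 g3) * (ennreal (?e2 g2) * ennreal (?e1 g1))) \<partial>\<gamma>3 \<partial>\<gamma>2 \<partial>\<gamma>1)"
  proof (subst nn_integral_triple[OF g2.sigma_finite_measure g3.sigma_finite_measure])
    have "(\<lambda>g. G (pert I1 A1 (fst g), pert I2 A2 (fst (snd g)), pert I3 A3 (snd (snd g)))) \<in> borel_measurable
      (RPi I1 \<Otimes>\<^sub>M (RPi I2 \<Otimes>\<^sub>M RPi I3))"
      by (rule measurable_compose[OF measurable_triple_map[OF measurable_coord_add measurable_coord_add measurable_coord_add] G])
    moreover have "(\<lambda>g. ennreal (?e3 (snd (snd g))) * (ennreal (?e2 (fst (snd g))) * ennreal (?e1 (fst g)))) \<in> borel_measurable
      (RPi I1 \<Otimes>\<^sub>M (RPi I2 \<Otimes>\<^sub>M RPi I3))"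
      by (intro borel_measurable_times_ennreal measurable_compose[OF measurable_fst em]
        measurable_compose[OF measurable_compose[OF measurable_snd measurable_fst] em]
        measurable_compose[OF measurable_compose[OF measurable_snd measurable_snd] em])
    ultimately show "(\<lambda>g. G (pert I1 A1 (fst g), pert I2 A2 (fst (snd g)), pert I3 A3 (snd (snd g))) *
      (ennreal (?e3 (snd (snd g))) * (ennreal (?e2 (fst (snd g))) * ennreal (?e1 (fst g))))) \<in> borel_measurable (\<gamma>1 \<Otimes>\<^sub>M (\<gamma>2 \<Otimes>\<^sub>M \<gamma>3))"
      by measurable
  qed simp
  also have "\<dots> \<le> (\<integral>\<^sup>+g1. \<integral>\<^sup>+g2. (\<integral>\<^sup>+x3. G (pert I1 A1 g1, pert I2 A2 g2, x3) \<partial>\<mu>3) *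
      (ennreal (?e2 g2) * ennreal (?e1 g1)) \<partial>\<gamma>2 \<partial>\<gamma>1)"
  proof (intro nn_integral_mono)
    fix g1 g2 assume "g1 \<in> space \<gamma>1" "g2 \<in> space \<gamma>2"
    then have [measurable]: "pert I1 A1 g1 \<in> space (RPi I1)" "pert I2 A2 g2 \<in> space (RPi I2)"
      by (auto simp: space_PiM)
    have "(\<integral>\<^sup>+g3. G (pert I1 A1 g1, pert I2 A2 g2, pert I3 A3 g3) * (ennreal (?e3 g3) * (ennreal (?e2 g2) * ennreal (?e1 g1))) \<partial>\<gamma>3)
      = (\<integral>\<^sup>+g3. G (pert I1 A1 g1, pert I2 A2 g2, pert I3 A3 g3) * ennreal (?e3 g3) \<partial>\<gamma>3) * (ennreal (?e2 g2) * ennreal (?e1 g1))" (is "?L = _")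
      unfolding mult.assoc[symmetric, of "G _"] by (rule nn_integral_multc) measurable
    also have "\<dots> \<le> (\<integral>\<^sup>+x3. G (pert I1 A1 g1, pert I2 A2 g2, x3) \<partial>\<mu>3) * (ennreal (?e2 g2) * ennreal (?e1 g1))"
      by (intro mult_right_mono recentresD[OF p3]) auto
    finally show "?L
      \<le> (\<integral>\<^sup>+x3. G (pert I1 A1 g1, pert I2 A2 g2, x3) \<partial>\<mu>3) * (ennreal (?e2 g2) * ennreal (?e1 g1))" .
  qed
  also have "\<dots> \<le> (\<integral>\<^sup>+g1. (\<integral>\<^sup>+x2. \<integral>\<^sup>+x3. G (pert I1 A1 g1, x2, x3) \<partial>\<mu>3 \<partial>\<mu>2) * ennreal (?e1 g1) \<partial>\<gamma>1)"
  proof (intro nn_integral_mono)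
    fix g1 assume "g1 \<in> space \<gamma>1"
    then have [measurable]: "pert I1 A1 g1 \<in> space (RPi I1)" by (auto simp: space_PiM)
    have "(\<integral>\<^sup>+g2. (\<integral>\<^sup>+x3. G (pert I1 A1 g1, pert I2 A2 g2, x3) \<partial>\<mu>3) * (ennreal (?e2 g2) * ennreal (?e1 g1)) \<partial>\<gamma>2)
      = (\<integral>\<^sup>+g2. (\<integral>\<^sup>+x3. G (pert I1 A1 g1, pert I2 A2 g2, x3) \<partial>\<mu>3) * ennreal (?e2 g2) \<partial>\<gamma>2) * ennreal (?e1 g1)" (is "?L = _")
      unfolding mult.assoc[symmetric] by (rule nn_integral_multc) measurable
    also have "\<dots> \<le> (\<integral>\<^sup>+x2. \<integral>\<^sup>+x3. G (pert I1 A1 g1, x2, x3) \<partial>\<mu>3 \<partial>\<mu>2) * ennreal (?e1 g1)"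
      by (intro mult_right_mono recentresD[OF p2, of "\<lambda>x2. \<integral>\<^sup>+x3. G (pert I1 A1 g1, x2, x3) \<partial>\<mu>3"]) auto
    finally show "?L
      \<le> (\<integral>\<^sup>+x2. \<integral>\<^sup>+x3. G (pert I1 A1 g1, x2, x3) \<partial>\<mu>3 \<partial>\<mu>2) * ennreal (?e1 g1)" .
  qed
  also have "\<dots> \<le> (\<integral>\<^sup>+x1. \<integral>\<^sup>+x2. \<integral>\<^sup>+x3. G (x1, x2, x3) \<partial>\<mu>3 \<partial>\<mu>2 \<partial>\<mu>1)"
    by (intro recentresD[OF p1, of "\<lambda>x1. \<integral>\<^sup>+x2. \<integral>\<^sup>+x3. G (x1, x2, x3) \<partial>\<mu>3 \<partial>\<mu>2"]) measurable
  also have "\<dots> = (\<integral>\<^sup>+x. G x \<partial>(\<mu>1 \<Otimes>\<^sub>M (\<mu>2 \<Otimes>\<^sub>M \<mu>3)))"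
    by (rule nn_integral_triple[OF m2.sigma_finite_measure m3.sigma_finite_measure, symmetric]) measurable
  finally show ?thesis .
qed

text \<open>The linear terms left by the recentring are odd in the noise, so they cancel over the
  sign patterns together with the perturbations. As the noise is symmetric, all patterns have the
  same law, and the sum over them integrates to eight copies of one integral.\<close>

lemma prior_lower_bound:
  fixes Q :: "'e \<Rightarrow> 'a \<Rightarrow> 'b \<Rightarrow> 'c \<Rightarrow> real" and I :: "'a set" and J :: "'b set" and K :: "'c set" and l1 l3 :: nat
  defines "I1 \<equiv> I \<times> {..<l1}" and "I2 \<equiv> {..<l1} \<times> J \<times> {..<l3}" and "I3 \<equiv> K \<times> {..<l3}"
  assumes N1: "noise I1 s1 \<gamma>1" and N2: "noise I2 s2 \<gamma>2" and N3: "noise I3 s3 \<gamma>3"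
    and \<mu>: "prob_space \<mu>1" "prob_space \<mu>2" "prob_space \<mu>3" "sets \<mu>1 = sets (RPi I1)"
      "sets \<mu>2 = sets (RPi I2)" "sets \<mu>3 = sets (RPi I3)"
    and p1: "recentres I1 \<gamma>1 m1 A1 L1 \<mu>1"
    and p2: "recentres I2 \<gamma>2 m2 A2 L2 \<mu>2"
    and p3: "recentres I3 \<gamma>3 m3 A3 L3 \<mu>3"
    and B: "0 < B"
    and second: "(\<integral>\<^sup>+g1. \<integral>\<^sup>+g2. \<integral>\<^sup>+g3. ennreal (\<Sum>e\<in>Es. (tform I J K l1 l3 (Q e)
      (pert I1 A1 g1) (pert I2 A2 g2) (pert I3 A3 g3))\<^sup>2) \<partial>\<gamma>3 \<partial>\<gamma>2 \<partial>\<gamma>1) \<le> ennreal (B / 16)"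
  shows "ennreal (exp (tform I J K l1 l3 E A1 A2 A3 - c - (m1 + m2 + m3)) / 8) \<le>
    (\<integral>\<^sup>+x. (if (\<Sum>e\<in>Es. (tform I J K l1 l3 (Q e) (fst x) (fst (snd x)) (snd (snd x)))\<^sup>2) \<le> B
      then ennreal (exp (tform I J K l1 l3 E (fst x) (fst (snd x)) (snd (snd x)) - c)) else 0) \<partial>(\<mu>1 \<Otimes>\<^sub>M (\<mu>2 \<Otimes>\<^sub>M \<mu>3)))"
proof -
  note I = I1_def I2_def I3_def
  let ?PM = "RPi I1 \<Otimes>\<^sub>M (RPi I2 \<Otimes>\<^sub>M RPi I3)"
  interpret g1: prob_space \<gamma>1 by (rule noise_prob[OF N1])
  interpret g2: prob_space \<gamma>2 by (rule noise_prob[OF N2])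
  interpret g3: prob_space \<gamma>3 by (rule noise_prob[OF N3])
  interpret g23: pair_prob_space \<gamma>2 \<gamma>3 ..
  interpret g: pair_prob_space \<gamma>1 "\<gamma>2 \<Otimes>\<^sub>M \<gamma>3" ..
  note [measurable_cong] = noise_sets[OF N1] noise_sets[OF N2] noise_sets[OF N3]
  define \<gamma> where "\<gamma> = \<gamma>1 \<Otimes>\<^sub>M (\<gamma>2 \<Otimes>\<^sub>M \<gamma>3)"
  have sets_\<gamma> [measurable_cong]: "sets \<gamma> = sets ?PM" unfolding \<gamma>_def
    by (intro sets_pair_measure_cong noise_sets[OF N1] noise_sets[OF N2] noise_sets[OF N3])
  define tf where "tf = (\<lambda>E x. tform I J K l1 l3 E (fst x) (fst (snd x)) (snd (snd x)))"
  have tf_m [measurable]: "tf E \<in> borel_measurable ?PM" for E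
    unfolding tf_def I by (rule tform_measurable)
  define q where "q = (\<lambda>x. \<Sum>e\<in>Es. (tf (Q e) x)\<^sup>2)"
  have q_m [measurable]: "q \<in> borel_measurable ?PM" unfolding q_def by measurable
  have q0: "0 \<le> q x" for x unfolding q_def by (intro sum_nonneg) auto
  define G where "G = (\<lambda>x. if q x \<le> B then ennreal (exp (tf E x - c)) else 0)"
  have G_m [measurable]: "G \<in> borel_measurable ?PM" unfolding G_def by measurable
  define Pt where "Pt = (\<lambda>g. (pert I1 A1 (fst g), pert I2 A2 (fst (snd g)), pert I3 A3 (snd (snd g))))"
  have Pt_m [measurable]: "Pt \<in> ?PM \<rightarrow>\<^sub>M ?PM"
    unfolding Pt_def by (intro measurable_triple_map measurable_coord_add)
  define \<Lambda> where "\<Lambda> = (\<lambda>g. (\<Sum>k\<in>I1. L1 k * fst g k) + (\<Sum>k\<in>I2. L2 k * fst (snd g) k) + (\<Sum>k\<in>I3. L3 k * snd (snd g) k))"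
  have lin_m: "(\<lambda>g. \<Sum>k\<in>I. L k * g k) \<in> borel_measurable (RPi I)" for I :: "'z set" and L :: "'z \<Rightarrow> real"
    by measurable
  have \<Lambda>_m [measurable]: "\<Lambda> \<in> borel_measurable ?PM"
    unfolding \<Lambda>_def
    by (intro borel_measurable_add measurable_compose[OF measurable_fst lin_m]
        measurable_compose[OF measurable_compose[OF measurable_snd measurable_fst] lin_m]
        measurable_compose[OF measurable_compose[OF measurable_snd measurable_snd] lin_m])
  define m where "m = m1 + m2 + m3"
  define k where "k = (\<lambda>g. G (Pt g) * ennreal (exp (- \<Lambda> g - m)))"
  have k_m [measurable]: "k \<in> borel_measurable ?PM" unfolding k_def by measurable
  have stepA: "(\<integral>\<^sup>+g. k g \<partial>\<gamma>) \<le> (\<integral>\<^sup>+x. G x \<partial>(\<mu>1 \<Otimes>\<^sub>M (\<mu>2 \<Otimes>\<^sub>M \<mu>3)))"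
    unfolding k_def Pt_def \<Lambda>_def \<gamma>_def m_def
    by (rule prior_product_ge[OF N1 N2 N3 \<mu> p1 p2 p3 G_m])
  define SG where "SG = {1, -1 :: real} \<times> {1, -1 :: real} \<times> {1, -1 :: real}"
  have SG: "finite SG" "card SG = 8" by (simp_all add: SG_def card_cartesian_product)
  define sg where "sg = (\<lambda>\<sigma> g. (scal I1 (fst \<sigma>) (fst g), scal I2 (fst (snd \<sigma>)) (fst (snd g)), scal I3 (snd (snd \<sigma>)) (snd (snd g))))"
  have sg_m [measurable]: "sg \<sigma> \<in> ?PM \<rightarrow>\<^sub>M ?PM" for \<sigma>
    unfolding sg_def by (intro measurable_triple_map scal_measurable)
  have flip: "(\<integral>\<^sup>+g. F (sg \<sigma> g) \<partial>\<gamma>) = (\<integral>\<^sup>+g. F g \<partial>\<gamma>)" if "\<sigma> \<in> SG" "F \<in> borel_measurable ?PM" for \<sigma> F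
    unfolding \<gamma>_def sg_def using that by (intro pair_noise_scal[OF N1 N2 N3]) (auto simp: SG_def)
  define c0 where "c0 = tform I J K l1 l3 E A1 A2 A3 - c - m"
  have avg: "(\<Sum>\<sigma>\<in>SG. tf E (Pt (sg \<sigma> g)) - c + (- \<Lambda> (sg \<sigma> g) - m)) = real (card SG) * c0" for g
  proof -
    have "(\<Sum>\<sigma>\<in>SG. tf E (Pt (sg \<sigma> g))) = 8 * tform I J K l1 l3 E A1 A2 A3"
      unfolding tf_def Pt_def sg_def SG_def I fst_conv snd_conv by (rule tform_sign_average)
    moreover have "(\<Sum>\<sigma>\<in>SG. \<Lambda> (sg \<sigma> g)) = 0"
      unfolding \<Lambda>_def sg_def SG_def fst_conv snd_conv by (rule scal_linear_average)
    ultimately show ?thesis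
      by (simp add: sum.distrib sum_subtractf sum_negf SG c0_def algebra_simps)
  qed
  \<comment> \<open>The truncation is not invariant under sign changes. Either all eight patterns
    pass it and convexity applies, or some pattern has \<open>q > B\<close>, and then the second
    summand alone dominates the left side.\<close>
  have pointwise: "ennreal (8 * exp c0) \<le> (\<Sum>\<sigma>\<in>SG. k (sg \<sigma> g)) + ennreal (8 * exp c0 / B) * (\<Sum>\<sigma>\<in>SG. ennreal (q (Pt (sg \<sigma> g))))" for g
  proof (cases "\<forall>\<sigma>\<in>SG. q (Pt (sg \<sigma> g)) \<le> B")
    case True
    have "8 * exp c0 \<le> (\<Sum>\<sigma>\<in>SG. exp (tf E (Pt (sg \<sigma> g)) - c + (- \<Lambda> (sg \<sigma> g) - m)))"
      using sum_exp_ge[OF avg] SG(2) by simp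
    then have "ennreal (8 * exp c0) \<le> ennreal (\<Sum>\<sigma>\<in>SG. exp (tf E (Pt (sg \<sigma> g)) - c + (- \<Lambda> (sg \<sigma> g) - m)))"
      by (rule ennreal_leI)
    also have "\<dots> = (\<Sum>\<sigma>\<in>SG. ennreal (exp (tf E (Pt (sg \<sigma> g)) - c + (- \<Lambda> (sg \<sigma> g) - m))))"
      by (rule sum_ennreal[symmetric]) simp
    also have "\<dots> = (\<Sum>\<sigma>\<in>SG. k (sg \<sigma> g))"
      using True by (intro sum.cong refl) (simp add: k_def G_def ennreal_mult[symmetric] exp_add[symmetric])
    finally show ?thesis by (rule order_trans) simp
  next
    case False
    then obtain \<sigma> where \<sigma>: "\<sigma> \<in> SG" "B < q (Pt (sg \<sigma> g))" by force
    have "8 * exp c0 = 8 * exp c0 / B * B" using B by simp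
    also have "\<dots> \<le> 8 * exp c0 / B * q (Pt (sg \<sigma> g))" using \<sigma>(2) B by (intro mult_left_mono) auto
    finally have "ennreal (8 * exp c0) \<le> ennreal (8 * exp c0 / B) * ennreal (q (Pt (sg \<sigma> g)))"
      using B q0 by (simp add: ennreal_mult[symmetric])
    also have "\<dots> \<le> ennreal (8 * exp c0 / B) * (\<Sum>\<sigma>\<in>SG. ennreal (q (Pt (sg \<sigma> g))))"
      using \<sigma>(1) SG(1) by (intro mult_left_mono member_le_sum[of \<sigma> SG "\<lambda>\<sigma>. ennreal (q (Pt (sg \<sigma> g)))"]) auto
    finally show ?thesis by (rule order_trans) simp
  qed
  have qint: "(\<integral>\<^sup>+g. ennreal (q (Pt g)) \<partial>\<gamma>) \<le> ennreal (B / 16)"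
  proof -
    have "(\<integral>\<^sup>+g. ennreal (q (Pt g)) \<partial>\<gamma>) = (\<integral>\<^sup>+g1. \<integral>\<^sup>+g2. \<integral>\<^sup>+g3. ennreal (q (Pt (g1, g2, g3))) \<partial>\<gamma>3 \<partial>\<gamma>2 \<partial>\<gamma>1)"
      unfolding \<gamma>_def
      by (rule nn_integral_triple[OF g2.sigma_finite_measure g3.sigma_finite_measure]) measurable
    then show ?thesis using second by (simp only: q_def tf_def Pt_def fst_conv snd_conv)
  qed
  have "ennreal (8 * exp c0) = (\<integral>\<^sup>+g. ennreal (8 * exp c0) \<partial>\<gamma>)"
    unfolding \<gamma>_def by (simp add: g.P.emeasure_space_1)
  also have "\<dots> \<le> (\<integral>\<^sup>+g. (\<Sum>\<sigma>\<in>SG. k (sg \<sigma> g)) + ennreal (8 * exp c0 / B) * (\<Sum>\<sigma>\<in>SG. ennreal (q (Pt (sg \<sigma> g)))) \<partial>\<gamma>)"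
    by (intro nn_integral_mono pointwise)
  also have "\<dots> = (\<Sum>\<sigma>\<in>SG. \<integral>\<^sup>+g. k (sg \<sigma> g) \<partial>\<gamma>) + ennreal (8 * exp c0 / B) * (\<Sum>\<sigma>\<in>SG. \<integral>\<^sup>+g. ennreal (q (Pt (sg \<sigma> g))) \<partial>\<gamma>)"
    by (simp add: nn_integral_add nn_integral_sum nn_integral_cmult)
  also have "\<dots> = 8 * (\<integral>\<^sup>+g. k g \<partial>\<gamma>) + ennreal (8 * exp c0 / B) * (8 * (\<integral>\<^sup>+g. ennreal (q (Pt g)) \<partial>\<gamma>))"
    using flip[of _ "\<lambda>g. k g"] flip[of _ "\<lambda>g. ennreal (q (Pt g))"] SG(2) by simp
  also have "\<dots> \<le> 8 * (\<integral>\<^sup>+g. k g \<partial>\<gamma>) + ennreal (8 * exp c0 / B) * (8 * ennreal (B / 16))"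
    by (intro add_left_mono mult_left_mono qint) auto
  \<comment> \<open>With a second moment of at most \<open>B / 16\<close>, the possible failures at
    eight patterns consume \<open>4 * exp c0\<close>, half of what is available.\<close>
  also have "ennreal (8 * exp c0 / B) * (8 * ennreal (B / 16)) = ennreal (4 * exp c0)"
  proof -
    have "8 * ennreal (B / 16) = ennreal (8 * (B / 16))" using ennreal_mult[of 8 "B / 16"] B by simp
    moreover have "ennreal (8 * exp c0 / B) * ennreal (8 * (B / 16)) = ennreal (8 * exp c0 / B * (8 * (B / 16)))"
      using B by (intro ennreal_mult[symmetric]) auto
    moreover have "8 * exp c0 / B * (8 * (B / 16)) = 4 * exp c0" using B by simp
    ultimately show ?thesis by simp
  qed
  finally have fin: "ennreal (8 * exp c0) \<le> 8 * (\<integral>\<^sup>+g. k g \<partial>\<gamma>) + ennreal (4 * exp c0)" .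
  \<comment> \<open>The remaining half gives \<open>exp c0 / 2\<close>; the weaker
    \<open>exp c0 / 8\<close> is the form that matches \<open>ln (8 / \<delta>)\<close>.\<close>
  have "ennreal (exp c0 / 8) \<le> (\<integral>\<^sup>+g. k g \<partial>\<gamma>)"
  proof (cases "\<integral>\<^sup>+g. k g \<partial>\<gamma>")
    case (real x)
    have "ennreal (8 * exp c0) \<le> ennreal (8 * x + 4 * exp c0)"
      using fin real by (simp add: ennreal_mult ennreal_plus)
    then have "8 * exp c0 \<le> 8 * x + 4 * exp c0" using real by (subst (asm) ennreal_le_iff) auto
    then have "exp c0 / 8 \<le> x" using exp_gt_zero[of c0] by linarith
    then show ?thesis using real by (simp add: ennreal_leI)
  qed simp
  with stepA have "ennreal (exp c0 / 8) \<le> (\<integral>\<^sup>+x. G x \<partial>(\<mu>1 \<Otimes>\<^sub>M (\<mu>2 \<Otimes>\<^sub>M \<mu>3)))" by (rule order_trans[rotated])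
  then show ?thesis by (simp only: G_def q_def tf_def c0_def m_def)
qed

text \<open>Tonelli transfers the moment bound at each parameter to the prior average. The event is
  the complement of a superlevel set, so the strict inequality holds everywhere on it.\<close>

lemma markov_fubini:
  fixes G :: "'w \<Rightarrow> 'x \<Rightarrow> ennreal"
  assumes M: "prob_space M" and \<mu>: "prob_space \<mu>"
    and G [measurable]: "(\<lambda>(w, x). G w x) \<in> borel_measurable (M \<Otimes>\<^sub>M \<mu>)"
    and le: "\<And>x. x \<in> space \<mu> \<Longrightarrow> (\<integral>\<^sup>+w. G w x \<partial>M) \<le> 1" and \<delta>: "0 < \<delta>"
  shows "\<exists>E\<in>sets M. 1 - \<delta> \<le> measure M E \<and> (\<forall>w\<in>E. w \<in> space M \<and> (\<integral>\<^sup>+x. G w x \<partial>\<mu>) < ennreal (1 / \<delta>))"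
proof -
  interpret M: prob_space M by fact
  interpret \<mu>: prob_space \<mu> by fact
  interpret P: pair_prob_space M \<mu> ..
  define Z where "Z = (\<lambda>w. \<integral>\<^sup>+x. G w x \<partial>\<mu>)"
  have Zm [measurable]: "Z \<in> borel_measurable M" unfolding Z_def by measurable
  have "(\<integral>\<^sup>+w. Z w \<partial>M) = (\<integral>\<^sup>+x. \<integral>\<^sup>+w. G w x \<partial>M \<partial>\<mu>)"
    unfolding Z_def using P.Fubini'[OF G] by simp
  also have "\<dots> \<le> (\<integral>\<^sup>+x. 1 \<partial>\<mu>)" by (intro nn_integral_mono le)
  finally have Z1: "(\<integral>\<^sup>+w. Z w \<partial>M) \<le> 1" by (simp add: \<mu>.emeasure_space_1)
  define D where "D = {w \<in> space M. ennreal (1 / \<delta>) \<le> Z w}"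
  have Dm [measurable]: "D \<in> sets M" unfolding D_def by measurable
  have "emeasure M D \<le> ennreal \<delta>"
  proof -
    have "emeasure M D = (\<integral>\<^sup>+w. indicator D w \<partial>M)" by simp
    also have "\<dots> \<le> (\<integral>\<^sup>+w. ennreal \<delta> * Z w \<partial>M)"
    proof (intro nn_integral_mono)
      fix w assume "w \<in> space M"
      show "indicator D w \<le> ennreal \<delta> * Z w"
      proof (cases "w \<in> D")
        case True
        then have "ennreal \<delta> * ennreal (1 / \<delta>) \<le> ennreal \<delta> * Z w" by (intro mult_left_mono) (auto simp: D_def)
        moreover have "ennreal \<delta> * ennreal (1 / \<delta>) = 1" using \<delta> by (simp add: ennreal_mult[symmetric])
        ultimately show ?thesis using True by simp
      qed simp
    qed
    also have "\<dots> = ennreal \<delta> * (\<integral>\<^sup>+w. Z w \<partial>M)" by (rule nn_integral_cmult) measurable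
    also have "\<dots> \<le> ennreal \<delta> * 1" by (intro mult_left_mono Z1) simp
    finally show ?thesis by simp
  qed
  then have "measure M D \<le> \<delta>" using \<delta> by (simp add: M.emeasure_eq_measure)
  then have "1 - \<delta> \<le> measure M (space M - D)" by (simp add: M.prob_compl)
  then show ?thesis
    by (intro bexI[of _ "space M - D"]) (auto simp: D_def Z_def not_le)
qed

section \<open>The contraction as a matrix pairing, positivity behind the effective ranks,
  exponential moments\<close>

section \<open>The quadratic forms of the covariance error\<close>

text \<open>Serves both the first and the third factor; the row index is split into the pair that
  \<open>krear\<close> expects.\<close>

definition vec1 :: "nat \<Rightarrow> (nat \<Rightarrow> nat \<Rightarrow> real) \<Rightarrow> (nat \<times> nat) \<times> nat \<Rightarrow> real" where
  "vec1 p A = (\<lambda>(x, s). A (fst x * p + snd x) s)"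

definition vec2 :: "nat \<Rightarrow> (nat \<Rightarrow> nat \<Rightarrow> nat \<Rightarrow> real) \<Rightarrow> nat \<times> (nat \<times> nat) \<times> nat \<Rightarrow> real" where
  "vec2 q A = (\<lambda>(s, y, t). A s (fst y * q + snd y) t)"

lemma contract_eq_tform:
  "contract (p\<^sup>2) (q\<^sup>2) (r\<^sup>2) l1 l3 A1 A3 (\<lambda>a b c. rearr p q r D1 a b c - rearr p q r D2 a b c) A2 =
    tform ({..<p} \<times> {..<p}) ({..<q} \<times> {..<q}) ({..<r} \<times> {..<r}) l1 l3
      (krear q r (\<lambda>i j. D1 i j - D2 i j)) (vec1 p A1) (vec2 q A2) (vec1 r A3)"
  (is "?l = _")
proof -
  have E: "rearr p q r D (fst a * p + snd a) (fst b * q + snd b) (fst c * r + snd c) = krear q r D a b c"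
    if "a \<in> {..<p} \<times> {..<p}" "b \<in> {..<q} \<times> {..<q}" "c \<in> {..<r} \<times> {..<r}" for D a b c
    using that by (auto simp: rearr_def krear_def)
  have K: "krear q r D1 a b c - krear q r D2 a b c = krear q r (\<lambda>i j. D1 i j - D2 i j) a b c" for a b c
    by (simp add: krear_def)
  have "?l =
    (\<Sum>s<l1. \<Sum>b\<in>{..<q} \<times> {..<q}. \<Sum>t<l3. tcoef2 ({..<p} \<times> {..<p}) ({..<r} \<times> {..<r})
      (krear q r (\<lambda>i j. D1 i j - D2 i j)) (vec1 p A1) (vec1 r A3) s b t * vec2 q A2 (s, b, t))"
    unfolding contract_def power2_eq_square sum_pair_index tcoef2_def
    by (simp add: E K vec1_def vec2_def cong: sum.cong del: mem_Sigma_iff)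
  also have "\<dots> = (\<Sum>s<l1. \<Sum>b\<in>{..<q} \<times> {..<q}. \<Sum>t<l3. vec2 q A2 (s, b, t) * tcoef2 ({..<p} \<times> {..<p}) ({..<r} \<times> {..<r})
      (krear q r (\<lambda>i j. D1 i j - D2 i j)) (vec1 p A1) (vec1 r A3) s b t)"
    by (simp only: mult.commute)
  finally show ?thesis unfolding tform_lin2 sum.cartesian_product'[of _ "{..<l1}"] sum.cartesian_product'[of _ _ "{..<l3}"] fst_conv snd_conv .
qed

text \<open>\<open>V\<close> is the inverse rearrangement of the coefficient tensor. It is chosen
  before \<open>D\<close>, so that one and the same matrix is tested against the covariance error
  and against the rank-one matrices of \<open>kfac\<close>.\<close>

lemma tform_as_matrix_form:
  "\<exists>V. \<forall>D. tform ({..<p} \<times> {..<p}) ({..<q} \<times> {..<q}) ({..<r} \<times> {..<r}) l1 l3 (krear q r D) x1 x2 x3 =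
    (\<Sum>i<p * q * r. \<Sum>j<p * q * r. V i j * D i j)"
  (is "\<exists>V. \<forall>D. ?t D = _")
proof -
  define T where "T = (\<lambda>a b c. \<Sum>s<l1. x1 (a, s) * (\<Sum>t<l3. x2 (s, b, t) * x3 (c :: nat \<times> nat, t)))"
  let ?J = "{..<p} \<times> {..<q} \<times> {..<r}" and ?\<phi> = "\<lambda>(a, b, c). a * q * r + b * r + c"
  define \<psi> where "\<psi> = the_inv_into ?J ?\<phi>"
  have T: "(\<Sum>s<l1. x1 (a, s) * (\<Sum>t<l3. x2 (s, b, t) * x3 (c, t))) = T a b c" for a b c
    by (simp add: T_def)
  define V where "V = (\<lambda>i j. T (fst (\<psi> i), fst (\<psi> j)) (fst (snd (\<psi> i)), fst (snd (\<psi> j))) (snd (snd (\<psi> i)), snd (snd (\<psi> j))))"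
  have \<psi>: "\<psi> (fst u * q * r + fst (snd u) * r + snd (snd u)) = u" if "u \<in> ?J" for u
    using the_inv_into_f_f[of ?\<phi> ?J u] bij_betw_triple_index[of q r p] that
    by (simp add: \<psi>_def bij_betw_def split_beta)
  have "?t D =
    (\<Sum>i<p * q * r. \<Sum>j<p * q * r. V i j * D i j)" for D
  proof -
    have "?t D =
      (\<Sum>u\<in>?J. \<Sum>v\<in>?J. V (?\<phi> u) (?\<phi> v) * D (?\<phi> u) (?\<phi> v))"
      unfolding tform_tensor T sum_regroup3
      by (intro sum.cong refl) (simp add: V_def \<psi> krear_def split_beta del: mem_Sigma_iff)
    also have "\<dots> = (\<Sum>u\<in>?J. \<Sum>j<p * q * r. V (?\<phi> u) j * D (?\<phi> u) j)"
      by (intro sum.cong refl sum.reindex_bij_betw[OF bij_betw_triple_index])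
    also have "\<dots> = (\<Sum>i<p * q * r. \<Sum>j<p * q * r. V i j * D i j)"
      by (rule sum.reindex_bij_betw[OF bij_betw_triple_index])
    finally show ?thesis .
  qed
  then show ?thesis by blast
qed

lemma vec1_contraction:
  assumes "mat_opnorm (p\<^sup>2) l A \<le> 1"
  shows "(\<Sum>a\<in>{..<p} \<times> {..<p}. (\<Sum>s<l. vec1 p A (a, s) * y s)\<^sup>2) \<le> (\<Sum>s<l. (y s)\<^sup>2)" (is "?l \<le> _")
proof -
  have "?l = (\<Sum>i<p\<^sup>2. (\<Sum>s<l. A i s * y s)\<^sup>2)"
    by (simp add: vec1_def power2_eq_square[of p] sum_pair_index)
  also have "\<dots> \<le> (mat_opnorm (p\<^sup>2) l A)\<^sup>2 * (\<Sum>s<l. (y s)\<^sup>2)" by (rule mat_opnorm_bound)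
  also have "\<dots> \<le> 1 * (\<Sum>s<l. (y s)\<^sup>2)"
    using assms mat_opnorm_nonneg[of "p\<^sup>2" l A] by (intro mult_right_mono power_le_one sum_nonneg) auto
  finally show ?thesis by simp
qed

text \<open>A contraction has columns of norm at most 1; this is where \<open>l1\<close> and
  \<open>l3\<close> enter the costs of the first and third prior.\<close>

lemma vec1_sum_squares:
  assumes "mat_opnorm (p\<^sup>2) l A \<le> 1"
  shows "(\<Sum>k\<in>({..<p} \<times> {..<p}) \<times> {..<l}. (vec1 p A k)\<^sup>2) \<le> real l" (is "?l \<le> _")
proof -
  have "?l = (\<Sum>s<l. \<Sum>a\<in>{..<p} \<times> {..<p}. (vec1 p A (a, s))\<^sup>2)"
    by (rule sum_times_swap)
  also have "\<dots> \<le> (\<Sum>s<l. 1)"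
    by (intro sum_mono column_norm_le[OF vec1_contraction[OF assms]]) auto
  finally show ?thesis by simp
qed

lemma vec2_sum_squares:
  assumes "tens_frob l1 (q\<^sup>2) l3 A \<le> 1"
  shows "(\<Sum>s<l1. \<Sum>b\<in>{..<q} \<times> {..<q}. \<Sum>t<l3. (vec2 q A (s, b, t))\<^sup>2) \<le> 1" (is "?l \<le> _")
proof -
  have "?l = (\<Sum>a<l1. \<Sum>b<q\<^sup>2. \<Sum>c<l3. (A a b c)\<^sup>2)"
    by (simp add: vec2_def power2_eq_square[of q] sum_pair_index)
  then show ?thesis using assms by (simp add: tens_frob_def)
qed

lemma pos_def_diag_pos:
  assumes "pos_def d S" "i < d" shows "0 < S i i"
proof -
  have "\<forall>v. (\<exists>i<d. v i \<noteq> 0) \<longrightarrow> (\<Sum>i<d. \<Sum>j<d. v i * S i j * v j) > 0"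
    using assms by (simp add: pos_def_def)
  then have "(\<Sum>k<d. \<Sum>l<d. (if k = i then 1 else 0) * S k l * (if l = i then 1 else 0)) > 0"
    using assms(2) by (elim allE[where x = "\<lambda>k. if k = i then 1 else 0"]) auto
  also have "(\<Sum>k<d. \<Sum>l<d. (if k = i then 1 else 0) * S k l * (if l = i then 1 else 0)) = (\<Sum>k<d. if k = i then S i i else 0)"
    using assms(2) by (intro sum.cong refl) (simp add: if_distrib cong: if_cong)
  finally show ?thesis using assms(2) by simp
qed

text \<open>Effective ranks are quotients, but they chain as products. Multiplying out needs
  positive denominators, which come from the positive diagonal of a positive definite matrix,
  inherited by its partial traces.\<close>

lemma effective_rank_bounds:
  assumes pd: "pos_def (p * q * r) S" and pqr: "0 < p" "0 < q" "0 < r"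
  defines "N \<equiv> mat_opnorm (p * q * r) (p * q * r) S"
    and "c1 \<equiv> mat_opnorm (q * r) (q * r) (Tr1 p q r S)" and "c2 \<equiv> mat_opnorm (p * r) (p * r) (Tr2 p q r S)"
    and "c3 \<equiv> mat_opnorm (p * q) (p * q) (Tr3 p q r S)" and "c12 \<equiv> mat_opnorm r r (Tr12 p q r S)"
  shows "0 < N" "0 < eff_r1 p q r S" "0 < eff_r2 p q r S" "0 < eff_r3 p q r S"
    "c1 \<le> eff_r1 p q r S * N" "c2 \<le> eff_r2 p q r S * N" "c3 \<le> eff_r3 p q r S * N" "c12 \<le> eff_r1 p q r S * c2"
    "mat_opnorm p p (Tr23 p q r S) \<le> eff_r2 p q r S * c3" "mat_opnorm q q (Tr13 p q r S) \<le> eff_r3 p q r S * c1"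
    "\<bar>Tr123 p q r S\<bar> \<le> eff_r3 p q r S * c12"
proof -
  have d: "0 < S (a * q * r + b * r + c) (a * q * r + b * r + c)" if "a < p" "b < q" "c < r" for a b c
    using pos_def_diag_pos[OF pd triple_index_less[OF that]] .
  have "S 0 0 \<le> N" unfolding N_def using pqr by (intro diag_entry_le_opnorm) simp
  moreover have "0 < S 0 0" using pqr by (intro pos_def_diag_pos[OF pd]) simp
  ultimately show N: "0 < N" by simp
  have c1: "0 < c1"
  proof -
    have "0 < Tr1 p q r S (0 * r + 0) (0 * r + 0)"
      unfolding Tr1_index using pqr by (intro sum_pos d) auto
    then have "0 < Tr1 p q r S 0 0" by simp
    also have "\<dots> \<le> c1" unfolding c1_def using pqr by (intro diag_entry_le_opnorm) simp
    finally show ?thesis .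
  qed
  have c2: "0 < c2"
  proof -
    have "0 < (\<Sum>b<q. S (0 * q * r + b * r + 0) (0 * q * r + b * r + 0))"
      using pqr by (intro sum_pos d) auto
    then have "0 < Tr2 p q r S (0 * r + 0) (0 * r + 0)"
      by (simp only: Tr2_index[OF pqr(3) pqr(3)])
    then have "0 < Tr2 p q r S 0 0" by simp
    also have "\<dots> \<le> c2" unfolding c2_def using pqr by (intro diag_entry_le_opnorm) simp
    finally show ?thesis .
  qed
  have c3: "0 < c3"
  proof -
    have "0 < Tr3 p q r S (0 * q + 0) (0 * q + 0)"
      unfolding Tr3_index using pqr by (intro sum_pos d) auto
    then have "0 < Tr3 p q r S 0 0" by simp
    also have "\<dots> \<le> c3" unfolding c3_def using pqr by (intro diag_entry_le_opnorm) simp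
    finally show ?thesis .
  qed
  have c12: "0 < c12"
  proof -
    have "0 < (\<Sum>a<p. \<Sum>b<q. S (a * q * r + b * r + 0) (a * q * r + b * r + 0))"
      using pqr by (intro sum_pos d) auto
    then have "0 < Tr12 p q r S 0 0"
      by (simp only: Tr12_index[OF pqr(3) pqr(3)])
    also have "\<dots> \<le> c12" unfolding c12_def using pqr by (intro diag_entry_le_opnorm) simp
    finally show ?thesis .
  qed
  show r1: "c1 \<le> eff_r1 p q r S * N" "c12 \<le> eff_r1 p q r S * c2"
    unfolding eff_r1_def N_def[symmetric] c1_def[symmetric] c2_def[symmetric] c12_def[symmetric]
    using N c2 by (simp_all add: pos_divide_le_eq[symmetric])
  show r2: "c2 \<le> eff_r2 p q r S * N" "mat_opnorm p p (Tr23 p q r S) \<le> eff_r2 p q r S * c3"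
    unfolding eff_r2_def N_def[symmetric] c2_def[symmetric] c3_def[symmetric]
    using N c3 by (simp_all add: pos_divide_le_eq[symmetric])
  show r3: "c3 \<le> eff_r3 p q r S * N" "mat_opnorm q q (Tr13 p q r S) \<le> eff_r3 p q r S * c1" "\<bar>Tr123 p q r S\<bar> \<le> eff_r3 p q r S * c12"
    unfolding eff_r3_def N_def[symmetric] c1_def[symmetric] c3_def[symmetric] c12_def[symmetric]
    using N c1 c12 by (simp_all add: pos_divide_le_eq[symmetric])
  show "0 < eff_r1 p q r S" "0 < eff_r2 p q r S" "0 < eff_r3 p q r S"
    using r1(1) r2(1) r3(1) N c1 c2 c3 by (smt (verit) mult_nonpos_nonneg)+
qed

text \<open>With \<open>X = R Z\<close> for the whitened vector \<open>Z\<close>, the form in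
  \<open>X\<close> with matrix \<open>U\<close> becomes the form in \<open>Z\<close> with matrix
  \<open>R U R\<close>, whose squared Frobenius norm is \<open>v\<close> and whose trace is the
  pairing of \<open>U\<close> with \<open>S\<close>. Assumption (A) applies to that matrix.\<close>

lemma mgf_quadratic_form:
  fixes X :: "nat \<Rightarrow> 'w \<Rightarrow> real" and U R :: "nat \<Rightarrow> nat \<Rightarrow> real" and d :: nat
  defines "v \<equiv> \<Sum>e\<in>{..<d} \<times> {..<d}. (\<Sum>i<d. \<Sum>j<d. U i j * (R i (fst e) * R j (snd e)))\<^sup>2"
  assumes R: "\<And>i j. R i j = R j i" "\<And>i j. i < d \<Longrightarrow> j < d \<Longrightarrow> S i j = (\<Sum>m<d. R i m * R j m)"
    and B: "\<And>i j. B i j = B j i" "\<And>i j. i < d \<Longrightarrow> j < d \<Longrightarrow> (\<Sum>k<d. B i k * R k j) = (if i = j then 1 else 0)"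
    and A: "\<And>V. V \<in> mat_space d d \<Longrightarrow> mat_frob d d V \<le> 1 / \<omega> \<Longrightarrow>
        (let Z = (\<lambda>i w. \<Sum>j<d. B i j * X j w);
             F = (\<lambda>w. exp ((\<Sum>i<d. \<Sum>j<d. Z i w * V i j * Z j w) - mat_trace d V))
         in integrable M F \<and> ln (integral\<^sup>L M F) \<le> \<omega>\<^sup>2 * (mat_frob d d V)\<^sup>2)"
    and \<omega>: "0 < \<omega>" and v: "\<omega>\<^sup>2 * v \<le> 1"
  shows "(\<integral>\<^sup>+w. ennreal (exp (\<Sum>i<d. \<Sum>j<d. U i j * (X i w * X j w - S i j))) \<partial>M) \<le> ennreal (exp (\<omega>\<^sup>2 * v))"
proof -
  define V where "V = (\<lambda>k l. if k < d \<and> l < d then \<Sum>i<d. \<Sum>j<d. U i j * (R i k * R j l) else 0)"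
  have Vm: "V \<in> mat_space d d" by (auto simp: V_def mat_space_def)
  have v0: "0 \<le> v" unfolding v_def by (intro sum_nonneg) auto
  have frob: "(mat_frob d d V)\<^sup>2 = v"
  proof -
    have "v = (\<Sum>i<d. \<Sum>j<d. (V i j)\<^sup>2)" by (simp add: v_def V_def sum.cartesian_product')
    then show ?thesis using v0 by (simp add: mat_frob_def)
  qed
  have "(\<omega> * mat_frob d d V)\<^sup>2 \<le> 1" using v by (simp add: power_mult_distrib frob)
  then have "\<bar>\<omega> * mat_frob d d V\<bar> \<le> 1" by (simp add: abs_square_le_1)
  then have fle: "mat_frob d d V \<le> 1 / \<omega>" using \<omega> by (simp add: pos_le_divide_eq mult.commute)
  define Z where "Z = (\<lambda>i w. \<Sum>j<d. B i j * X j w)"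
  define F where "F = (\<lambda>w. exp ((\<Sum>i<d. \<Sum>j<d. Z i w * V i j * Z j w) - mat_trace d V))"
  from A[OF Vm fle] have int: "integrable M F" and ln: "ln (integral\<^sup>L M F) \<le> \<omega>\<^sup>2 * v"
    unfolding Let_def Z_def[symmetric] F_def[symmetric] frob by auto
  \<comment> \<open>Only \<open>B R = 1\<close> is given; transposing it, with both matrices
    symmetric, yields \<open>R B = 1\<close>.\<close>
  have RZ: "(\<Sum>k<d. R i k * Z k w) = X i w" if i: "i < d" for i w
  proof -
    have "(\<Sum>k<d. R i k * Z k w) = (\<Sum>k<d. \<Sum>j<d. R i k * B k j * X j w)"
      by (simp add: Z_def sum_distrib_left mult.assoc)
    also have "\<dots> = (\<Sum>j<d. \<Sum>k<d. R i k * B k j * X j w)" by (rule sum.swap)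
    also have "\<dots> = (\<Sum>j<d. (\<Sum>k<d. B j k * R k i) * X j w)"
      unfolding sum_distrib_right by (intro sum.cong refl) (simp add: R(1)[of i] B(1)[of j for j] mult.commute)
    also have "\<dots> = (\<Sum>j<d. if j = i then X j w else 0)" using i by (intro sum.cong refl) (simp add: B(2))
    finally show ?thesis using i by simp
  qed
  have quad: "(\<Sum>k<d. \<Sum>l<d. Z k w * V k l * Z l w) = (\<Sum>i<d. \<Sum>j<d. U i j * (X i w * X j w))" for w
  proof -
    let ?f = "\<lambda>i j k l. U i j * ((R i k * Z k w) * (R j l * Z l w))"
    have "(\<Sum>k<d. \<Sum>l<d. Z k w * V k l * Z l w) = (\<Sum>k<d. \<Sum>l<d. \<Sum>i<d. \<Sum>j<d. ?f i j k l)"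
      by (intro sum.cong refl) (simp add: V_def sum_distrib_left sum_distrib_right mult_ac)
    also have "\<dots> = (\<Sum>y\<in>{..<d}\<times>{..<d}. \<Sum>x\<in>{..<d}\<times>{..<d}. ?f (fst x) (snd x) (fst y) (snd y))"
      by (simp only: sum.cartesian_product' fst_conv snd_conv)
    also have "\<dots> = (\<Sum>x\<in>{..<d}\<times>{..<d}. \<Sum>y\<in>{..<d}\<times>{..<d}. ?f (fst x) (snd x) (fst y) (snd y))"
      by (rule sum.swap)
    also have "\<dots> = (\<Sum>i<d. \<Sum>j<d. \<Sum>k<d. \<Sum>l<d. ?f i j k l)"
      by (simp only: sum.cartesian_product' fst_conv snd_conv)
    also have "\<dots> = (\<Sum>i<d. \<Sum>j<d. U i j * ((\<Sum>k<d. R i k * Z k w) * (\<Sum>l<d. R j l * Z l w)))"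
      by (simp only: sum_product) (simp only: sum_distrib_left)
    also have "\<dots> = (\<Sum>i<d. \<Sum>j<d. U i j * (X i w * X j w))" by (intro sum.cong refl) (simp add: RZ)
    finally show ?thesis .
  qed
  have tr: "mat_trace d V = (\<Sum>i<d. \<Sum>j<d. U i j * S i j)"
  proof -
    have "mat_trace d V = (\<Sum>k<d. \<Sum>i<d. \<Sum>j<d. U i j * (R i k * R j k))" by (simp add: mat_trace_def V_def)
    also have "\<dots> = (\<Sum>i<d. \<Sum>k<d. \<Sum>j<d. U i j * (R i k * R j k))" by (rule sum.swap)
    also have "\<dots> = (\<Sum>i<d. \<Sum>j<d. \<Sum>k<d. U i j * (R i k * R j k))" by (intro sum.cong refl sum.swap)
    finally show ?thesis by (simp add: R(2) sum_distrib_left)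
  qed
  have F: "exp (\<Sum>i<d. \<Sum>j<d. U i j * (X i w * X j w - S i j)) = F w" for w
    unfolding F_def quad tr by (simp add: right_diff_distrib sum_subtractf)
  have "integral\<^sup>L M F \<le> exp (\<omega>\<^sup>2 * v)"
  \<comment> \<open>A bound on \<open>ln\<close> is informative only for a positive argument;
    otherwise the claim holds because its right side is positive.\<close>
  proof (cases "0 < integral\<^sup>L M F")
    case True
    then show ?thesis using ln by (metis exp_le_cancel_iff exp_ln)
  next
    case False
    then show ?thesis using exp_gt_zero[of "\<omega>\<^sup>2 * v"] by linarith
  qed
  then show ?thesis unfolding F
    using int by (subst nn_integral_eq_integral) (auto simp: F_def intro: ennreal_leI)
qed

section \<open>Factorisation over the sample, choice of the parameters, conclusion\<close>

section \<open>The uniform deviation bound\<close>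

text \<open>Independence factorises the exponential moment, and equality in law replaces each factor
  by that of the generic vector.\<close>

lemma (in prob_space) nn_integral_exp_iid_sum:
  assumes ind: "indep_vars (\<lambda>_. P) Y {..<n :: nat}"
    and Y0: "Y0 \<in> M \<rightarrow>\<^sub>M P" and Y: "\<And>k. k < n \<Longrightarrow> Y k \<in> M \<rightarrow>\<^sub>M P"
    and dist: "\<And>k. k < n \<Longrightarrow> distr M P (Y k) = distr M P Y0"
    and h [measurable]: "h \<in> borel_measurable P"
  shows "(\<integral>\<^sup>+w. ennreal (exp (\<Sum>k<n. h (Y k w))) \<partial>M) = (\<integral>\<^sup>+w. ennreal (exp (h (Y0 w))) \<partial>M) ^ n"
proof -
  have e: "(\<lambda>z. ennreal (exp (h z))) \<in> borel_measurable P" by measurable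
  have "(\<integral>\<^sup>+w. ennreal (exp (\<Sum>k<n. h (Y k w))) \<partial>M) = (\<integral>\<^sup>+w. (\<Prod>k<n. ennreal (exp (h (Y k w)))) \<partial>M)"
    by (simp add: exp_sum prod_ennreal)
  also have "\<dots> = (\<Prod>k<n. \<integral>\<^sup>+w. ennreal (exp (h (Y k w))) \<partial>M)"
    by (intro indep_vars_nn_integral indep_vars_compose2[OF ind] e) auto
  also have "\<dots> = (\<Prod>k<n. \<integral>\<^sup>+w. ennreal (exp (h (Y0 w))) \<partial>M)"
  proof (intro prod.cong refl)
    fix k assume "k \<in> {..<n}"
    then have k: "k < n" by simp
    have "(\<integral>\<^sup>+w. ennreal (exp (h (Y k w))) \<partial>M) = (\<integral>\<^sup>+z. ennreal (exp (h z)) \<partial>distr M P (Y k))"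
      using e by (subst nn_integral_distr[OF Y[OF k]]) simp_all
    also have "\<dots> = (\<integral>\<^sup>+w. ennreal (exp (h (Y0 w))) \<partial>M)"
      unfolding dist[OF k] using e by (subst nn_integral_distr[OF Y0]) simp_all
    finally show "(\<integral>\<^sup>+w. ennreal (exp (h (Y k w))) \<partial>M) = (\<integral>\<^sup>+w. ennreal (exp (h (Y0 w))) \<partial>M)" .
  qed
  finally show ?thesis by simp
qed

text \<open>Tonelli needs measurability jointly in the sample point and the parameters, hence a
  tensor \<open>E\<close> that depends on \<open>w\<close>.\<close>

lemma tform_measurable_joint:
  assumes E: "\<And>a b c. (\<lambda>w. E w a b c) \<in> borel_measurable M"
  shows "(\<lambda>(w, x). tform I J K l1 l3 (E w) (fst x) (fst (snd x)) (snd (snd x))) \<in> borel_measurable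
    (M \<Otimes>\<^sub>M (RPi (I \<times> {..<l1}) \<Otimes>\<^sub>M (RPi ({..<l1} \<times> J \<times> {..<l3}) \<Otimes>\<^sub>M RPi (K \<times> {..<l3}))))"
  (is "_ \<in> borel_measurable (M \<Otimes>\<^sub>M ?M)")
proof -
  have c1: "(\<lambda>z. fst (snd z) (a, s) :: real) \<in> borel_measurable (M \<Otimes>\<^sub>M ?M)" if "a \<in> I" "s < l1" for a s
    using that by (intro measurable_compose[OF measurable_compose[OF measurable_snd measurable_fst] measurable_component_singleton]) auto
  have c2: "(\<lambda>z. fst (snd (snd z)) (s, b, t) :: real) \<in> borel_measurable (M \<Otimes>\<^sub>M ?M)" if "s < l1" "b \<in> J" "t < l3" for s b t
    using that by (intro measurable_compose[OF measurable_compose[OF measurable_compose[OF measurable_snd measurable_snd] measurable_fst] measurable_component_singleton]) auto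
  have c3: "(\<lambda>z. snd (snd (snd z)) (c, t) :: real) \<in> borel_measurable (M \<Otimes>\<^sub>M ?M)" if "c \<in> K" "t < l3" for c t
    using that by (intro measurable_compose[OF measurable_compose[OF measurable_compose[OF measurable_snd measurable_snd] measurable_snd] measurable_component_singleton]) auto
  show ?thesis unfolding tform_def split_beta
    by (intro borel_measurable_sum borel_measurable_times measurable_compose[OF measurable_fst E] c1 c2 c3) auto
qed

lemma kfac_eq_krear: "kfac q r R e = krear q r (\<lambda>i j. R i (fst e) * R j (snd e))"
  by (simp add: fun_eq_iff kfac_def krear_def)

lemma m_param_nonneg: "S \<noteq> {} \<Longrightarrow> 0 \<le> m_param e l S"
  by (cases "finite S") (auto simp: m_param_def Suc_le_eq card_gt_0_iff)

theorem theorem3: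
  fixes M :: "'a measure"
    and p q r n l1 l3 :: nat
    and X :: "nat \<Rightarrow> 'a \<Rightarrow> real"            \<comment> \<open>X j \<omega> = j-th coordinate of the generic vector X\<close>
    and Xs :: "nat \<Rightarrow> nat \<Rightarrow> 'a \<Rightarrow> real"     \<comment> \<open>Xs i j \<omega> = j-th coordinate of X_{i+1}, i < n\<close>
    and \<Sigma> :: "nat \<Rightarrow> nat \<Rightarrow> real"
    and \<omega> \<delta> :: real
    and S1 S3 :: "(nat \<Rightarrow> nat \<Rightarrow> real) set"
    and S2 :: "(nat \<Rightarrow> nat \<Rightarrow> nat \<Rightarrow> real) set"
  defines "d \<equiv> p * q * r"
  assumes M: "prob_space M"
    and pqr: "0 < p" "0 < q" "0 < r"
    and X_meas: "(\<lambda>w. restrict (\<lambda>j. X j w) {..<d}) \<in> M \<rightarrow>\<^sub>M PiM {..<d} (\<lambda>_. borel)"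
    and Xs_meas: "\<And>i. i < n \<Longrightarrow> (\<lambda>w. restrict (\<lambda>j. Xs i j w) {..<d}) \<in> M \<rightarrow>\<^sub>M PiM {..<d} (\<lambda>_. borel)"
    and Xs_indep: "prob_space.indep_vars M (\<lambda>_. PiM {..<d} (\<lambda>_. borel))
                     (\<lambda>i w. restrict (\<lambda>j. Xs i j w) {..<d}) {..<n}"
    and Xs_distr: "\<And>i. i < n \<Longrightarrow>
        distr M (PiM {..<d} (\<lambda>_. borel)) (\<lambda>w. restrict (\<lambda>j. Xs i j w) {..<d})
      = distr M (PiM {..<d} (\<lambda>_. borel)) (\<lambda>w. restrict (\<lambda>j. X j w) {..<d})"
    and centered: "\<And>j. j < d \<Longrightarrow> integrable M (X j) \<and> integral\<^sup>L M (X j) = 0"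
    and second_mom: "\<And>i j. i < d \<Longrightarrow> j < d \<Longrightarrow> integrable M (\<lambda>w. X i w * X j w)"
    and Sigma_def: "\<Sigma> = (\<lambda>i j. if i < d \<and> j < d then integral\<^sup>L M (\<lambda>w. X i w * X j w) else 0)"
    and Sigma_pd: "pos_def d \<Sigma>"
    and \<omega>_pos: "0 < \<omega>"
    and assmA: "\<And>V. V \<in> mat_space d d \<Longrightarrow> mat_frob d d V \<le> 1 / \<omega> \<Longrightarrow>
        (let B = inv_sqrt d \<Sigma>;
             Z = (\<lambda>i w. \<Sum>j<d. B i j * X j w);
             F = (\<lambda>w. exp ((\<Sum>i<d. \<Sum>j<d. Z i w * V i j * Z j w) - mat_trace d V))
         in integrable M F \<and> ln (integral\<^sup>L M F) \<le> \<omega>^2 * (mat_frob d d V)^2)"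
    and l_pos: "0 < l1" "0 < l3"
    and S1: "S1 \<noteq> {}" "S1 \<subseteq> {A \<in> mat_space (p^2) l1. mat_opnorm (p^2) l1 A \<le> 1}"
    and S3: "S3 \<noteq> {}" "S3 \<subseteq> {A \<in> mat_space (r^2) l3. mat_opnorm (r^2) l3 A \<le> 1}"
    and S2: "S2 \<noteq> {}" "S2 \<subseteq> {A \<in> tens_space l1 (q^2) l3. tens_frob l1 (q^2) l3 A \<le> 1}"
    and \<delta>: "0 < \<delta>" "\<delta> < 1"
    and n_large: "real n \<ge> m_param (eff_r1 p q r \<Sigma>) l1 S1 + m_param (eff_r2 p q r \<Sigma>) (l1 * l3) S2
                      + m_param (eff_r3 p q r \<Sigma>) l3 S3 + ln (8 / \<delta>)"
  shows "\<exists>E \<in> sets M. measure M E \<ge> 1 - \<delta> \<and>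
     (\<forall>w \<in> E.
        (let \<Sigma>hat = (\<lambda>i j. if i < d \<and> j < d then (\<Sum>k<n. Xs k i w * Xs k j w) / real n else 0);
             Ehat = (\<lambda>a b c. rearr p q r \<Sigma>hat a b c - rearr p q r \<Sigma> a b c);
             m = m_param (eff_r1 p q r \<Sigma>) l1 S1 + m_param (eff_r2 p q r \<Sigma>) (l1 * l3) S2
                 + m_param (eff_r3 p q r \<Sigma>) l3 S3
         in \<forall>A1 \<in> S1. \<forall>A2 \<in> S2. \<forall>A3 \<in> S3.
              contract (p^2) (q^2) (r^2) l1 l3 A1 A3 Ehat A2
                \<le> 2^7 * \<omega> * mat_opnorm d d \<Sigma> * sqrt ((m + ln (8 / \<delta>)) / real n)))"
proof -
  interpret prob_space M by (rule M)
  let ?Y = "\<lambda>i w. restrict (\<lambda>j. Xs i j w) {..<d}" and ?Z = "\<lambda>w. restrict (\<lambda>j. X j w) {..<d}"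
  let ?PP = "{..<p} \<times> {..<p}" and ?QQ = "{..<q} \<times> {..<q}" and ?RR = "{..<r} \<times> {..<r}" and ?DD = "{..<d} \<times> {..<d}"
  let ?I1 = "?PP \<times> {..<l1}" and ?I2 = "{..<l1} \<times> ?QQ \<times> {..<l3}" and ?I3 = "?RR \<times> {..<l3}"
  define N where "N = mat_opnorm d d \<Sigma>"
  define e1 where "e1 = eff_r1 p q r \<Sigma>"
  define e2 where "e2 = eff_r2 p q r \<Sigma>"
  define e3 where "e3 = eff_r3 p q r \<Sigma>"
  define m1 where "m1 = m_param e1 l1 S1"
  define m2 where "m2 = m_param e2 (l1 * l3) S2"
  define m3 where "m3 = m_param e3 l3 S3"
  define mt where "mt = m1 + m2 + m3 + ln (8 / \<delta>)"
  note ranks = effective_rank_bounds[OF Sigma_pd[unfolded d_def] pqr, folded d_def, folded N_def e1_def e2_def e3_def]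
  note N = ranks(1)
  obtain R where Rex: "(\<forall>i j. R i j = R j i) \<and> (\<forall>i<d. \<forall>j<d. \<Sigma> i j = (\<Sum>m<d. R i m * R j m)) \<and>
    (\<forall>i j. inv_sqrt d \<Sigma> i j = inv_sqrt d \<Sigma> j i) \<and>
    (\<forall>i<d. \<forall>j<d. (\<Sum>k<d. inv_sqrt d \<Sigma> i k * R k j) = (if i = j then 1 else 0))"
    using pos_def_sqrt[OF Sigma_pd] by (elim exE)
  then have R: "\<And>i j. R i j = R j i" "\<And>i j. i < d \<Longrightarrow> j < d \<Longrightarrow> \<Sigma> i j = (\<Sum>m<d. R i m * R j m)"
    and B: "\<And>i j. inv_sqrt d \<Sigma> i j = inv_sqrt d \<Sigma> j i"
      "\<And>i j. i < d \<Longrightarrow> j < d \<Longrightarrow> (\<Sum>k<d. inv_sqrt d \<Sigma> i k * R k j) = (if i = j then 1 else 0)"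
    by auto
  interpret kron_factor p q r d R \<Sigma>
    using R(2) by unfold_locales (simp add: d_def)
  have op1: "mat_opnorm (p\<^sup>2) l1 A \<le> 1" if "A \<in> S1" for A using S1(2) that by auto
  have op3: "mat_opnorm (r\<^sup>2) l3 A \<le> 1" if "A \<in> S3" for A using S3(2) that by auto
  have fr2: "tens_frob l1 (q\<^sup>2) l3 A \<le> 1" if "A \<in> S2" for A using S2(2) that by auto
  have fin: "finite ?PP" "finite ?QQ" "finite ?RR" "finite ?DD" "finite ?I1" "finite ?I2" "finite ?I3" by auto

  obtain \<mu>1 \<gamma>1 s1 where \<mu>1: "prob_space \<mu>1" "sets \<mu>1 = sets (RPi ?I1)"
    and N1: "noise ?I1 s1 \<gamma>1" and s1: "0 \<le> s1" "s1 * e1\<^sup>2 \<le> 1 / 2"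
    and pr1: "\<forall>A\<in>S1. \<exists>L. recentres ?I1 \<gamma>1 m1 (vec1 p A) L \<mu>1"
  proof -
    have m: "(if finite S1 then min (e1\<^sup>2 * real l1) (ln (real (card S1))) else e1\<^sup>2 * real l1) = m1"
      by (simp add: m1_def m_param_def)
    have "0 < e1\<^sup>2" using ranks(2) by simp
    from prior_exists[where e = "vec1 p", OF fin(5) S1(1) this vec1_sum_squares[OF op1], unfolded m]
    show thesis by - (drule meta_mp, assumption, elim exE conjE, rule that)
  qed
  obtain \<mu>2 \<gamma>2 s2 where \<mu>2: "prob_space \<mu>2" "sets \<mu>2 = sets (RPi ?I2)"
    and N2: "noise ?I2 s2 \<gamma>2" and s2: "0 \<le> s2" "s2 * (e2\<^sup>2 * real (l1 * l3)) \<le> 1 / 2"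
    and pr2: "\<forall>A\<in>S2. \<exists>L. recentres ?I2 \<gamma>2 m2 (vec2 q A) L \<mu>2"
  proof -
    \<comment> \<open>For the second prior \<open>R = 1\<close>, and \<open>l1 * l3\<close> is part
      of \<rho> instead: the cost is still the one in \<open>m2\<close>, while the variance shrinks
      enough to pay for the free sums over \<open>s\<close> and \<open>t\<close>.\<close>
    have "(\<Sum>k\<in>?I2. (vec2 q A k)\<^sup>2) \<le> 1" if "A \<in> S2" for A
      using vec2_sum_squares[OF fr2[OF that]]
      unfolding sum.cartesian_product'[of _ "{..<l1}"] sum.cartesian_product'[of _ _ "{..<l3}"] by simp
    moreover have "0 < e2\<^sup>2 * real (l1 * l3)" using ranks(3) l_pos by simp
    ultimately have "\<exists>\<mu> \<gamma> s. prob_space \<mu> \<and> sets \<mu> = sets (RPi ?I2) \<and> noise ?I2 s \<gamma> \<and>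
      0 \<le> s \<and> s * (e2\<^sup>2 * real (l1 * l3)) \<le> 1 / 2 \<and> (\<forall>A\<in>S2. \<exists>L. recentres ?I2 \<gamma>
        (if finite S2 then min (e2\<^sup>2 * real (l1 * l3) * 1) (ln (real (card S2))) else e2\<^sup>2 * real (l1 * l3) * 1) (vec2 q A) L \<mu>)"
      by (intro prior_exists fin(6) S2(1))
    moreover have "(if finite S2 then min (e2\<^sup>2 * real (l1 * l3) * 1) (ln (real (card S2))) else e2\<^sup>2 * real (l1 * l3) * 1) = m2"
      by (simp add: m2_def m_param_def)
    ultimately show thesis by (simp only:) (elim exE conjE, rule that)
  qed
  obtain \<mu>3 \<gamma>3 s3 where \<mu>3: "prob_space \<mu>3" "sets \<mu>3 = sets (RPi ?I3)"
    and N3: "noise ?I3 s3 \<gamma>3" and s3: "0 \<le> s3" "s3 * e3\<^sup>2 \<le> 1 / 2"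
    and pr3: "\<forall>A\<in>S3. \<exists>L. recentres ?I3 \<gamma>3 m3 (vec1 r A) L \<mu>3"
  proof -
    have m: "(if finite S3 then min (e3\<^sup>2 * real l3) (ln (real (card S3))) else e3\<^sup>2 * real l3) = m3"
      by (simp add: m3_def m_param_def)
    have "0 < e3\<^sup>2" using ranks(4) by simp
    from prior_exists[where e = "vec1 r", OF fin(7) S3(1) this vec1_sum_squares[OF op3], unfolded m]
    show thesis by - (drule meta_mp, assumption, elim exE conjE, rule that)
  qed

  have mt: "0 < mt"
    using m_param_nonneg[OF S1(1), of e1 l1] m_param_nonneg[OF S2(1), of e2 "l1 * l3"] m_param_nonneg[OF S3(1), of e3 l3] \<delta>
      ln_gt_zero[of "8 / \<delta>"]
    unfolding mt_def m1_def m2_def m3_def by (simp add: add_nonneg_pos)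
  have mn: "mt \<le> real n" using n_large unfolding mt_def m1_def m2_def m3_def e1_def e2_def e3_def by simp
  then have n: "0 < real n" using mt by linarith
  \<comment> \<open>At the truncation level \<open>64 * N\<close> the matrix scaled by
    \<open>lam\<close> has \<omega> times its norm equal to \<open>sqrt (mt / real n)\<close>; the
    moment bounds of \<open>n\<close> observations then multiply to at most
    \<open>exp mt\<close>.\<close>
  define lam where "lam = sqrt (mt / real n) / (\<omega> * (64 * N))"
  have lam: "0 < lam" using mt n \<omega>_pos N by (simp add: lam_def)
  have lam2: "\<omega>\<^sup>2 * (lam\<^sup>2 * (64 * N)\<^sup>2) = mt / real n"
    using mt n \<omega>_pos N by (simp add: lam_def power_divide power_mult_distrib)

  let ?D = "\<lambda>w i j. if i < d \<and> j < d then (\<Sum>k<n. Xs k i w * Xs k j w) / real n else 0"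
  let ?T = "\<lambda>E x. tform ?PP ?QQ ?RR l1 l3 E (fst x) (fst (snd x)) (snd (snd x))"
  \<comment> \<open>The scale is built into the tensor, and \<open>real n\<close> undoes the
    averaging: the exponent becomes a plain sum over the observations.\<close>
  define E where "E = (\<lambda>w. krear q r (\<lambda>i j. lam * real n * (?D w i j - \<Sigma> i j)))"
  define Q where "Q = (\<lambda>x. \<Sum>e\<in>?DD. (?T (kfac q r R e) x)\<^sup>2)"
  define G where "G = (\<lambda>w x. if Q x \<le> (64 * N)\<^sup>2 then ennreal (exp (?T (E w) x - mt)) else 0)"
  define \<mu> where "\<mu> = \<mu>1 \<Otimes>\<^sub>M (\<mu>2 \<Otimes>\<^sub>M \<mu>3)"
  let ?PM = "RPi ?I1 \<Otimes>\<^sub>M (RPi ?I2 \<Otimes>\<^sub>M RPi ?I3)"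
  have sets_\<mu>: "sets \<mu> = sets ?PM"
    unfolding \<mu>_def by (intro sets_pair_measure_cong \<mu>1 \<mu>2 \<mu>3)
  note [measurable_cong] = sets_\<mu>
  have "prob_space \<mu>"
  proof -
    interpret a: prob_space \<mu>1 by (rule \<mu>1)
    interpret b: prob_space \<mu>2 by (rule \<mu>2)
    interpret c: prob_space \<mu>3 by (rule \<mu>3)
    interpret bc: pair_prob_space \<mu>2 \<mu>3 ..
    interpret abc: pair_prob_space \<mu>1 "\<mu>2 \<Otimes>\<^sub>M \<mu>3" ..
    show ?thesis unfolding \<mu>_def by unfold_locales
  qed

  have Xm: "(\<lambda>w. Xs k j w) \<in> borel_measurable M" if "k < n" "j < d" for k j
    using measurable_compose[OF Xs_meas[OF that(1)] measurable_component_singleton[of j "{..<d}" "\<lambda>_. borel"]] that by simp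
  have Em: "(\<lambda>w. E w a b c) \<in> borel_measurable M" for a b c
  proof -
    have "(\<lambda>w. ?D w i j) \<in> borel_measurable M" for i j
      by (cases "i < d \<and> j < d") (auto intro!: borel_measurable_divide borel_measurable_sum borel_measurable_times Xm)
    then show ?thesis unfolding E_def krear_def
      by (intro borel_measurable_times borel_measurable_diff borel_measurable_const)
  qed
  have Gm: "(\<lambda>(w, x). G w x) \<in> borel_measurable (M \<Otimes>\<^sub>M \<mu>)"
  proof -
    have [measurable]: "(\<lambda>z. ?T (E (fst z)) (snd z)) \<in> borel_measurable (M \<Otimes>\<^sub>M ?PM)"
      using tform_measurable_joint[where E = E and I = ?PP and J = ?QQ and K = ?RR and ?l1.0 = l1 and ?l3.0 = l3, OF Em] by (simp add: split_beta)
    have [measurable]: "Q \<in> borel_measurable ?PM"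
      unfolding Q_def by (intro borel_measurable_sum borel_measurable_power tform_measurable)
    show ?thesis unfolding G_def split_beta by measurable
  qed

  have mgf: "(\<integral>\<^sup>+w. G w x \<partial>M) \<le> 1" for x
  proof (cases "Q x \<le> (64 * N)\<^sup>2")
    case False
    then show ?thesis by (simp add: G_def)
  next
    case True
    obtain V where V: "\<And>D. ?T (krear q r D) x = (\<Sum>i<d. \<Sum>j<d. V i j * D i j)"
      using tform_as_matrix_form[of p q r l1 l3 "fst x" "fst (snd x)" "snd (snd x)"] unfolding d_def by blast
    define U where "U = (\<lambda>i j. lam * V i j)"
    define h where "h = (\<lambda>z. \<Sum>i<d. \<Sum>j<d. U i j * (z i * z j - \<Sigma> i j))"
    have hm: "h \<in> borel_measurable (RPi {..<d})"
      unfolding h_def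
      by (intro borel_measurable_sum borel_measurable_times borel_measurable_diff borel_measurable_const measurable_component_singleton)
    have hY: "h (?Y k w) = (\<Sum>i<d. \<Sum>j<d. U i j * (Xs k i w * Xs k j w - \<Sigma> i j))" for k w
      unfolding h_def by (intro sum.cong refl) auto
    have hY0: "h (?Z w) = (\<Sum>i<d. \<Sum>j<d. U i j * (X i w * X j w - \<Sigma> i j))" for w
      unfolding h_def by (intro sum.cong refl) auto
    have TE: "?T (E w) x = (\<Sum>k<n. h (?Y k w))" for w
    proof -
      have "?T (E w) x = (\<Sum>i<d. \<Sum>j<d. \<Sum>k<n. U i j * (Xs k i w * Xs k j w - \<Sigma> i j))"
        unfolding E_def V
      proof (intro sum.cong refl)
        fix i j assume "i \<in> {..<d}" "j \<in> {..<d}"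
        then have "V i j * (lam * real n * (?D w i j - \<Sigma> i j)) = U i j * ((\<Sum>k<n. Xs k i w * Xs k j w) - real n * \<Sigma> i j)"
          using n by (simp add: U_def field_simps)
        also have "\<dots> = (\<Sum>k<n. U i j * (Xs k i w * Xs k j w - \<Sigma> i j))"
          by (simp add: sum_distrib_left[symmetric] sum_subtractf)
        finally show "V i j * (lam * real n * (?D w i j - \<Sigma> i j)) = (\<Sum>k<n. U i j * (Xs k i w * Xs k j w - \<Sigma> i j))" .
      qed
      also have "\<dots> = (\<Sum>i<d. \<Sum>k<n. \<Sum>j<d. U i j * (Xs k i w * Xs k j w - \<Sigma> i j))" by (intro sum.cong refl sum.swap)
      also have "\<dots> = (\<Sum>k<n. \<Sum>i<d. \<Sum>j<d. U i j * (Xs k i w * Xs k j w - \<Sigma> i j))" by (rule sum.swap)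
      finally show ?thesis by (simp only: hY)
    qed
    define v where "v = (\<Sum>e\<in>?DD. (\<Sum>i<d. \<Sum>j<d. U i j * (R i (fst e) * R j (snd e)))\<^sup>2)"
    \<comment> \<open>\<open>Q x\<close> is the squared Frobenius norm of \<open>R V R\<close>, so
      the truncation in \<open>G\<close> bounds precisely the norm to which Assumption (A)
      refers.\<close>
    have vQ: "v = lam\<^sup>2 * Q x"
      unfolding v_def Q_def kfac_eq_krear V U_def
      by (simp add: sum_distrib_left[symmetric] power_mult_distrib mult.assoc)
    have vm: "\<omega>\<^sup>2 * v \<le> mt / real n"
      unfolding vQ lam2[symmetric] using True by (intro mult_left_mono) auto
    \<comment> \<open>The lower bound on the sample size enters here, as
      \<open>mt \<le> real n\<close>.\<close>
    then have "\<omega>\<^sup>2 * v \<le> 1" using mn n by (smt (verit) divide_le_eq_1_pos)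
    have one: "(\<integral>\<^sup>+w. ennreal (exp (h (?Z w))) \<partial>M) \<le> ennreal (exp (\<omega>\<^sup>2 * v))"
      unfolding hY0 v_def
      by (rule mgf_quadratic_form[OF R B _ \<omega>_pos]) (use assmA \<open>\<omega>\<^sup>2 * v \<le> 1\<close> in \<open>auto simp: Let_def v_def\<close>)
    have "(\<integral>\<^sup>+w. G w x \<partial>M) = (\<integral>\<^sup>+w. ennreal (exp (- mt)) * ennreal (exp (\<Sum>k<n. h (?Y k w))) \<partial>M)"
      using True by (intro nn_integral_cong) (simp add: G_def TE ennreal_mult[symmetric] exp_add[symmetric])
    also have "\<dots> = ennreal (exp (- mt)) * (\<integral>\<^sup>+w. ennreal (exp (\<Sum>k<n. h (?Y k w))) \<partial>M)"
    proof (rule nn_integral_cmult)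
      have "(\<lambda>w. \<Sum>k<n. h (?Y k w)) \<in> borel_measurable M"
        by (intro borel_measurable_sum measurable_compose[OF Xs_meas hm]) auto
      then show "(\<lambda>w. ennreal (exp (\<Sum>k<n. h (?Y k w)))) \<in> borel_measurable M" by measurable
    qed
    also have "\<dots> = ennreal (exp (- mt)) * (\<integral>\<^sup>+w. ennreal (exp (h (?Z w))) \<partial>M) ^ n"
      using nn_integral_exp_iid_sum[OF Xs_indep X_meas Xs_meas Xs_distr hm] by simp
    also have "\<dots> \<le> ennreal (exp (- mt)) * ennreal (exp (\<omega>\<^sup>2 * v)) ^ n"
      by (intro mult_left_mono power_mono one) auto
    also have "\<dots> = ennreal (exp (real n * (\<omega>\<^sup>2 * v) - mt))"
      by (simp add: ennreal_power ennreal_mult[symmetric] exp_of_nat_mult[symmetric] exp_add[symmetric])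
    also have "\<dots> \<le> 1"
    proof -
      have "real n * (\<omega>\<^sup>2 * v) \<le> mt" using vm n by (simp add: pos_le_divide_eq mult.commute)
      then show ?thesis by simp
    qed
    finally show ?thesis .
  qed

  obtain Ev where Ev: "Ev \<in> sets M" "1 - \<delta> \<le> measure M Ev"
    and small: "\<And>w. w \<in> Ev \<Longrightarrow> (\<integral>\<^sup>+x. G w x \<partial>\<mu>) < ennreal (1 / \<delta>)"
    using markov_fubini[OF M \<open>prob_space \<mu>\<close> Gm mgf \<delta>(1)] by auto

  have bound: "contract (p\<^sup>2) (q\<^sup>2) (r\<^sup>2) l1 l3 A1 A3 (\<lambda>a b c. rearr p q r (?D w) a b c - rearr p q r \<Sigma> a b c) A2
      \<le> 2^7 * \<omega> * N * sqrt (mt / real n)" (is "?c \<le> _")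
    if w: "w \<in> Ev" and A: "A1 \<in> S1" "A2 \<in> S2" "A3 \<in> S3" for w A1 A2 A3
  proof -
    let ?t = "tform ?PP ?QQ ?RR l1 l3 (E w) (vec1 p A1) (vec2 q A2) (vec1 r A3)"
    obtain L1 where L1: "recentres ?I1 \<gamma>1 m1 (vec1 p A1) L1 \<mu>1"
      using bspec[OF pr1 A(1)] by auto
    obtain L2 where L2: "recentres ?I2 \<gamma>2 m2 (vec2 q A2) L2 \<mu>2"
      using bspec[OF pr2 A(2)] by auto
    obtain L3 where L3: "recentres ?I3 \<gamma>3 m3 (vec1 r A3) L3 \<mu>3"
      using bspec[OF pr3 A(3)] by auto
    have second: "(\<integral>\<^sup>+g1. \<integral>\<^sup>+g2. \<integral>\<^sup>+g3. ennreal (\<Sum>e\<in>?DD. (tform ?PP ?QQ ?RR l1 l3 (kfac q r R e)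
      (pert ?I1 (vec1 p A1) g1) (pert ?I2 (vec2 q A2) g2) (pert ?I3 (vec1 r A3) g3))\<^sup>2) \<partial>\<gamma>3 \<partial>\<gamma>2 \<partial>\<gamma>1) \<le> ennreal ((64 * N)\<^sup>2 / 16)"
    proof -
      \<comment> \<open>The truncation level gives \<open>(64 * N)^2 / 16 = 256 * N^2\<close>, well
        above \<open>27 / 8 * N^2\<close>.\<close>
      have le: "27 / 8 * N\<^sup>2 \<le> (64 * N)\<^sup>2 / 16" by (simp add: power_mult_distrib)
      show ?thesis
        unfolding tform_second_moment[OF fin(1-4) N1 N2 N3 s1(1) s2(1) s3(1)]
        by (intro ennreal_leI order_trans[OF second_moment_bound[where ?x1.0 = "vec1 p A1" and ?x3.0 = "vec1 r A3" and ?x2.0 = "vec2 q A2" and ?e1.0 = e1 and ?e2.0 = e2 and ?e3.0 = e3, folded d_def, folded N_def] le]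
            vec1_contraction op1 op3 A vec2_sum_squares fr2 s1 s2 s3 ranks less_imp_le[OF ranks(2)] less_imp_le[OF ranks(3)] less_imp_le[OF ranks(4)])
    qed
    have "ennreal (exp (?t - mt - (m1 + m2 + m3)) / 8)
      \<le> (\<integral>\<^sup>+x. G w x \<partial>\<mu>)"
      unfolding G_def Q_def \<mu>_def
      by (rule prior_lower_bound[OF N1 N2 N3 \<mu>1(1) \<mu>2(1) \<mu>3(1) \<mu>1(2) \<mu>2(2) \<mu>3(2) L1 L2 L3 _ second])
        (use N in auto)
    also note small[OF w]
    finally have "exp (?t - mt - (m1 + m2 + m3)) / 8 < 1 / \<delta>"
      using \<delta>(1) by (subst (asm) ennreal_less_iff) auto
    then have "exp (?t - mt - (m1 + m2 + m3)) < 8 / \<delta>"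
      by (simp add: field_simps)
    then have "?t - mt - (m1 + m2 + m3) < ln (8 / \<delta>)"
    proof -
      have "8 / \<delta> = exp (ln (8 / \<delta>))" using \<delta>(1) by simp
      with \<open>_ < 8 / \<delta>\<close> show ?thesis by (metis exp_less_cancel_iff)
    qed
    \<comment> \<open>One \<open>mt\<close> is the constant subtracted in \<open>G\<close>; the
      other is the recentring cost together with \<open>ln (8 / \<delta>)\<close>.\<close>
    then have "?t < 2 * mt" by (simp add: mt_def)
    moreover have "?t = lam * real n *
      ?c"
    proof -
      obtain V where V: "\<And>D. tform ?PP ?QQ ?RR l1 l3 (krear q r D) (vec1 p A1) (vec2 q A2) (vec1 r A3) = (\<Sum>i<d. \<Sum>j<d. V i j * D i j)"
        using tform_as_matrix_form[of p q r l1 l3 "vec1 p A1" "vec2 q A2" "vec1 r A3"] unfolding d_def by blast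
      show ?thesis unfolding contract_eq_tform E_def V
        by (simp add: sum_distrib_left mult.left_commute)
    qed
    \<comment> \<open>Dividing by \<open>lam\<close> brings back the truncation level 64, and
      \<open>2 * 64 = 2^7\<close>.\<close>
    moreover have "lam * real n * (2^7 * \<omega> * N * sqrt (mt / real n)) = 2 * mt"
    proof -
      have "lam * (64 * \<omega> * N) = sqrt (mt / real n)" using \<omega>_pos N by (simp add: lam_def)
      moreover have "lam * real n * (2^7 * \<omega> * N * sqrt (mt / real n)) = 2 * real n * ((lam * (64 * \<omega> * N)) * sqrt (mt / real n))"
        by simp
      ultimately have "lam * real n * (2^7 * \<omega> * N * sqrt (mt / real n)) = 2 * real n * (sqrt (mt / real n) * sqrt (mt / real n))"
        by simp
      also have "sqrt (mt / real n) * sqrt (mt / real n) = mt / real n" using mt n by simp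
      finally show ?thesis using n by simp
    qed
    ultimately have "lam * real n * ?c
      \<le> lam * real n * (2^7 * \<omega> * N * sqrt (mt / real n))" by linarith
    then show ?thesis using lam n by (simp only: mult_le_cancel_left_pos mult_pos_pos)
  qed
  show ?thesis
    using Ev bound unfolding Let_def N_def mt_def m1_def m2_def m3_def e1_def e2_def e3_def by blast
qed

end
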